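(* Let $X,Y$ be proper CAT(0) spaces with base points $\mathfrak o_X$ and $\mathfrak o_Y=\Phi(\mathfrak o_X)$, and let $\Phi:X\to Y$ be a $(k,K)$--quasi-isometry. Then for every $\kappa$ as in the standing assumptions, $\Phi$ induces a homeomorphism $\Phi^\star:\partial_\kappa X\to\partial_\kappa Y$ given by $\Phi^\star([\beta])=[\Phi\circ\beta]$, where $\Phi\circ\beta$ is the composition, adjusted to be a continuous quasi-geodesic ray.
   Context: A $(k,K)$--quasi-isometry is a map with $\frac1k d(x_1,x_2)-K\le d(\Phi x_1,\Phi x_2)\le k\,d(x_1,x_2)+K$ whose image is $K$--dense. For a proper CAT(0) space $X$ with base point $\mathfrak o$: $\|x\|=d_X(\mathfrak o,x)$; $\kappa:[0,\infty)\to[1,\infty)$ monotone increasing, concave, sublinear; $\kappa(x)=\kappa(\|x\|)$; $\mathcal N_\kappa(Z,n)=\{x:d(x,Z)\le n\kappa(x)\}$; quasi-geodesic rays are continuous $(q,Q)$--quasi-isometric embeddings of $[0,\infty)$ starting at $\mathfrak o$; two rays $\kappa$--fellow travel if each lies in some $\mathcal N_\kappa(\cdot,n)$ of the other. $Z$ is $\kappa$--contracting if there is $c_Z$ with $\operatorname{diam}(x_Z\cup y_Z)\le c_Z\kappa(x)$ whenever $d(x,y)\le d(x,Z)$. $\partial_\kappa X$ is the set of $\kappa$--fellow-travelling classes of $\kappa$--contracting quasi-geodesic rays; each class $\mathbf b$ contains a unique geodesic ray $b$. For each $\mathbf b$ fix $m_b:\mathbb R^2\to\mathbb R_+$, $m_b(q,Q)\ge\max(q,Q)$,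 with the strongly Morse property: for all $r,n>0$ and sublinear $\kappa'$ there is $R$ such that every $(q,Q)$--quasi-geodesic ray $\eta$ with $m_b(q,Q)\le r/(2\kappa(r))$ and $d(\eta(t_R),b)\le n\kappa'(R)$ satisfies $\eta|_r\subset\mathcal N_\kappa(b,m_b(q,Q))$ ($t_\rho$ first time with $\|\eta(t_\rho)\|=\rho$, $\eta|_\rho=\eta([0,t_\rho])$). $\mathcal U_\kappa(\mathbf b,r)$ is the set of $\mathbf a$ such that every $(q,Q)$--quasi-geodesic ray $\alpha\in\mathbf a$ with $m_b(q,Q)\le r/(2\kappa(r))$ satisfies $\alpha|_r\subset\mathcal N_\kappa(b,m_b(q,Q))$; a set $\mathcal W$ is open iff each of its points $\mathbf b$ has some $\mathcal U_\kappa(\mathbf b,r)\subset\mathcal W$. *)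

theory Defs
  imports "HOL-Analysis.Analysis"
begin

definition proper_space :: "'a::metric_space set \<Rightarrow> bool" where
  "proper_space S \<longleftrightarrow> (\<forall>x\<in>S. \<forall>r. compact (cball x r \<inter> S))"

definition geodesic_segment :: "(real \<Rightarrow> 'a::metric_space) \<Rightarrow> 'a \<Rightarrow> 'a \<Rightarrow> bool" where
  "geodesic_segment g x y \<longleftrightarrow> g 0 = x \<and> g (dist x y) = y \<and>
     (\<forall>s\<in>{0..dist x y}. \<forall>t\<in>{0..dist x y}. dist (g s) (g t) = \<bar>s - t\<bar>)"

definition geodesic_space :: "'a::metric_space set \<Rightarrow> bool" where
  "geodesic_space S \<longleftrightarrow> (\<forall>x\<in>S. \<forall>y\<in>S. \<exists>g. geodesic_segment g x y \<and> g ` {0..dist x y} \<subseteq> S)"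

text \<open>Pairs (point on a side of a geodesic triangle, its comparison point on the
  corresponding side of a Euclidean comparison triangle a b c).\<close>
definition side_pairs :: "(real \<Rightarrow> 'a::metric_space) \<Rightarrow> 'a \<Rightarrow> 'a \<Rightarrow> real^2 \<Rightarrow> real^2
    \<Rightarrow> ('a \<times> (real^2)) set" where
  "side_pairs g x y a b = {(g s, a + (s / dist x y) *\<^sub>R (b - a)) | s. 0 \<le> s \<and> s \<le> dist x y}"

definition CAT0 :: "'a::metric_space set \<Rightarrow> bool" where
  "CAT0 S \<longleftrightarrow> geodesic_space S \<and>
    (\<forall>x\<in>S. \<forall>y\<in>S. \<forall>z\<in>S. \<forall>g1 g2 g3. \<forall>a b c :: real^2.
       geodesic_segment g1 x y \<and> g1 ` {0..dist x y} \<subseteq> S \<and>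
       geodesic_segment g2 y z \<and> g2 ` {0..dist y z} \<subseteq> S \<and>
       geodesic_segment g3 z x \<and> g3 ` {0..dist z x} \<subseteq> S \<and>
       dist a b = dist x y \<and> dist b c = dist y z \<and> dist c a = dist z x \<longrightarrow>
       (let T = side_pairs g1 x y a b \<union> side_pairs g2 y z b c \<union> side_pairs g3 z x c a in
        \<forall>(p, p')\<in>T. \<forall>(q, q')\<in>T. dist p q \<le> dist p' q'))"

definition quasi_isometry :: "real \<Rightarrow> real \<Rightarrow> ('a::metric_space \<Rightarrow> 'b::metric_space) \<Rightarrow> bool" where
  "quasi_isometry k K \<Phi> \<longleftrightarrow> k \<ge> 1 \<and> K \<ge> 0 \<and>
     (\<forall>x1 x2. dist x1 x2 / k - K \<le> dist (\<Phi> x1) (\<Phi> x2) \<and>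
              dist (\<Phi> x1) (\<Phi> x2) \<le> k * dist x1 x2 + K) \<and>
     (\<forall>y. \<exists>x. dist (\<Phi> x) y \<le> K)"

definition qg_ray :: "'a::metric_space \<Rightarrow> real \<Rightarrow> real \<Rightarrow> (real \<Rightarrow> 'a) \<Rightarrow> bool" where
  "qg_ray bp q Q \<eta> \<longleftrightarrow> q \<ge> 1 \<and> Q \<ge> 0 \<and> continuous_on {0..} \<eta> \<and> \<eta> 0 = bp \<and>
     (\<forall>s\<ge>0. \<forall>t\<ge>0. \<bar>s - t\<bar> / q - Q \<le> dist (\<eta> s) (\<eta> t) \<and>
                    dist (\<eta> s) (\<eta> t) \<le> q * \<bar>s - t\<bar> + Q)"

definition quasi_geodesic_ray :: "'a::metric_space \<Rightarrow> (real \<Rightarrow> 'a) \<Rightarrow> bool" where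
  "quasi_geodesic_ray bp \<eta> \<longleftrightarrow> (\<exists>q Q. qg_ray bp q Q \<eta>)"

definition geodesic_ray :: "'a::metric_space \<Rightarrow> (real \<Rightarrow> 'a) \<Rightarrow> bool" where
  "geodesic_ray bp b \<longleftrightarrow> b 0 = bp \<and> (\<forall>s\<ge>0. \<forall>t\<ge>0. dist (b s) (b t) = \<bar>s - t\<bar>)"

definition ray_img :: "(real \<Rightarrow> 'a) \<Rightarrow> 'a set" where
  "ray_img \<eta> = \<eta> ` {0..}"

definition kappa_fun :: "(real \<Rightarrow> real) \<Rightarrow> bool" where
  "kappa_fun \<kappa> \<longleftrightarrow> (\<forall>t\<ge>0. \<kappa> t \<ge> 1) \<and> mono_on {0..} \<kappa> \<and> concave_on {0..} \<kappa> \<and>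
     ((\<lambda>t. \<kappa> t / t) \<longlongrightarrow> 0) at_top"

definition knbhd :: "'a::metric_space \<Rightarrow> (real \<Rightarrow> real) \<Rightarrow> 'a set \<Rightarrow> real \<Rightarrow> 'a set" where
  "knbhd bp \<kappa> Z n = {x. infdist x Z \<le> n * \<kappa> (dist bp x)}"

definition fellow_travel :: "'a::metric_space \<Rightarrow> (real \<Rightarrow> real) \<Rightarrow> (real \<Rightarrow> 'a) \<Rightarrow> (real \<Rightarrow> 'a) \<Rightarrow> bool" where
  "fellow_travel bp \<kappa> \<alpha> \<beta> \<longleftrightarrow>
     (\<exists>n. ray_img \<alpha> \<subseteq> knbhd bp \<kappa> (ray_img \<beta>) n) \<and> (\<exists>n. ray_img \<beta> \<subseteq> knbhd bp \<kappa> (ray_img \<alpha>) n)"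

definition proj_set :: "'a::metric_space \<Rightarrow> 'a set \<Rightarrow> 'a set" where
  "proj_set x Z = {z\<in>Z. dist x z = infdist x Z}"

definition kcontracting :: "'a::metric_space \<Rightarrow> (real \<Rightarrow> real) \<Rightarrow> 'a set \<Rightarrow> bool" where
  "kcontracting bp \<kappa> Z \<longleftrightarrow> (\<exists>c. \<forall>x y. dist x y \<le> infdist x Z \<longrightarrow>
       diameter (proj_set x Z \<union> proj_set y Z) \<le> c * \<kappa> (dist bp x))"

definition ray_class :: "'a::metric_space \<Rightarrow> (real \<Rightarrow> real) \<Rightarrow> (real \<Rightarrow> 'a) \<Rightarrow> (real \<Rightarrow> 'a) set" where
  "ray_class bp \<kappa> \<beta> = {\<alpha>. quasi_geodesic_ray bp \<alpha> \<and> fellow_travel bp \<kappa> \<alpha> \<beta>}"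

definition kbdry :: "'a::metric_space \<Rightarrow> (real \<Rightarrow> real) \<Rightarrow> (real \<Rightarrow> 'a) set set" where
  "kbdry bp \<kappa> = {ray_class bp \<kappa> \<beta> | \<beta>. quasi_geodesic_ray bp \<beta> \<and> kcontracting bp \<kappa> (ray_img \<beta>)}"

definition first_time :: "'a::metric_space \<Rightarrow> (real \<Rightarrow> 'a) \<Rightarrow> real \<Rightarrow> real" where
  "first_time bp \<eta> \<rho> = Inf {t. 0 \<le> t \<and> dist bp (\<eta> t) = \<rho>}"

definition ray_upto :: "'a::metric_space \<Rightarrow> (real \<Rightarrow> 'a) \<Rightarrow> real \<Rightarrow> 'a set" where
  "ray_upto bp \<eta> \<rho> = \<eta> ` {0..first_time bp \<eta> \<rho>}"

definition strongly_morse ::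
    "'a::metric_space \<Rightarrow> (real \<Rightarrow> real) \<Rightarrow> (real \<Rightarrow> 'a) \<Rightarrow> (real \<Rightarrow> real \<Rightarrow> real) \<Rightarrow> bool" where
  "strongly_morse bp \<kappa> b m \<longleftrightarrow>
     (\<forall>r>0. \<forall>n>0. \<forall>\<kappa>'. kappa_fun \<kappa>' \<longrightarrow> (\<exists>R. \<forall>q Q \<eta>.
        qg_ray bp q Q \<eta> \<and> m q Q \<le> r / (2 * \<kappa> r) \<and>
        infdist (\<eta> (first_time bp \<eta> R)) (ray_img b) \<le> n * \<kappa>' R \<longrightarrow>
        ray_upto bp \<eta> r \<subseteq> knbhd bp \<kappa> (ray_img b) (m q Q)))"

definition morse_gauge ::
    "'a::metric_space \<Rightarrow> (real \<Rightarrow> real) \<Rightarrow> ((real \<Rightarrow> 'a) set \<Rightarrow> real \<Rightarrow> real \<Rightarrow> real) \<Rightarrow> bool" where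
  "morse_gauge bp \<kappa> m \<longleftrightarrow> (\<forall>B\<in>kbdry bp \<kappa>.
     (\<forall>q Q. m B q Q \<ge> max q Q \<and> m B q Q \<ge> 0) \<and>
     (\<forall>b\<in>B. geodesic_ray bp b \<longrightarrow> strongly_morse bp \<kappa> b (m B)))"

definition Unbhd ::
    "'a::metric_space \<Rightarrow> (real \<Rightarrow> real) \<Rightarrow> ((real \<Rightarrow> 'a) set \<Rightarrow> real \<Rightarrow> real \<Rightarrow> real)
     \<Rightarrow> (real \<Rightarrow> 'a) set \<Rightarrow> real \<Rightarrow> (real \<Rightarrow> 'a) set set" where
  "Unbhd bp \<kappa> m B r = {A\<in>kbdry bp \<kappa>. \<forall>b\<in>B. geodesic_ray bp b \<longrightarrow>
     (\<forall>q Q \<alpha>. \<alpha> \<in> A \<and> qg_ray bp q Q \<alpha> \<and> m B q Q \<le> r / (2 * \<kappa> r) \<longrightarrow>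
        ray_upto bp \<alpha> r \<subseteq> knbhd bp \<kappa> (ray_img b) (m B q Q))}"

definition bopen ::
    "'a::metric_space \<Rightarrow> (real \<Rightarrow> real) \<Rightarrow> ((real \<Rightarrow> 'a) set \<Rightarrow> real \<Rightarrow> real \<Rightarrow> real)
     \<Rightarrow> (real \<Rightarrow> 'a) set set \<Rightarrow> bool" where
  "bopen bp \<kappa> m W \<longleftrightarrow> W \<subseteq> kbdry bp \<kappa> \<and> (\<forall>B\<in>W. \<exists>r>0. Unbhd bp \<kappa> m B r \<subseteq> W)"

end

theory Submission
  imports Defs
begin

text \<open>The contracting property does not pass through a quasi-isometry in an obvious way, but the
  Morse property does: a quasi-geodesic ray close to the image of b is pulled back, compared with b,
  and pushed forward again. So the class of a contracting ray is moved in three steps. A contracting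
  ray is fellow-travelled by a geodesic ray b, since geodesics with endpoints on a contracting set
  stay close to it, and b is Morse by the strong Morse property. The image of b is then a Morse
  quasi-geodesic ray, and a limit of geodesics from the base point to its points is a Morse geodesic
  ray b'. Finally a Morse geodesic ray in a CAT(0) space is contracting, by comparison with explicit
  quasi-geodesic detours. Continuity follows from the strong Morse property of b': whether a ray
  belongs to a neighbourhood of the class of b' is decided at one large radius R, and at this radius
  the rays of all classes near the class of b have images close to b'.\<close>

section \<open>The functions $\kappa$ and $\kappa$-neighbourhoods\<close>

text \<open>Contraction is stated with nearest-point projections, which a quasi-isometry need not
  respect; it can only be rebuilt in the target from CAT(0) geometry. The detours used for this have
  multiplicative constant 5 and additive constant 0 whatever their position, so one Morse bound
  controls them all. Errors are multiples of \<open>\<kappa>\<close> at the norm of the point where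
  they are measured, and every comparison changes that point. \<open>kappa_control\<close> converts
  one such error into another. Both the Morse property and the neighbourhoods quantify over all
  quasi-geodesics with given constants. Hence many lemmas obtain their constants before the sets or
  rays to which they apply. The quasi-inverse is chosen to respect base points exactly, and
  \<open>qi_pair\<close> is symmetric. Surjectivity and openness are then injectivity and continuity
  with the spaces exchanged.\<close>

lemma kappa_ge_1: "kappa_fun \<kappa> \<Longrightarrow> 0 \<le> t \<Longrightarrow> 1 \<le> \<kappa> t"
  by (auto simp: kappa_fun_def)

lemma kappa_mono: "kappa_fun \<kappa> \<Longrightarrow> 0 \<le> s \<Longrightarrow> s \<le> t \<Longrightarrow> \<kappa> s \<le> \<kappa> t"
  unfolding kappa_fun_def by (auto intro: mono_onD)

text \<open>Concavity on the segment from \<open>0\<close> to \<open>c * s\<close>, with a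
  nonnegative value at \<open>0\<close>. It makes \<open>\<kappa>\<close> insensitive, up to a
  factor, to the changes of norm that quasi-isometries cause.\<close>

lemma kappa_scale:
  assumes "kappa_fun \<kappa>" "1 \<le> c" "0 \<le> s"
  shows "\<kappa> (c * s) \<le> c * \<kappa> s"
proof -
  have "concave_on {0..} \<kappa>" using assms by (simp add: kappa_fun_def)
  from concave_onD[OF this, of "1/c" 0 "c * s"] assms
  have "\<kappa> s \<ge> (1 - 1/c) * \<kappa> 0 + (1/c) * \<kappa> (c * s)" by (auto simp: field_simps)
  moreover have "(1 - 1/c) * \<kappa> 0 \<ge> 0" using assms kappa_ge_1[of \<kappa> 0] by auto
  ultimately have "\<kappa> s \<ge> (1/c) * \<kappa> (c * s)" by linarith
  then show ?thesis using assms by (simp add: field_simps)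
qed

lemma kappa_scale_le:
  assumes "kappa_fun \<kappa>" "1 \<le> c" "0 \<le> s" "0 \<le> t" "t \<le> c * s"
  shows "\<kappa> t \<le> c * \<kappa> s"
  using kappa_scale[OF assms(1-3)] kappa_mono[OF assms(1) assms(4,5)] by linarith

lemma kappa_sublinear:
  assumes "kappa_fun \<kappa>" "e > 0"
  obtains B where "B \<ge> 0" "\<And>t. 0 \<le> t \<Longrightarrow> \<kappa> t \<le> e * t + B"
proof -
  have "eventually (\<lambda>t. \<kappa> t / t < e) at_top"
    using assms order_tendstoD(2)[of "\<lambda>t. \<kappa> t / t" 0 at_top e] by (auto simp: kappa_fun_def)
  then obtain T where T: "\<And>t. t \<ge> T \<Longrightarrow> \<kappa> t / t < e" by (auto simp: eventually_at_top_linorder)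
  define S where "S = max T 1"
  have *: "\<kappa> t \<le> e * t + \<kappa> S" if "0 \<le> t" for t
  proof (cases "t \<le> S")
    case True
    then have "\<kappa> t \<le> \<kappa> S" using kappa_mono[OF assms(1) that] by auto
    then show ?thesis using that assms(2) by (simp add: add_increasing)
  next
    case False
    then have "\<kappa> t / t < e" "t > 0" using T[of t] by (auto simp: S_def)
    then have "\<kappa> t \<le> e * t" by (simp add: field_simps)
    moreover have "\<kappa> S \<ge> 1" using kappa_ge_1[OF assms(1), of S] by (simp add: S_def)
    ultimately show ?thesis by linarith
  qed
  have "\<kappa> S \<ge> 1" using kappa_ge_1[OF assms(1), of S] by (simp add: S_def)
  then show ?thesis using that[of "\<kappa> S"] * by auto
qed

text \<open>The term \<open>\<kappa> t\<close> on the right of the hypothesis is absorbed: with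
  slope \<open>1 / (2*c)\<close> in \<open>kappa_sublinear\<close> it costs only half of
  \<open>t\<close>, so \<open>t\<close> is at most linear in \<open>s\<close>. The lemma is used
  whenever an error measured at one point has to be expressed at another whose distance is bounded
  by \<open>\<kappa>\<close> at either of them.\<close>

lemma kappa_control:
  assumes "kappa_fun \<kappa>"
  obtains C' where "C' \<ge> 1"
    "\<And>s t. 0 \<le> s \<Longrightarrow> 0 \<le> t \<Longrightarrow> t \<le> C * (s + \<kappa> t + \<kappa> s + 1) \<Longrightarrow> \<kappa> t \<le> C' * \<kappa> s"
proof -
  define c where "c = max C 1"
  obtain B where B: "B \<ge> 0" "\<And>t. 0 \<le> t \<Longrightarrow> \<kappa> t \<le> (1 / (2*c)) * t + B"
    using kappa_sublinear[OF assms, of "1 / (2*c)"] by (auto simp: c_def)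
  \<comment> \<open>For \<open>s \<ge> 1\<close> the constants are at most multiples of
    \<open>s\<close>, giving \<open>t \<le> L * s\<close>; for \<open>s < 1\<close> they give
    \<open>t \<le> L\<close>. The factor \<open>L + \<kappa> L\<close> serves both cases.\<close>
  define L where "L = 4 * c + 4 * c * B + 4 * c + 1"
  have c1: "c \<ge> 1" by (simp add: c_def)
  have L1: "L \<ge> 1" using c1 B(1) by (simp add: L_def)
  have *: "\<kappa> t \<le> (L + \<kappa> L) * \<kappa> s" if st: "0 \<le> s" "0 \<le> t" "t \<le> C * (s + \<kappa> t + \<kappa> s + 1)" for s t
  proof -
    have k: "\<kappa> s \<ge> 1" "\<kappa> t \<ge> 1" "\<kappa> L \<ge> 1" using kappa_ge_1[OF assms] st L1 by auto
    have ks: "c * \<kappa> s \<le> s / 2 + c * B" and kt: "c * \<kappa> t \<le> t / 2 + c * B"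
    proof -
      have "c * ((1 / (2*c)) * r + B) = r / 2 + c * B" for r using c1 by (simp add: field_simps)
      then show "c * \<kappa> s \<le> s / 2 + c * B" "c * \<kappa> t \<le> t / 2 + c * B"
        using mult_left_mono[OF B(2)[OF st(1)], of c] mult_left_mono[OF B(2)[OF st(2)], of c] c1 by auto
    qed
    have "t \<le> c * (s + \<kappa> t + \<kappa> s + 1)"
      using st k mult_right_mono[of C c "s + \<kappa> t + \<kappa> s + 1"] unfolding c_def by linarith
    also have "\<dots> = c * s + c * \<kappa> t + c * \<kappa> s + c" by (simp add: algebra_simps)
    also have "\<dots> \<le> c * s + t / 2 + c * B + (s / 2 + c * B) + c" using ks kt by linarith
    finally have t: "t \<le> 2 * (c * s) + 4 * (c * B) + s + 2 * c" by linarith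
    have cs: "s \<le> c * s" using c1 st(1) mult_right_mono[of 1 c s] by simp
    have cB: "0 \<le> c * B" using c1 B(1) by simp
    show ?thesis
    proof (cases "s \<ge> 1")
      case True
      have "c \<le> c * s" "c * B \<le> c * B * s" using True c1 cB by (simp_all add: mult_le_cancel_left1)
      then have "t \<le> L * s" using t cs st(1) cB unfolding L_def by (simp add: algebra_simps)
      then have "\<kappa> t \<le> L * \<kappa> s" using kappa_scale_le[OF assms L1 st(1,2)] by blast
      also have "\<dots> \<le> (L + \<kappa> L) * \<kappa> s" using k by (intro mult_right_mono) auto
      finally show ?thesis .
    next
      case False
      then have "c * s \<le> c" using c1 by simp
      then have "t \<le> L" using t False c1 cB unfolding L_def by linarith
      then have "\<kappa> t \<le> \<kappa> L" using kappa_mono[OF assms st(2)] by auto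
      also have "\<dots> \<le> (L + \<kappa> L) * 1" using L1 by simp
      also have "\<dots> \<le> (L + \<kappa> L) * \<kappa> s" using k L1 by (intro mult_left_mono) auto
      finally show ?thesis .
    qed
  qed
  show ?thesis
    by (rule that[of "L + \<kappa> L"]) (use * L1 kappa_ge_1[OF assms, of L] in auto)
qed

lemma infdist_near:
  assumes "S \<noteq> {}" "infdist x S < e"
  obtains y where "y \<in> S" "dist x y < e"
  using assms by (auto simp: infdist_notempty cINF_less_iff)

lemma infdist_le_of_near:
  assumes "S \<noteq> {}" "infdist x S \<le> e"
  obtains y where "y \<in> S" "dist x y \<le> e + 1"
  using infdist_near[OF assms(1), of x "e+1"] assms(2) by (metis less_add_one less_imp_le order_le_less_trans)

text \<open>Stated for arbitrary sets because it is also applied to images under a quasi-isometry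
  and to single points. It is one-sided: the error is measured at the points of the first
  set.\<close>

definition kclose :: "'a::metric_space \<Rightarrow> (real \<Rightarrow> real) \<Rightarrow> real \<Rightarrow> 'a set \<Rightarrow> 'a set \<Rightarrow> bool" where
  "kclose bp \<kappa> n S T \<longleftrightarrow> (\<forall>x\<in>S. infdist x T \<le> n * \<kappa> (dist bp x))"

lemma kclose_mono: "kappa_fun \<kappa> \<Longrightarrow> kclose bp \<kappa> n S T \<Longrightarrow> n \<le> m \<Longrightarrow> kclose bp \<kappa> m S T"
  unfolding kclose_def
  by (meson mult_right_mono order_trans kappa_ge_1 zero_le_dist zero_le_one)

lemma kclose_subset_knbhd: "S \<subseteq> knbhd bp \<kappa> T n \<longleftrightarrow> kclose bp \<kappa> n S T"
  by (auto simp: knbhd_def kclose_def)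

lemma fellow_travel_kclose:
  "fellow_travel bp \<kappa> \<alpha> \<beta> \<longleftrightarrow>
     (\<exists>n. kclose bp \<kappa> n (ray_img \<alpha>) (ray_img \<beta>)) \<and> (\<exists>n. kclose bp \<kappa> n (ray_img \<beta>) (ray_img \<alpha>))"
  by (simp add: fellow_travel_def kclose_subset_knbhd)

text \<open>The second error is measured at an intermediate point \<open>y\<close>;
  \<open>kappa_control\<close> moves it to \<open>x\<close>. The constant precedes the sets, which
  keeps Morse bounds uniform under composition.\<close>

lemma kclose_trans:
  assumes \<kappa>: "kappa_fun \<kappa>"
  obtains l where "l \<ge> 0"
    "\<And>S T U. kclose bp \<kappa> n S T \<Longrightarrow> kclose bp \<kappa> m T U \<Longrightarrow> T \<noteq> {} \<Longrightarrow> kclose bp \<kappa> l S U"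
proof -
  define n' where "n' = max n 0 + 1"
  define m' where "m' = max m 0"
  obtain C where C: "C \<ge> 1" "\<And>s t. 0 \<le> s \<Longrightarrow> 0 \<le> t \<Longrightarrow> t \<le> n' * (s + \<kappa> t + \<kappa> s + 1) \<Longrightarrow> \<kappa> t \<le> C * \<kappa> s"
    using kappa_control[OF \<kappa>, of n'] by blast
  have *: "kclose bp \<kappa> (n' + m' * C) S U" if asm: "kclose bp \<kappa> n S T" "kclose bp \<kappa> m T U" "T \<noteq> {}" for S T U
    unfolding kclose_def
  proof
    fix x assume x: "x \<in> S"
    have kx: "\<kappa> (dist bp x) \<ge> 1" using kappa_ge_1[OF \<kappa>] by simp
    have "infdist x T \<le> n * \<kappa> (dist bp x)" using asm(1) x by (auto simp: kclose_def)
    then obtain y where y: "y \<in> T" "dist x y \<le> n * \<kappa> (dist bp x) + 1"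
      using infdist_le_of_near[OF asm(3)] by blast
    have "n * \<kappa> (dist bp x) \<le> max n 0 * \<kappa> (dist bp x)" using kx by (intro mult_right_mono) auto
    then have d: "dist x y \<le> n' * \<kappa> (dist bp x)" using y(2) kx unfolding n'_def distrib_right by linarith
    have ky: "\<kappa> (dist bp y) \<ge> 1" using kappa_ge_1[OF \<kappa>] by simp
    have "dist bp y \<le> dist bp x + n' * \<kappa> (dist bp x)" using d dist_triangle[of bp y x] by linarith
    also have "\<dots> \<le> n' * dist bp x + n' * \<kappa> (dist bp x)"
      using mult_right_mono[of 1 n' "dist bp x"] by (simp add: n'_def)
    also have "\<dots> \<le> n' * (dist bp x + \<kappa> (dist bp y) + \<kappa> (dist bp x) + 1)"
    proof -
      have "n' * (dist bp x + \<kappa> (dist bp x)) \<le> n' * (dist bp x + \<kappa> (dist bp y) + \<kappa> (dist bp x) + 1)"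
        using ky by (intro mult_left_mono) (auto simp: n'_def)
      then show ?thesis by (simp add: algebra_simps)
    qed
    finally have "\<kappa> (dist bp y) \<le> C * \<kappa> (dist bp x)" using C(2) by simp
    then have "m' * \<kappa> (dist bp y) \<le> m' * (C * \<kappa> (dist bp x))" by (intro mult_left_mono) (auto simp: m'_def)
    moreover have "infdist y U \<le> m * \<kappa> (dist bp y)" using asm(2) y by (auto simp: kclose_def)
    moreover have "m * \<kappa> (dist bp y) \<le> m' * \<kappa> (dist bp y)" using ky by (intro mult_right_mono) (auto simp: m'_def)
    ultimately show "infdist x U \<le> (n' + m' * C) * \<kappa> (dist bp x)"
      using d infdist_triangle[of x U y] by (simp add: algebra_simps)
  qed
  show ?thesis by (rule that[of "n' + m' * C"]) (use * C in \<open>auto simp: n'_def m'_def\<close>)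
qed

lemma kclose_bounded:
  assumes "kappa_fun \<kappa>" "\<forall>t\<ge>0. dist (\<alpha> t) (\<beta> t) \<le> D"
  shows "kclose bp \<kappa> D (ray_img \<alpha>) (ray_img \<beta>)"
  unfolding kclose_def ray_img_def
proof clarsimp
  fix t :: real assume t: "0 \<le> t"
  have "0 \<le> D" using assms(2) t by (meson order_trans zero_le_dist)
  then have "D \<le> D * \<kappa> (dist bp (\<alpha> t))" using kappa_ge_1[OF assms(1)] by (simp add: mult_le_cancel_left1)
  moreover have "infdist (\<alpha> t) (\<beta> ` {0..}) \<le> D" using assms(2) t by (intro infdist_le2[of "\<beta> t"]) auto
  ultimately show "infdist (\<alpha> t) (\<beta> ` {0..}) \<le> D * \<kappa> (dist bp (\<alpha> t))" by linarith
qed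

lemma fellow_travel_bounded:
  assumes "kappa_fun \<kappa>" "\<forall>t\<ge>0. dist (\<alpha> t) (\<beta> t) \<le> D"
  shows "fellow_travel bp \<kappa> \<alpha> \<beta>"
  using kclose_bounded[OF assms] kclose_bounded[of \<kappa> \<beta> \<alpha> D] assms
  unfolding fellow_travel_kclose by (auto simp: dist_commute)

lemma ray_img_nonempty [simp]: "ray_img \<alpha> \<noteq> {}"
  by (auto simp: ray_img_def)

lemma ray_imgI: "0 \<le> t \<Longrightarrow> \<alpha> t \<in> ray_img \<alpha>"
  by (auto simp: ray_img_def)

lemma fellow_travel_refl: "kappa_fun \<kappa> \<Longrightarrow> fellow_travel bp \<kappa> \<alpha> \<alpha>"
  by (rule fellow_travel_bounded[of _ _ _ 0]) auto

lemma fellow_travel_sym: "fellow_travel bp \<kappa> \<alpha> \<beta> \<Longrightarrow> fellow_travel bp \<kappa> \<beta> \<alpha>"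
  by (auto simp: fellow_travel_def)

lemma fellow_travel_trans:
  assumes "kappa_fun \<kappa>" "fellow_travel bp \<kappa> \<alpha> \<beta>" "fellow_travel bp \<kappa> \<beta> \<gamma>"
  shows "fellow_travel bp \<kappa> \<alpha> \<gamma>"
  using assms(2,3) unfolding fellow_travel_kclose
  by (metis kclose_trans[OF assms(1)] ray_img_nonempty)

section \<open>Coarse rays\<close>

text \<open>Continuity and base point are split off from \<open>qg_ray\<close>, since composing with
  a quasi-isometry destroys continuity.\<close>

definition coarse_ray :: "real \<Rightarrow> real \<Rightarrow> (real \<Rightarrow> 'a::metric_space) \<Rightarrow> bool" where
  "coarse_ray q Q \<eta> \<longleftrightarrow> q \<ge> 1 \<and> Q \<ge> 0 \<and>
     (\<forall>s\<ge>0. \<forall>t\<ge>0. \<bar>s - t\<bar> / q - Q \<le> dist (\<eta> s) (\<eta> t) \<and> dist (\<eta> s) (\<eta> t) \<le> q * \<bar>s - t\<bar> + Q)"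

lemma qg_ray_coarse: "qg_ray bp q Q \<eta> \<longleftrightarrow> coarse_ray q Q \<eta> \<and> continuous_on {0..} \<eta> \<and> \<eta> 0 = bp"
  by (auto simp: qg_ray_def coarse_ray_def)

lemma coarse_ray_upper: "coarse_ray q Q \<eta> \<Longrightarrow> 0 \<le> s \<Longrightarrow> 0 \<le> t \<Longrightarrow> dist (\<eta> s) (\<eta> t) \<le> q * \<bar>s - t\<bar> + Q"
  by (auto simp: coarse_ray_def)

lemma coarse_ray_lower:
  assumes "coarse_ray q Q \<eta>" "0 \<le> s" "0 \<le> t"
  shows "\<bar>s - t\<bar> \<le> q * (dist (\<eta> s) (\<eta> t) + Q)"
proof -
  have "q \<ge> 1" "\<bar>s - t\<bar> / q - Q \<le> dist (\<eta> s) (\<eta> t)" using assms by (auto simp: coarse_ray_def)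
  then show ?thesis by (simp add: field_simps)
qed

lemma coarse_rayI:
  assumes "q \<ge> 1" "Q \<ge> 0" "\<And>s t. 0 \<le> s \<Longrightarrow> s \<le> t \<Longrightarrow> t - s \<le> q * (dist (\<eta> s) (\<eta> t) + Q)"
    "\<And>s t. 0 \<le> s \<Longrightarrow> s \<le> t \<Longrightarrow> dist (\<eta> s) (\<eta> t) \<le> q * (t - s) + Q"
  shows "coarse_ray q Q \<eta>"
  unfolding coarse_ray_def
proof (intro conjI allI impI assms(1,2))
  fix s t :: real assume st: "0 \<le> s" "0 \<le> t"
  have "\<bar>s - t\<bar> \<le> q * (dist (\<eta> s) (\<eta> t) + Q)" using assms(3)[of s t] assms(3)[of t s] st
    by (cases "s \<le> t") (auto simp: dist_commute)
  then show "\<bar>s - t\<bar> / q - Q \<le> dist (\<eta> s) (\<eta> t)" using assms(1) by (simp add: field_simps)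
  show "dist (\<eta> s) (\<eta> t) \<le> q * \<bar>s - t\<bar> + Q" using assms(4)[of s t] assms(4)[of t s] st
    by (cases "s \<le> t") (auto simp: dist_commute)
qed

lemma coarse_ray_mono:
  assumes "coarse_ray q Q \<eta>" "q \<le> q'" "Q \<le> Q'"
  shows "coarse_ray q' Q' \<eta>"
proof (rule coarse_rayI)
  have qQ: "q \<ge> 1" "Q \<ge> 0" using assms by (auto simp: coarse_ray_def)
  show "q' \<ge> 1" "Q' \<ge> 0" using qQ assms by auto
  fix s t :: real assume st: "0 \<le> s" "s \<le> t"
  have "t - s \<le> q * (dist (\<eta> s) (\<eta> t) + Q)" using coarse_ray_lower[OF assms(1), of s t] st by auto
  also have "\<dots> \<le> q' * (dist (\<eta> s) (\<eta> t) + Q')" using qQ assms by (intro mult_mono) auto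
  finally show "t - s \<le> q' * (dist (\<eta> s) (\<eta> t) + Q')" .
  have "dist (\<eta> s) (\<eta> t) \<le> q * (t - s) + Q" using coarse_ray_upper[OF assms(1), of s t] st by auto
  also have "\<dots> \<le> q' * (t - s) + Q'" using qQ assms st by (intro add_mono mult_right_mono) auto
  finally show "dist (\<eta> s) (\<eta> t) \<le> q' * (t - s) + Q'" .
qed

lemma qg_ray_mono: "qg_ray bp q Q \<eta> \<Longrightarrow> q \<le> q' \<Longrightarrow> Q \<le> Q' \<Longrightarrow> qg_ray bp q' Q' \<eta>"
  by (auto simp: qg_ray_coarse intro: coarse_ray_mono)

lemma coarse_ray_perturb:
  assumes "coarse_ray q Q \<eta>" "\<forall>t\<ge>0. dist (\<theta> t) (\<eta> t) \<le> D"
  shows "coarse_ray q (Q + 2 * D) \<theta>"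
proof (rule coarse_rayI)
  have qQ: "q \<ge> 1" "Q \<ge> 0" using assms by (auto simp: coarse_ray_def)
  have "D \<ge> 0" using assms(2)[rule_format, of 0] zero_le_dist[of "\<theta> 0" "\<eta> 0"] by linarith
  then show "q \<ge> 1" "Q + 2 * D \<ge> 0" using qQ by auto
  fix s t :: real assume st: "0 \<le> s" "s \<le> t"
  have D: "dist (\<theta> s) (\<eta> s) \<le> D" "dist (\<theta> t) (\<eta> t) \<le> D" using assms st by auto
  have 1: "dist (\<eta> s) (\<eta> t) \<le> dist (\<theta> s) (\<theta> t) + 2 * D"
    using D dist_triangle[of "\<eta> s" "\<eta> t" "\<theta> s"] dist_triangle[of "\<theta> s" "\<eta> t" "\<theta> t"]
    by (simp add: dist_commute)
  have "t - s \<le> q * (dist (\<eta> s) (\<eta> t) + Q)" using coarse_ray_lower[OF assms(1), of s t] st by auto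
  also have "\<dots> \<le> q * (dist (\<theta> s) (\<theta> t) + (Q + 2 * D))" using qQ 1 by (intro mult_left_mono) auto
  finally show "t - s \<le> q * (dist (\<theta> s) (\<theta> t) + (Q + 2 * D))" .
  have "dist (\<theta> s) (\<theta> t) \<le> dist (\<eta> s) (\<eta> t) + 2 * D"
    using D dist_triangle[of "\<theta> s" "\<theta> t" "\<eta> s"] dist_triangle[of "\<eta> s" "\<theta> t" "\<eta> t"]
    by (simp add: dist_commute)
  then show "dist (\<theta> s) (\<theta> t) \<le> q * (t - s) + (Q + 2 * D)"
    using coarse_ray_upper[OF assms(1), of s t] st by auto
qed

text \<open>No part of \<open>\<beta>\<close> can be missed. The points \<open>\<alpha> i\<close>
  have near points \<open>\<beta> (s i)\<close>; consecutive ones are at distance of order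
  \<open>K i\<close>, so by the lower quasi-geodesic bound their times differ by no more than that
  order, and every time from \<open>s 0\<close> on lies between two consecutive such times.\<close>

lemma kclose_reverse:
  assumes \<kappa>: "kappa_fun \<kappa>" and \<alpha>: "coarse_ray q Q \<alpha>" and \<beta>: "coarse_ray q' Q' \<beta>"
    and n: "kclose bp \<kappa> n (ray_img \<alpha>) (ray_img \<beta>)"
  obtains m where "kclose bp \<kappa> m (ray_img \<beta>) (ray_img \<alpha>)"
proof -
  define n' where "n' = max n 0 + 1"
  have n'1: "n' \<ge> 1" by (simp add: n'_def)
  have qQ: "q \<ge> 1" "Q \<ge> 0" "q' \<ge> 1" "Q' \<ge> 0" using \<alpha> \<beta> by (auto simp: coarse_ray_def)
  have "\<exists>s\<ge>0. dist (\<alpha> (real i)) (\<beta> s) \<le> n' * \<kappa> (dist bp (\<alpha> (real i)))" for i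
  proof -
    have kx: "\<kappa> (dist bp (\<alpha> i)) \<ge> 1" using kappa_ge_1[OF \<kappa>] by simp
    have "infdist (\<alpha> i) (ray_img \<beta>) \<le> n * \<kappa> (dist bp (\<alpha> i))" using n by (auto simp: kclose_def ray_imgI)
    then obtain y where y: "y \<in> ray_img \<beta>" "dist (\<alpha> i) y \<le> n * \<kappa> (dist bp (\<alpha> i)) + 1"
      using infdist_le_of_near[OF ray_img_nonempty] by blast
    have "n * \<kappa> (dist bp (\<alpha> i)) \<le> max n 0 * \<kappa> (dist bp (\<alpha> i))" using kx by (intro mult_right_mono) auto
    then have "dist (\<alpha> i) y \<le> n' * \<kappa> (dist bp (\<alpha> i))" using y(2) kx unfolding n'_def distrib_right by linarith
    then show ?thesis using y(1) by (auto simp: ray_img_def)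
  qed
  then obtain s where s: "\<And>i. s i \<ge> 0" "\<And>i. dist (\<alpha> (real i)) (\<beta> (s i)) \<le> n' * \<kappa> (dist bp (\<alpha> (real i)))"
    by metis
  define K where "K i = \<kappa> (dist bp (\<alpha> (real i)))" for i :: nat
  have K1: "K i \<ge> 1" for i using kappa_ge_1[OF \<kappa>] by (simp add: K_def)
  obtain C1 where C1: "C1 \<ge> 1" "\<And>s t. 0 \<le> s \<Longrightarrow> 0 \<le> t \<Longrightarrow> t \<le> (q + Q + 1) * (s + \<kappa> t + \<kappa> s + 1) \<Longrightarrow> \<kappa> t \<le> C1 * \<kappa> s"
    using kappa_control[OF \<kappa>, of "q + Q + 1"] by blast
  have KS: "K (Suc i) \<le> C1 * K i" for i
  proof -
    have "dist (\<alpha> (real i)) (\<alpha> (real (Suc i))) \<le> q * 1 + Q" using coarse_ray_upper[OF \<alpha>, of i "real (Suc i)"] by simp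
    then have "dist bp (\<alpha> (real (Suc i))) \<le> dist bp (\<alpha> i) + (q + Q + 1) * 1"
      using dist_triangle[of bp "\<alpha> (real (Suc i))" "\<alpha> i"] by (simp add: algebra_simps)
    also have "\<dots> \<le> (q + Q + 1) * dist bp (\<alpha> i) + (q + Q + 1) * (K (Suc i) + K i + 1)"
    proof (rule add_mono)
      show "dist bp (\<alpha> i) \<le> (q + Q + 1) * dist bp (\<alpha> i)" using mult_right_mono[of 1 "q+Q+1" "dist bp (\<alpha> i)"] qQ by simp
      show "(q + Q + 1) * 1 \<le> (q + Q + 1) * (K (Suc i) + K i + 1)"
        using K1[of i] K1[of "Suc i"] qQ by (intro mult_left_mono) linarith+
    qed
    finally show ?thesis using C1(2)[of "dist bp (\<alpha> i)" "dist bp (\<alpha> (real (Suc i)))"]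
      by (simp add: K_def algebra_simps)
  qed
  define E where "E = q' * (q' * (n' * C1 + n' + q + Q + Q')) + Q' + n'"
  have E0: "E \<ge> 0" using qQ n'1 C1(1) by (simp add: E_def)
  obtain C2 where C2: "C2 \<ge> 1" "\<And>s t. 0 \<le> s \<Longrightarrow> 0 \<le> t \<Longrightarrow> t \<le> (E + 1) * (s + \<kappa> t + \<kappa> s + 1) \<Longrightarrow> \<kappa> t \<le> C2 * \<kappa> s"
    using kappa_control[OF \<kappa>, of "E + 1"] by blast
  \<comment> \<open>Covers the initial times \<open>u < s 0\<close>.\<close>
  define F where "F = q' * s 0 + Q' + n' * K 0"
  have F0: "F \<ge> 0" using qQ n'1 K1[of 0] s(1) by (simp add: F_def)
  obtain B where B: "B \<ge> 0" "\<And>t. 0 \<le> t \<Longrightarrow> \<kappa> t \<le> (1 / (2*n')) * t + B"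
    using kappa_sublinear[OF \<kappa>, of "1 / (2*n')"] n'1 by auto
  have "kclose bp \<kappa> (max F (E * C2)) (ray_img \<beta>) (ray_img \<alpha>)"
    unfolding kclose_def ray_img_def
  proof clarsimp
    fix u :: real assume u: "0 \<le> u"
    have k1: "\<kappa> (dist bp (\<beta> u)) \<ge> 1" using kappa_ge_1[OF \<kappa>] by simp
    show "infdist (\<beta> u) (\<alpha> ` {0..}) \<le> max F (E * C2) * \<kappa> (dist bp (\<beta> u))"
    proof (cases "s 0 \<le> u")
      case False
      have "dist (\<beta> u) (\<beta> (s 0)) \<le> q' * \<bar>u - s 0\<bar> + Q'" using coarse_ray_upper[OF \<beta> u s(1)] .
      also have "\<dots> \<le> q' * s 0 + Q'" using False u qQ by (intro add_right_mono mult_left_mono) auto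
      finally have "dist (\<beta> u) (\<alpha> 0) \<le> F"
        using dist_triangle[of "\<beta> u" "\<alpha> 0" "\<beta> (s 0)"] s(2)[of 0] by (simp add: F_def K_def dist_commute)
      also have "F \<le> max F (E * C2) * \<kappa> (dist bp (\<beta> u))"
        using mult_mono[of F "max F (E * C2)" 1 "\<kappa> (dist bp (\<beta> u))"] F0 k1 by auto
      finally show ?thesis by (intro infdist_le2[of "\<alpha> 0"]) auto
    next
      case True
      \<comment> \<open>The times \<open>s i\<close> need not be monotone; the last index with
        \<open>s i \<le> u\<close> is enough. It exists because the \<open>\<alpha> i\<close> leave
        every ball, whereas the \<open>\<beta> (s i)\<close> with \<open>s i \<le> u\<close> stay in
        one and, by the slope \<open>1 / (2*n')\<close>, differ from \<open>\<alpha> i\<close> by at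
        most half its norm plus a constant.\<close>
      define I where "I = {i. s i \<le> u}"
      have "finite I"
      proof -
        define G where "G = q' * u + Q' + dist bp (\<beta> 0) + n' * B"
        have "real i \<le> q * (2 * G + dist bp (\<alpha> 0) + Q)" if "i \<in> I" for i
        proof -
          have su: "s i \<le> u" using that by (simp add: I_def)
          have "dist (\<beta> 0) (\<beta> (s i)) \<le> q' * s i + Q'" using coarse_ray_upper[OF \<beta>, of 0 "s i"] s(1)[of i] by simp
          also have "\<dots> \<le> q' * u + Q'" using su qQ by auto
          finally have 1: "dist bp (\<beta> (s i)) \<le> q' * u + Q' + dist bp (\<beta> 0)"
            using dist_triangle[of bp "\<beta> (s i)" "\<beta> 0"] by linarith
          have "n' * \<kappa> (dist bp (\<alpha> i)) \<le> n' * ((1 / (2*n')) * dist bp (\<alpha> i) + B)"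
            using B(2)[of "dist bp (\<alpha> i)"] n'1 by (intro mult_left_mono) auto
          also have "\<dots> = dist bp (\<alpha> i) / 2 + n' * B" using n'1 by (simp add: field_simps)
          finally have "dist bp (\<alpha> i) \<le> 2 * G"
            using 1 s(2)[of i] dist_triangle[of bp "\<alpha> i" "\<beta> (s i)"] by (simp add: G_def dist_commute)
          then have "dist (\<alpha> i) (\<alpha> 0) \<le> 2 * G + dist bp (\<alpha> 0)"
            using dist_triangle[of "\<alpha> i" "\<alpha> 0" bp] by (simp add: dist_commute)
          then have "q * (dist (\<alpha> i) (\<alpha> 0) + Q) \<le> q * (2 * G + dist bp (\<alpha> 0) + Q)"
            using qQ by (intro mult_left_mono) auto
          then show ?thesis using coarse_ray_lower[OF \<alpha>, of i 0] by simp
        qed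
        then have "I \<subseteq> {i. i \<le> nat \<lfloor>q * (2 * G + dist bp (\<alpha> 0) + Q)\<rfloor>}"
          by (auto simp: le_nat_floor)
        then show ?thesis by (rule finite_subset) simp
      qed
      moreover have "0 \<in> I" using True by (simp add: I_def)
      ultimately have m: "Max I \<in> I" by (metis Max_in empty_iff)
      have m': "Suc (Max I) \<notin> I" using Max_ge[OF \<open>finite I\<close>] Suc_n_not_le_n by blast
      define i where "i = Max I"
      have i: "s i \<le> u" "u < s (Suc i)" using m m' by (auto simp: I_def i_def)
      have s1: "dist (\<alpha> (real i)) (\<beta> (s i)) \<le> n' * K i" using s(2)[of i] by (simp add: K_def)
      have "dist (\<alpha> (real (Suc i))) (\<beta> (s (Suc i))) \<le> n' * K (Suc i)" using s(2)[of "Suc i"] by (simp add: K_def)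
      also have "\<dots> \<le> n' * (C1 * K i)" using KS n'1 by (intro mult_left_mono) auto
      finally have s2: "dist (\<alpha> (real (Suc i))) (\<beta> (s (Suc i))) \<le> n' * (C1 * K i)" .
      have "dist (\<alpha> (real i)) (\<alpha> (real (Suc i))) \<le> q + Q" using coarse_ray_upper[OF \<alpha>, of i "real (Suc i)"] by simp
      moreover have "dist (\<beta> (s i)) (\<beta> (s (Suc i))) \<le>
        dist (\<alpha> (real i)) (\<beta> (s i)) + dist (\<alpha> (real i)) (\<alpha> (real (Suc i))) + dist (\<alpha> (real (Suc i))) (\<beta> (s (Suc i)))"
        using dist_triangle[of "\<beta> (s i)" "\<beta> (s (Suc i))" "\<alpha> i"] dist_triangle[of "\<alpha> i" "\<beta> (s (Suc i))" "\<alpha> (real (Suc i))"]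
        by (simp add: dist_commute)
      ultimately have d: "dist (\<beta> (s i)) (\<beta> (s (Suc i))) \<le> n' * K i + (q + Q) + n' * (C1 * K i)"
        using s1 s2 by linarith
      have "u - s i \<le> \<bar>s i - s (Suc i)\<bar>" using i by simp
      also have "\<dots> \<le> q' * (dist (\<beta> (s i)) (\<beta> (s (Suc i))) + Q')" using coarse_ray_lower[OF \<beta> s(1) s(1)] .
      also have "\<dots> \<le> q' * (n' * K i + (q + Q) + n' * (C1 * K i) + Q')" using d qQ by (intro mult_left_mono) auto
      finally have "u - s i \<le> q' * (n' * K i + (q + Q) + n' * (C1 * K i) + Q')" .
      then have "dist (\<beta> u) (\<beta> (s i)) \<le> q' * \<bar>u - s i\<bar> + Q'" "q' * \<bar>u - s i\<bar> \<le> q' * (q' * (n' * K i + (q + Q) + n' * (C1 * K i) + Q'))"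
        using coarse_ray_upper[OF \<beta> u s(1)[of i]] qQ i by auto
      have KK: "K i \<ge> 1" by (rule K1)
      have "q + Q \<le> (q + Q) * K i" "Q' \<le> Q' * K i" using KK qQ by (simp_all add: mult_le_cancel_left1)
      then have "n' * K i + (q + Q) + n' * (C1 * K i) + Q' \<le> (n' * C1 + n' + q + Q + Q') * K i"
        by (simp add: algebra_simps)
      then have "q' * (q' * (n' * K i + (q + Q) + n' * (C1 * K i) + Q')) \<le> q' * (q' * ((n' * C1 + n' + q + Q + Q') * K i))"
        using qQ by (intro mult_left_mono) auto
      moreover have "E * K i = q' * (q' * ((n' * C1 + n' + q + Q + Q') * K i)) + Q' * K i + n' * K i"
        by (simp add: E_def algebra_simps)
      moreover have "dist (\<beta> u) (\<beta> (s i)) \<le> q' * (q' * (n' * K i + (q + Q) + n' * (C1 * K i) + Q')) + Q'"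
        using \<open>dist (\<beta> u) (\<beta> (s i)) \<le> _\<close> \<open>q' * \<bar>u - s i\<bar> \<le> _\<close> by linarith
      ultimately have dE: "dist (\<beta> u) (\<alpha> i) \<le> E * K i"
        using s1 \<open>Q' \<le> Q' * K i\<close> dist_triangle[of "\<beta> u" "\<alpha> i" "\<beta> (s i)"] by (simp add: dist_commute)
      have "dist bp (\<alpha> i) \<le> dist bp (\<beta> u) + E * K i"
        using dE dist_triangle[of bp "\<alpha> i" "\<beta> u"] by linarith
      also have "\<dots> \<le> (E + 1) * dist bp (\<beta> u) + (E + 1) * (K i + \<kappa> (dist bp (\<beta> u)) + 1)"
      proof (rule add_mono)
        show "dist bp (\<beta> u) \<le> (E + 1) * dist bp (\<beta> u)" using E0 by (simp add: algebra_simps)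
        show "E * K i \<le> (E + 1) * (K i + \<kappa> (dist bp (\<beta> u)) + 1)" using E0 KK k1 by (intro mult_mono) auto
      qed
      finally have "\<kappa> (dist bp (\<alpha> i)) \<le> C2 * \<kappa> (dist bp (\<beta> u))"
        using C2(2)[of "dist bp (\<beta> u)" "dist bp (\<alpha> i)"] by (simp add: K_def algebra_simps)
      then have "E * K i \<le> E * (C2 * \<kappa> (dist bp (\<beta> u)))" using E0 unfolding K_def by (intro mult_left_mono) auto
      also have "\<dots> \<le> max F (E * C2) * \<kappa> (dist bp (\<beta> u))"
        using k1 by (simp add: mult.assoc[symmetric] mult_right_mono)
      finally show ?thesis using dE by (intro infdist_le2[of "\<alpha> i"]) auto
    qed
  qed
  then show ?thesis using that by blast
qed

section \<open>Geodesics and continuous approximations\<close>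

lemma geodesic_space_segment:
  assumes "geodesic_space (UNIV :: 'a::metric_space set)"
  obtains g where "geodesic_segment g x (y::'a)"
  using assms by (auto simp: geodesic_space_def)

lemma geodesic_segment_dist:
  assumes "geodesic_segment g x y" "0 \<le> s" "s \<le> dist x y" "0 \<le> t" "t \<le> dist x y"
  shows "dist (g s) (g t) = \<bar>s - t\<bar>"
  using assms by (auto simp: geodesic_segment_def)

lemma geodesic_segment_dist_left:
  assumes "geodesic_segment g x y" "0 \<le> s" "s \<le> dist x y"
  shows "dist x (g s) = s"
  using geodesic_segment_dist[OF assms(1), of 0 s] assms by (auto simp: geodesic_segment_def)

lemma geodesic_segment_dist_right:
  assumes "geodesic_segment g x y" "0 \<le> s" "s \<le> dist x y"
  shows "dist (g s) y = dist x y - s"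
  using geodesic_segment_dist[OF assms(1), of s "dist x y"] assms by (auto simp: geodesic_segment_def)

text \<open>Geodesic interpolation between the values at integer times is Lipschitz on unit
  intervals. It stays within \<open>2 * (q + Q)\<close> of \<open>\<eta>\<close>, so the additive
  constant becomes \<open>Q + 4 * (q + Q)\<close>, rounded up. This is the adjustment to a
  continuous ray.\<close>

lemma tame:
  fixes \<eta> :: "real \<Rightarrow> 'a::metric_space"
  assumes X: "geodesic_space (UNIV :: 'a set)" and \<eta>: "coarse_ray q Q \<eta>"
  obtains \<theta> where "qg_ray (\<eta> 0) q (5 * (q + Q)) \<theta>" "\<forall>t\<ge>0. dist (\<theta> t) (\<eta> t) \<le> 2 * (q + Q)"
proof -
  have qQ: "q \<ge> 1" "Q \<ge> 0" using \<eta> by (auto simp: coarse_ray_def)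
  define L where "L = q + Q"
  have L1: "L \<ge> 1" using qQ by (simp add: L_def)
  define l where "l n = dist (\<eta> (real n)) (\<eta> (real (Suc n)))" for n
  have lL: "l n \<le> L" for n using coarse_ray_upper[OF \<eta>, of n "real (Suc n)"] by (simp add: l_def L_def)
  obtain G where G: "\<And>n. geodesic_segment (G n) (\<eta> (real n)) (\<eta> (real (Suc n)))"
  proof -
    have "\<forall>n. \<exists>g. geodesic_segment g (\<eta> (real n)) (\<eta> (real (Suc n)))"
      using X by (auto simp: geodesic_space_def)
    then show ?thesis using that by metis
  qed
  define \<theta> where "\<theta> t = G (nat \<lfloor>t\<rfloor>) ((t - of_int \<lfloor>t\<rfloor>) * l (nat \<lfloor>t\<rfloor>))" for t
  have piece: "\<theta> t = G n ((t - real n) * l n)" if "real n \<le> t" "t \<le> real (Suc n)" for n t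
  proof (cases "t = real (Suc n)")
    case True
    then have "\<lfloor>t\<rfloor> = int (Suc n)" by (metis floor_of_nat)
    then have "nat \<lfloor>t\<rfloor> = Suc n" by simp
    then have "\<theta> t = G (Suc n) 0" using True unfolding \<theta>_def \<open>\<lfloor>t\<rfloor> = int (Suc n)\<close> by simp
    then have "\<theta> t = \<eta> (real (Suc n))" using G[of "Suc n"] by (auto simp: geodesic_segment_def)
    then show ?thesis using True G[of n] by (auto simp: geodesic_segment_def l_def)
  next
    case False
    then have "\<lfloor>t\<rfloor> = int n" using that by (intro floor_unique) auto
    then show ?thesis by (simp add: \<theta>_def)
  qed
  have lip: "dist (\<theta> s) (\<theta> t) \<le> L * \<bar>s - t\<bar>"
    if "real n \<le> t" "t \<le> real (Suc n)" "real n \<le> s" "s \<le> real (Suc n)" for n s t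
  proof -
    have l0: "l n \<ge> 0" by (simp add: l_def)
    have "dist (\<theta> s) (\<theta> t) = \<bar>(s - real n) * l n - (t - real n) * l n\<bar>"
      using piece[of n s] piece[of n t] that mult_right_mono[of "s - n" 1 "l n"] mult_right_mono[of "t - n" 1 "l n"]
      by (auto intro!: geodesic_segment_dist[OF G] simp: l_def)
    also have "\<dots> = \<bar>s - t\<bar> * l n" using l0 by (simp add: abs_mult flip: left_diff_distrib)
    also have "\<dots> \<le> \<bar>s - t\<bar> * L" using lL by (intro mult_left_mono) auto
    finally show ?thesis by (simp add: mult.commute)
  qed
  have cont: "continuous_on {real n..real (Suc n)} \<theta>" for n
  proof (rule continuous_onI)
    fix x e :: real assume x: "x \<in> {real n..real (Suc n)}" and e: "0 < e"
    show "\<exists>d>0. \<forall>x'\<in>{real n..real (Suc n)}. dist x' x < d \<longrightarrow> dist (\<theta> x') (\<theta> x) \<le> e"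
    proof (intro exI[of _ "e / L"] conjI ballI impI)
      show "0 < e / L" using e L1 by simp
      fix x' assume x': "x' \<in> {real n..real (Suc n)}" "dist x' x < e / L"
      have "dist (\<theta> x') (\<theta> x) \<le> L * \<bar>x' - x\<bar>" using lip[of n x x'] x x' by auto
      also have "\<dots> \<le> e" using x'(2) L1 by (simp add: dist_real_def field_simps)
      finally show "dist (\<theta> x') (\<theta> x) \<le> e" .
    qed
  qed
  have cont': "continuous_on {0..real n} \<theta>" for n
  proof (induction n)
    case (Suc n)
    have "{0..real (Suc n)} = {0..real n} \<union> {real n..real (Suc n)}" by auto
    then show ?case using continuous_on_closed_Un[OF _ _ Suc cont[of n]] by (metis closed_atLeastAtMost)
  qed simp
  have C: "continuous_on {0..} \<theta>"
  proof -
    have "continuous (at t within {0..}) \<theta>" if "t \<ge> 0" for t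
    proof -
      obtain n :: nat where n: "t < real n" using reals_Archimedean2 by blast
      have "continuous (at t within {0..real n}) \<theta>"
        using cont'[of n] that n by (auto simp: continuous_on_eq_continuous_within)
      moreover have "at t within {0..real n} = at t within {0..}"
        by (rule at_within_nhd[of _ "{..<real n}"]) (use n in auto)
      ultimately show ?thesis by (simp add: continuous_within)
    qed
    then show ?thesis by (auto simp: continuous_on_eq_continuous_within)
  qed
  have close: "dist (\<theta> t) (\<eta> t) \<le> 2 * L" if t: "t \<ge> 0" for t
  proof -
    define n where "n = nat \<lfloor>t\<rfloor>"
    have n: "real n \<le> t" "t \<le> real (Suc n)" using t by (auto simp: n_def) linarith
    have e: "\<theta> (real n) = \<eta> (real n)" using piece[of n n] G[of n] by (auto simp: geodesic_segment_def)
    have "dist (\<theta> t) (\<theta> (real n)) \<le> L * \<bar>t - real n\<bar>" using lip[of n "real n" t] n by auto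
    also have "\<dots> \<le> L * 1" using n L1 by (intro mult_left_mono) auto
    finally have 1: "dist (\<theta> t) (\<eta> (real n)) \<le> L" using e by simp
    have "dist (\<eta> (real n)) (\<eta> t) \<le> q * \<bar>real n - t\<bar> + Q" using coarse_ray_upper[OF \<eta>] t by auto
    also have "\<dots> \<le> q * 1 + Q" using n qQ by (intro add_right_mono mult_left_mono) auto
    finally show ?thesis using 1 dist_triangle[of "\<theta> t" "\<eta> t" "\<eta> (real n)"] by (simp add: L_def)
  qed
  have "\<theta> 0 = \<eta> 0" using piece[of 0 0] G[of 0] by (auto simp: geodesic_segment_def)
  moreover have "coarse_ray q (Q + 2 * (2 * L)) \<theta>" using coarse_ray_perturb[OF \<eta>] close by blast
  then have "coarse_ray q (5 * (q + Q)) \<theta>" by (rule coarse_ray_mono) (use qQ in \<open>auto simp: L_def\<close>)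
  ultimately show ?thesis using that[of \<theta>] C close by (auto simp: qg_ray_coarse L_def)
qed

text \<open>In each ball about \<open>bp\<close> the ray agrees with its restriction to a compact
  time interval, because the lower bound forces it out of the ball afterwards.\<close>

lemma closed_coarse_ray:
  assumes X: "proper_space (UNIV :: 'a::metric_space set)" and \<beta>: "qg_ray bp q Q (\<beta> :: real \<Rightarrow> 'a)"
  shows "closed (ray_img \<beta>)"
proof -
  have c: "coarse_ray q Q \<beta>" "continuous_on {0..} \<beta>" "\<beta> 0 = bp" using \<beta> by (auto simp: qg_ray_coarse)
  have "\<exists>T. closed T \<and> ray_img \<beta> \<inter> cball bp r = T \<inter> cball bp r" for r
  proof (intro exI conjI)
    define N where "N = q * (\<bar>r\<bar> + Q)"
    show "closed (\<beta> ` {0..N})"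
      using c(2) by (intro compact_imp_closed compact_continuous_image) (auto intro: continuous_on_subset)
    have "t \<le> N" if "t \<ge> 0" "dist bp (\<beta> t) \<le> r" for t
    proof -
      have "t \<le> q * (dist (\<beta> 0) (\<beta> t) + Q)" using coarse_ray_lower[OF c(1), of 0 t] that by auto
      also have "\<dots> \<le> N" unfolding N_def using that c by (intro mult_left_mono) (auto simp: coarse_ray_def)
      finally show ?thesis .
    qed
    then show "ray_img \<beta> \<inter> cball bp r = \<beta> ` {0..N} \<inter> cball bp r" by (auto simp: ray_img_def)
  qed
  then have *: "closed (ray_img \<beta> \<inter> cball bp r)" for r by (metis closed_Int closed_cball)
  show ?thesis unfolding closed_sequential_limits
  proof safe
    fix x l assume x: "\<forall>n. x n \<in> ray_img \<beta>" "x \<longlonglongrightarrow> l"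
    have "bounded (range x)" using x(2) by (rule convergent_imp_bounded)
    then obtain r where "\<And>n. dist bp (x n) \<le> r" unfolding bounded_any_center[where a=bp] by auto
    then have "\<forall>n. x n \<in> ray_img \<beta> \<inter> cball bp r" using x by auto
    then show "l \<in> ray_img \<beta>" using *[of r] x(2) unfolding closed_sequential_limits by blast
  qed
qed

lemma proj_set_nonempty:
  assumes X: "proper_space (UNIV :: 'a::metric_space set)" and "closed (Z :: 'a set)" "Z \<noteq> {}"
  obtains p where "p \<in> Z" "dist x p = infdist x Z"
proof -
  obtain z where z: "z \<in> Z" using assms(3) by blast
  have "compact (cball x (dist x z) \<inter> Z)"
    using X assms(2) unfolding proper_space_def by (simp add: compact_Int_closed)
  moreover have "cball x (dist x z) \<inter> Z \<noteq> {}" using z by auto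
  ultimately have "\<exists>p\<in>cball x (dist x z) \<inter> Z. \<forall>y\<in>cball x (dist x z) \<inter> Z. dist x p \<le> dist x y"
    by (intro continuous_attains_inf continuous_intros)
  then obtain p where p: "p \<in> cball x (dist x z) \<inter> Z" "\<And>y. y \<in> cball x (dist x z) \<inter> Z \<Longrightarrow> dist x p \<le> dist x y"
    by blast
  have "dist x p \<le> dist x y" if "y \<in> Z" for y
    using p(1) p(2)[of y] that by (cases "dist x y \<le> dist x z") auto
  then have "dist x p \<le> infdist x Z" using assms(3) by (auto simp: infdist_notempty intro: cINF_greatest)
  moreover have "infdist x Z \<le> dist x p" using p by (auto intro: infdist_le)
  ultimately show ?thesis using that p by force
qed

section \<open>Comparison inequalities in CAT(0) spaces\<close>

lemma comparison_triangle:
  fixes A B C :: real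
  assumes "A \<ge> 0" "B \<ge> 0" "C \<ge> 0" "A \<le> B + C" "B \<le> A + C" "C \<le> A + B"
  obtains a b c :: "real^2" where "dist a b = A" "dist b c = B" "dist c a = C"
proof -
  define e1 e2 :: "real^2" where "e1 = axis 1 1" and "e2 = axis 2 1"
  have n: "norm (x *\<^sub>R e1 + y *\<^sub>R e2) = sqrt (x\<^sup>2 + y\<^sup>2)" for x y
    by (simp add: norm_vec_def L2_set_def sum_2 e1_def e2_def axis_def)
  show ?thesis
  proof (cases "A = 0")
    case True
    then have "B = C" using assms by auto
    then show ?thesis using that[of 0 0 "C *\<^sub>R e1"] True assms n[of C 0] n[of "-C" 0] by (auto simp: dist_norm)
  next
    case False
    \<comment> \<open>With \<open>a\<close> at the origin and \<open>b\<close> on the first axis,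
      the law of cosines prescribes the first coordinate of \<open>c\<close>. The triangle
      inequalities amount to \<open>\<bar>x\<bar> \<le> C\<close>, which makes the second coordinate
      real.\<close>
    define x where "x = (A\<^sup>2 + C\<^sup>2 - B\<^sup>2) / (2 * A)"
    have Ax: "2 * A * x = A\<^sup>2 + C\<^sup>2 - B\<^sup>2" using False by (simp add: x_def)
    have "\<bar>x\<bar> \<le> C"
    proof -
      have "(A - C)\<^sup>2 \<le> B\<^sup>2" using assms by (intro power2_le_iff_abs_le[THEN iffD2]) auto
      moreover have "B\<^sup>2 \<le> (A + C)\<^sup>2" using assms by (intro power_mono) auto
      ultimately have "2 * A * x \<le> 2 * A * C" "2 * A * (-C) \<le> 2 * A * x" unfolding Ax by (auto simp: power2_eq_square algebra_simps)
      then have "2 * A * x \<le> 2 * A * C" "2 * A * (-C) \<le> 2 * A * x" by auto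
      moreover have "2 * A > 0" using False assms(1) by simp
      ultimately have "x \<le> C" "- C \<le> x" using mult_le_cancel_left_pos by blast+
      then show ?thesis by linarith
    qed
    then have x2: "x\<^sup>2 \<le> C\<^sup>2" using assms(3) by (simp add: abs_le_square_iff[symmetric])
    define y where "y = sqrt (C\<^sup>2 - x\<^sup>2)"
    have y2: "y\<^sup>2 = C\<^sup>2 - x\<^sup>2" using x2 by (simp add: y_def)
    let ?c = "x *\<^sub>R e1 + y *\<^sub>R e2"
    have "dist 0 (A *\<^sub>R e1) = A" using n[of A 0] assms by (simp add: dist_norm)
    moreover have "dist ?c 0 = C" using n[of x y] y2 assms by (simp add: dist_norm)
    moreover have "dist (A *\<^sub>R e1) ?c = B"
    proof -
      have "A *\<^sub>R e1 - ?c = (A - x) *\<^sub>R e1 + (- y) *\<^sub>R e2" by (simp add: algebra_simps)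
      then have "dist (A *\<^sub>R e1) ?c = norm ((A - x) *\<^sub>R e1 + (- y) *\<^sub>R e2)" by (simp only: dist_norm)
      also have "\<dots> = sqrt ((A - x)\<^sup>2 + y\<^sup>2)" using n[of "A-x" "-y"] by simp
      finally have "dist (A *\<^sub>R e1) ?c = sqrt ((A - x)\<^sup>2 + y\<^sup>2)" .
      also have "(A - x)\<^sup>2 + y\<^sup>2 = A\<^sup>2 + C\<^sup>2 - 2 * A * x" using y2 by (simp add: power2_eq_square algebra_simps)
      also have "\<dots> = B\<^sup>2" using Ax by simp
      finally show ?thesis using assms by simp
    qed
    ultimately show ?thesis using that by blast
  qed
qed

text \<open>Stewart's theorem becomes an inequality. A point w with d x w + d w y = d x y lies on
  a geodesic from x to y, so it need not be given by a parametrization.\<close>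
lemma stewart:
  fixes x y z w :: "'a::metric_space"
  assumes X: "CAT0 (UNIV :: 'a set)" and w: "dist x w + dist w y = dist x y"
  shows "dist x y * (dist z w)\<^sup>2 \<le> dist w y * (dist z x)\<^sup>2 + dist x w * (dist z y)\<^sup>2
           - dist x w * dist w y * dist x y"
proof (cases "dist x y = 0")
  case True
  then have "dist x w = 0" "dist w y = 0" using w by (metis add_nonneg_eq_0_iff zero_le_dist)+
  then show ?thesis using True by simp
next
  case False
  define L where "L = dist x y"
  define s where "s = dist x w"
  have L: "L > 0" using False by (simp add: L_def)
  have s: "0 \<le> s" "s \<le> L" "dist w y = L - s" using w by (auto simp: s_def L_def) (metis le_add_same_cancel1 zero_le_dist)
  have gX: "geodesic_space (UNIV :: 'a set)" using X by (simp add: CAT0_def)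
  obtain g1 where g1: "geodesic_segment g1 x w" by (rule geodesic_space_segment[OF gX])
  obtain g2 where g2: "geodesic_segment g2 w y" by (rule geodesic_space_segment[OF gX])
  \<comment> \<open>\<open>CAT0\<close> speaks of parametrized sides. Geodesics from
    \<open>x\<close> to \<open>w\<close> and from \<open>w\<close> to \<open>y\<close> concatenate
    to a geodesic because their lengths add up to \<open>dist x y\<close>.\<close>
  define g where "g t = (if t \<le> s then g1 t else g2 (t - s))" for t
  have gs: "g s = w" using g1 by (simp add: g_def geodesic_segment_def s_def)
  have seg: "geodesic_segment g x y"
    unfolding geodesic_segment_def
  proof (intro conjI ballI)
    show "g 0 = x" using g1 s by (simp add: g_def geodesic_segment_def)
    show "g (dist x y) = y"
    proof (cases "L = s")
      case True
      then have "w = y" using s by auto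
      then show ?thesis using gs True by (simp add: L_def)
    next
      case False
      then have "g (dist x y) = g2 (dist w y)" using s by (auto simp: g_def L_def)
      then show ?thesis using g2 by (simp add: geodesic_segment_def)
    qed
    have mix: "dist (g a) (g b) = b - a" if "0 \<le> a" "a \<le> b" "b \<le> L" for a b
    proof -
      consider "b \<le> s" | "s < a" | "a \<le> s" "s < b" by linarith
      then show ?thesis
      proof cases
        case 1 then show ?thesis using geodesic_segment_dist[OF g1, of a b] that by (auto simp: g_def s_def)
      next
        case 2 then show ?thesis using geodesic_segment_dist[OF g2, of "a - s" "b - s"] that s by (auto simp: g_def)
      next
        case 3
        have 1: "dist (g a) w = s - a" "dist x (g a) = a"
          using 3 that geodesic_segment_dist_right[OF g1, of a] geodesic_segment_dist_left[OF g1, of a] by (auto simp: g_def s_def)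
        have 2: "dist w (g b) = b - s" "dist (g b) y = L - b"
          using 3 that s geodesic_segment_dist_right[OF g2, of "b - s"] geodesic_segment_dist_left[OF g2, of "b - s"] by (auto simp: g_def)
        have "L \<le> a + dist (g a) (g b) + (L - b)"
          using 1 2 dist_triangle[of x y "g a"] dist_triangle[of "g a" y "g b"] by (simp add: L_def)
        moreover have "dist (g a) (g b) \<le> b - a" using 1 2 dist_triangle[of "g a" "g b" w] by simp
        ultimately show ?thesis by simp
      qed
    qed
    fix a b assume "a \<in> {0..dist x y}" "b \<in> {0..dist x y}"
    then show "dist (g a) (g b) = \<bar>a - b\<bar>"
      using mix[of a b] mix[of b a] by (cases "a \<le> b") (auto simp: L_def dist_commute)
  qed
  obtain h where h: "geodesic_segment h y z" by (rule geodesic_space_segment[OF gX])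
  obtain k where k: "geodesic_segment k z x" by (rule geodesic_space_segment[OF gX])
  obtain a b c :: "real^2" where abc: "dist a b = dist x y" "dist b c = dist y z" "dist c a = dist z x"
    by (rule comparison_triangle[of "dist x y" "dist y z" "dist z x"])
      (use dist_triangle[of x y z] dist_triangle[of y z x] dist_triangle[of z x y] in \<open>auto simp: dist_commute\<close>)
  have "(w, a + (s / dist x y) *\<^sub>R (b - a)) \<in> side_pairs g x y a b"
    unfolding side_pairs_def using gs s by (auto simp: L_def)
  moreover have "(z, b + (dist y z / dist y z) *\<^sub>R (c - b)) \<in> side_pairs h y z b c"
    unfolding side_pairs_def using h
    by (auto simp: geodesic_segment_def intro!: exI[of _ "dist y z"])
  \<comment> \<open>For \<open>y = z\<close> the quotient has the default value \<open>0\<close> and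
    the point is \<open>b\<close>, which then coincides with \<open>c\<close>.\<close>
  moreover have "b + (dist y z / dist y z) *\<^sub>R (c - b) = c" using abc by (cases "y = z") auto
  ultimately have mem: "(w, a + (s / dist x y) *\<^sub>R (b - a)) \<in> side_pairs g x y a b \<union> side_pairs h y z b c \<union> side_pairs k z x c a"
    "(z, c) \<in> side_pairs g x y a b \<union> side_pairs h y z b c \<union> side_pairs k z x c a"
    by auto
  have "\<forall>(p, p')\<in>side_pairs g x y a b \<union> side_pairs h y z b c \<union> side_pairs k z x c a.
      \<forall>(q, q')\<in>side_pairs g x y a b \<union> side_pairs h y z b c \<union> side_pairs k z x c a. dist p q \<le> dist p' q'"
    using X[unfolded CAT0_def Let_def, THEN conjunct2, rule_format, of x y z g h k a b c] seg h k abc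
    by simp
  from bspec[OF bspec[OF this mem(2), unfolded split_conv] mem(1), unfolded split_conv]
  have "dist z w \<le> dist c (a + (s / dist x y) *\<^sub>R (b - a))" .
  also have "a + (s / dist x y) *\<^sub>R (b - a) = (1 - s/L) *\<^sub>R a + (s/L) *\<^sub>R b" by (simp add: L_def algebra_simps)
  finally have d: "(dist z w)\<^sup>2 \<le> (dist c ((1 - s/L) *\<^sub>R a + (s/L) *\<^sub>R b))\<^sup>2" by (rule power_mono) simp
  \<comment> \<open>Stewart's theorem in the plane, as an identity for the point at parameter
    \<open>u\<close>.\<close>
  have E: "(dist c ((1 - u) *\<^sub>R a + u *\<^sub>R b))\<^sup>2 = (1 - u) * (dist c a)\<^sup>2 + u * (dist b c)\<^sup>2 - u * (1 - u) * (dist a b)\<^sup>2" for u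
    unfolding dist_norm power2_norm_eq_inner
    by (simp add: algebra_simps inner_commute power2_eq_square)
  have "L * (dist z w)\<^sup>2 \<le> L * ((1 - s/L) * (dist z x)\<^sup>2 + (s/L) * (dist z y)\<^sup>2 - (s/L) * (1 - s/L) * L\<^sup>2)"
    using d E[of "s/L"] abc L unfolding L_def[symmetric] by (intro mult_left_mono) (auto simp: dist_commute)
  also have "\<dots> = (L - s) * (dist z x)\<^sup>2 + s * (dist z y)\<^sup>2 - s * (L - s) * L"
    using L by (simp add: field_simps power2_eq_square)
  finally show ?thesis using s by (simp add: L_def s_def)
qed

text \<open>The law of cosines at the vertex x of the comparison triangle of x, a, c.\<close>
lemma fork:
  fixes x a c p q :: "'a::metric_space"
  assumes X: "CAT0 (UNIV :: 'a set)"
    and p: "dist x p + dist p a = dist x a" and q: "dist x q + dist q c = dist x c"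
  shows "dist x a * dist x c * (dist p q)\<^sup>2 \<le> dist x a * dist x c * ((dist x p)\<^sup>2 + (dist x q)\<^sup>2)
     - dist x p * dist x q * ((dist x a)\<^sup>2 + (dist x c)\<^sup>2 - (dist a c)\<^sup>2)"
proof -
  define A C s v where "A = dist x a" and "C = dist x c" and "s = dist x p" and "v = dist x q"
  have sv: "dist p a = A - s" "dist q c = C - v" "s \<ge> 0" "v \<ge> 0" "A \<ge> 0" "C \<ge> 0" using p q by (auto simp: A_def C_def s_def v_def)
  \<comment> \<open>Stewart first for \<open>p\<close> seen from \<open>c\<close>, then for
    \<open>q\<close> seen from \<open>p\<close>. Denominators stay cleared, so sides of length
    \<open>0\<close> are covered.\<close>
  have 1: "A * (dist c p)\<^sup>2 \<le> (A - s) * C\<^sup>2 + s * (dist a c)\<^sup>2 - s * (A - s) * A"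
    using stewart[OF X p, of c] sv by (simp add: A_def C_def s_def v_def dist_commute)
  have 2: "C * (dist p q)\<^sup>2 \<le> (C - v) * s\<^sup>2 + v * (dist c p)\<^sup>2 - v * (C - v) * C"
    using stewart[OF X q, of p] sv by (simp add: A_def C_def s_def v_def dist_commute)
  have "A * (C * (dist p q)\<^sup>2) \<le> A * ((C - v) * s\<^sup>2 + v * (dist c p)\<^sup>2 - v * (C - v) * C)"
    using 2 sv by (intro mult_left_mono) auto
  also have "\<dots> = A * (C - v) * s\<^sup>2 - A * v * (C - v) * C + v * (A * (dist c p)\<^sup>2)" by (simp add: algebra_simps)
  also have "\<dots> \<le> A * (C - v) * s\<^sup>2 - A * v * (C - v) * C + v * ((A - s) * C\<^sup>2 + s * (dist a c)\<^sup>2 - s * (A - s) * A)"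
    using 1 sv by (intro add_left_mono mult_left_mono) auto
  also have "\<dots> = A * C * (s\<^sup>2 + v\<^sup>2) - s * v * (A\<^sup>2 + C\<^sup>2 - (dist a c)\<^sup>2)"
    by (simp add: algebra_simps power2_eq_square)
  finally show ?thesis by (simp add: A_def C_def s_def v_def mult.assoc)
qed

lemma dist_between_le_max:
  fixes x y z w :: "'a::metric_space"
  assumes X: "CAT0 (UNIV :: 'a set)" and w: "dist x w + dist w y = dist x y"
  shows "dist z w \<le> max (dist z x) (dist z y)"
proof (cases "x = y")
  case True
  then have "w = x" using w by (metis add_nonneg_eq_0_iff dist_eq_0_iff zero_le_dist)
  then show ?thesis by simp
next
  case False
  define M where "M = max (dist z x) (dist z y)"
  have M: "dist z x \<le> M" "dist z y \<le> M" "M \<ge> 0" by (auto simp: M_def le_max_iff_disj)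
  have "dist x y * (dist z w)\<^sup>2 \<le> dist w y * (dist z x)\<^sup>2 + dist x w * (dist z y)\<^sup>2"
    using stewart[OF X w, of z] by (smt (verit) mult_nonneg_nonneg zero_le_dist)
  also have "\<dots> \<le> dist w y * M\<^sup>2 + dist x w * M\<^sup>2"
    using M by (intro add_mono mult_left_mono power_mono) auto
  also have "\<dots> = dist x y * M\<^sup>2" using w by (simp add: algebra_simps flip: w)
  finally have "(dist z w)\<^sup>2 \<le> M\<^sup>2" using False by simp
  then show ?thesis using M by (simp add: M_def power2_le_iff_abs_le)
qed

section \<open>Morse geodesic rays are contracting\<close>

text \<open>The bound M depends on q and Q but not on C. Unlike the contracting property, this form of the
  Morse property transfers along quasi-isometries directly.\<close>
definition kmorse :: "'a::metric_space \<Rightarrow> (real \<Rightarrow> real) \<Rightarrow> 'a set \<Rightarrow> bool" where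
  "kmorse bp \<kappa> Z \<longleftrightarrow> (\<forall>q Q. \<exists>M. \<forall>\<eta>. qg_ray bp q Q \<eta> \<and> (\<exists>C. kclose bp \<kappa> C (ray_img \<eta>) Z) \<longrightarrow>
     kclose bp \<kappa> M (ray_img \<eta>) Z)"

lemma geodesic_segment_cont: "geodesic_segment g x y \<Longrightarrow> continuous_on {0..dist x y} g"
proof (rule continuous_onI)
  fix s e :: real assume "geodesic_segment g x y" "s \<in> {0..dist x y}" "0 < e"
  then show "\<exists>d>0. \<forall>s'\<in>{0..dist x y}. dist s' s < d \<longrightarrow> dist (g s') (g s) \<le> e"
    by (intro exI[of _ e]) (auto simp: geodesic_segment_dist dist_real_def)
qed

lemma geodesic_ray_dist: "geodesic_ray bp b \<Longrightarrow> 0 \<le> s \<Longrightarrow> 0 \<le> t \<Longrightarrow> dist (b s) (b t) = \<bar>s - t\<bar>"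
  by (auto simp: geodesic_ray_def)

lemma geodesic_ray_dist_base: "geodesic_ray bp b \<Longrightarrow> 0 \<le> t \<Longrightarrow> dist bp (b t) = t"
  using geodesic_ray_dist[of bp b 0 t] by (auto simp: geodesic_ray_def)

lemma geodesic_ray_qg:
  assumes "geodesic_ray bp b"
  shows "qg_ray bp 1 0 b"
proof -
  have "continuous_on {0..} b"
  proof (rule continuous_onI)
    fix x e :: real assume "x \<in> {0..}" "0 < e"
    then show "\<exists>d>0. \<forall>x'\<in>{0..}. dist x' x < d \<longrightarrow> dist (b x') (b x) \<le> e"
      by (intro exI[of _ e]) (auto simp: geodesic_ray_dist[OF assms] dist_real_def)
  qed
  then show ?thesis using assms by (auto simp: qg_ray_def geodesic_ray_def)
qed

text \<open>A is the part of Z on the far side of p, seen from t. The geodesic from t to u is cut where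
  its points stop being closer to Z than to A, so that p stays the nearest point of A.\<close>
lemma cut_point:
  fixes u p t :: "'a::metric_space"
  assumes X: "CAT0 (UNIV :: 'a set)"
    and near: "\<forall>z\<in>Z. dist u p \<le> dist u z" and p: "p \<in> A" and A: "A \<subseteq> Z" and tZ: "t \<in> Z"
    and bt: "\<forall>a\<in>A. dist a p + dist p t = dist a t"
    and cover: "\<forall>w\<in>Z - A. \<forall>a\<in>A. dist a p + dist p w = dist a w"
    and \<sigma>: "geodesic_segment \<sigma> t u"
  obtains \<tau> where "0 \<le> \<tau>" "\<tau> \<le> dist t u"
    "\<forall>s\<in>{0..\<tau>}. dist p (\<sigma> \<tau>) \<le> dist p (\<sigma> s)"
    "\<forall>s\<in>{0..\<tau>}. \<forall>a\<in>A. dist p (\<sigma> s) \<le> dist a (\<sigma> s)"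
    "infdist (\<sigma> \<tau>) Z = dist p (\<sigma> \<tau>) \<or> (dist p (\<sigma> \<tau>))\<^sup>2 + (dist u (\<sigma> \<tau>))\<^sup>2 \<le> (dist u p)\<^sup>2"
proof -
  define L where "L = dist t u"
  \<comment> \<open>The times at which the distances to \<open>A\<close> and to \<open>Z\<close>
    agree. The end \<open>L\<close> is one of them by \<open>near\<close>; the first one is
    \<open>\<tau>1\<close>.\<close>
  define T where "T = {0..L} \<inter> (\<lambda>s. infdist (\<sigma> s) A - infdist (\<sigma> s) Z) -` {0}"
  have cont: "continuous_on {0..L} \<sigma>" using geodesic_segment_cont[OF \<sigma>] by (simp add: L_def)
  have "closed T" unfolding T_def
    by (intro continuous_closed_preimage continuous_intros cont)
  moreover have "bounded T" by (rule bounded_subset[of "{0..L}"]) (auto simp: T_def)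
  ultimately have cT: "compact T" by (simp add: compact_eq_bounded_closed)
  have inf_eq: "infdist c S = dist c p" if "p \<in> S" "\<forall>a\<in>S. dist p c \<le> dist a c" for S c
  proof -
    have "S \<noteq> {}" using that by blast
    then have "dist c p \<le> infdist c S"
      unfolding infdist_notempty[OF \<open>S \<noteq> {}\<close>] using that(2) by (intro cINF_greatest) (auto simp: dist_commute)
    then show ?thesis using infdist_le[OF that(1), of c] by simp
  qed
  have uL: "\<sigma> L = u" "\<sigma> 0 = t" using \<sigma> by (auto simp: geodesic_segment_def L_def)
  have "infdist u A = dist u p" "infdist u Z = dist u p"
    using inf_eq[of A u] inf_eq[of Z u] near A p by (metis dist_commute subsetD)+
  then have "L \<in> T" using uL by (auto simp: T_def L_def)
  then obtain \<tau>1 where \<tau>1: "\<tau>1 \<in> T" "\<And>s. s \<in> T \<Longrightarrow> \<tau>1 \<le> s" using compact_attains_inf[OF cT] by blast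
  have t1: "0 \<le> \<tau>1" "\<tau>1 \<le> L" using \<tau>1 by (auto simp: T_def)
  have good': "dist p (\<sigma> s) \<le> dist a (\<sigma> s)" if s: "0 \<le> s" "s < \<tau>1" "a \<in> A" for s a
  proof -
    have "s \<notin> T" using \<tau>1(2)[of s] s by auto
    then have "infdist (\<sigma> s) A \<noteq> infdist (\<sigma> s) Z" using s t1 by (auto simp: T_def)
    moreover have "infdist (\<sigma> s) Z \<le> infdist (\<sigma> s) A" using A p by (intro infdist_mono) auto
    ultimately have "infdist (\<sigma> s) Z < infdist (\<sigma> s) A" by simp
    then obtain w where w: "w \<in> Z" "dist (\<sigma> s) w < infdist (\<sigma> s) A" using infdist_near tZ by blast
    then have lt: "dist (\<sigma> s) w < dist (\<sigma> s) a'" if "a' \<in> A" for a' using infdist_le[OF that, of "\<sigma> s"] by linarith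
    then have "w \<notin> A" by blast
    \<comment> \<open>As \<open>w\<close> is nearer than all of \<open>A\<close>, it lies on the
      other side of \<open>p\<close>. Since \<open>p\<close> is between \<open>a\<close> and
      \<open>w\<close>, and \<open>w\<close> is nearer than \<open>a\<close>, convexity of balls
      makes \<open>p\<close> no farther than \<open>a\<close>.\<close>
    then have "dist a p + dist p w = dist a w" using cover w s by blast
    from dist_between_le_max[OF X this, of "\<sigma> s"] lt[OF s(3)] show ?thesis by (simp add: dist_commute)
  qed
  have good: "dist p (\<sigma> s) \<le> dist a (\<sigma> s)" if s: "0 \<le> s" "s \<le> \<tau>1" "a \<in> A" for s a
  proof (cases "s < \<tau>1")
    case True then show ?thesis using good' s by blast
  next
    case False
    then have s1: "s = \<tau>1" using s by simp
    show ?thesis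
    proof (cases "\<tau>1 = 0")
      case True
      then show ?thesis using bt s s1 uL by (metis add.commute le_add_same_cancel1 zero_le_dist)
    next
      case f: False
      show ?thesis
      proof (rule field_le_epsilon)
        fix e :: real assume e: "0 < e"
        define r where "r = max 0 (\<tau>1 - e / 2)"
        have r: "0 \<le> r" "r < \<tau>1" "\<tau>1 - r \<le> e / 2" using f t1 e by (auto simp: r_def max_def)
        have "dist (\<sigma> r) (\<sigma> \<tau>1) = \<tau>1 - r" using geodesic_segment_dist[OF \<sigma>, of r \<tau>1] r t1 by (auto simp: L_def)
        then show "dist p (\<sigma> s) \<le> dist a (\<sigma> s) + e"
          using good'[OF r(1,2) s(3)] r(3) dist_triangle[of p "\<sigma> \<tau>1" "\<sigma> r"] dist_triangle[of a "\<sigma> r" "\<sigma> \<tau>1"]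
          by (simp add: s1 dist_commute)
      qed
    qed
  qed
  have "continuous_on {0..\<tau>1} (\<lambda>s. dist p (\<sigma> s))"
    using cont t1 by (intro continuous_intros continuous_on_subset[OF cont]) auto
  then obtain \<tau> where \<tau>: "\<tau> \<in> {0..\<tau>1}" "\<And>s. s \<in> {0..\<tau>1} \<Longrightarrow> dist p (\<sigma> \<tau>) \<le> dist p (\<sigma> s)"
    using continuous_attains_inf[of "{0..\<tau>1}" "\<lambda>s. dist p (\<sigma> s)"] t1 by auto
  have "infdist (\<sigma> \<tau>) Z = dist p (\<sigma> \<tau>) \<or> (dist p (\<sigma> \<tau>))\<^sup>2 + (dist u (\<sigma> \<tau>))\<^sup>2 \<le> (dist u p)\<^sup>2"
  \<comment> \<open>At \<open>\<tau>1\<close> the point \<open>p\<close> is nearest in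
    \<open>Z\<close>. Otherwise the distance to \<open>p\<close> does not drop when moving on by a
    small \<open>h\<close> towards \<open>u\<close>, so the angle at \<open>\<sigma> \<tau>\<close>
    is at least a right angle; Stewart for this short step, with \<open>h\<close> tending to
    \<open>0\<close>, yields the inequality of Pythagoras.\<close>
  proof (cases "\<tau> = \<tau>1")
    case True
    have "infdist (\<sigma> \<tau>) Z = infdist (\<sigma> \<tau>) A" using \<tau>1(1) True by (simp add: T_def)
    also have "\<dots> = dist p (\<sigma> \<tau>)" using inf_eq[OF p, of "\<sigma> \<tau>"] good t1 True by (auto simp: dist_commute)
    finally show ?thesis ..
  next
    case False
    then have lt: "0 \<le> \<tau>" "\<tau> < \<tau>1" using \<tau> by auto
    define l where "l = L - \<tau>"
    have l: "l > 0" using lt t1 by (simp add: l_def)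
    have zu: "dist (\<sigma> \<tau>) u = l" using geodesic_segment_dist[OF \<sigma>, of \<tau> L] lt t1 uL by (auto simp: L_def l_def)
    have "(dist p (\<sigma> \<tau>))\<^sup>2 + l\<^sup>2 \<le> (dist u p)\<^sup>2 + e" if e: "e > 0" for e
    proof -
      define h where "h = min (\<tau>1 - \<tau>) (e / l)"
      have h: "0 < h" "\<tau> + h \<le> \<tau>1" "h * l \<le> e" using lt l e by (auto simp: h_def min_def field_simps)
      have d: "dist (\<sigma> \<tau>) (\<sigma> (\<tau> + h)) = h" "dist (\<sigma> (\<tau> + h)) u = l - h"
        using geodesic_segment_dist[OF \<sigma>, of \<tau> "\<tau> + h"] geodesic_segment_dist[OF \<sigma>, of "\<tau> + h" L] lt t1 uL h
        by (auto simp: L_def l_def)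
      have "l * (dist p (\<sigma> (\<tau> + h)))\<^sup>2 \<le> (l - h) * (dist p (\<sigma> \<tau>))\<^sup>2 + h * (dist p u)\<^sup>2 - h * (l - h) * l"
        using stewart[OF X, of "\<sigma> \<tau>" "\<sigma> (\<tau> + h)" u p] d zu by simp
      moreover have "l * (dist p (\<sigma> \<tau>))\<^sup>2 \<le> l * (dist p (\<sigma> (\<tau> + h)))\<^sup>2"
        using \<tau>(2)[of "\<tau> + h"] h lt l by (intro mult_left_mono power_mono) auto
      ultimately have "h * ((dist p (\<sigma> \<tau>))\<^sup>2 + l\<^sup>2) \<le> h * ((dist u p)\<^sup>2 + h * l)"
        by (simp add: algebra_simps power2_eq_square dist_commute)
      then have "(dist p (\<sigma> \<tau>))\<^sup>2 + l\<^sup>2 \<le> (dist u p)\<^sup>2 + h * l" using h(1) by simp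
      then show ?thesis using h by linarith
    qed
    then have "(dist p (\<sigma> \<tau>))\<^sup>2 + l\<^sup>2 \<le> (dist u p)\<^sup>2" by (rule field_le_epsilon)
    then show ?thesis using zu by (simp add: dist_commute)
  qed
  then show ?thesis using that[of \<tau>] \<tau> t1 good by (auto simp: L_def)
qed

lemma add_le_twice_of_squares:
  fixes a b c :: real
  assumes "a\<^sup>2 + b\<^sup>2 \<le> c\<^sup>2" "0 \<le> c"
  shows "a + b \<le> 2 * c"
proof -
  have "2 * (a * b) \<le> a\<^sup>2 + b\<^sup>2" using sum_squares_bound[of a b] by simp
  moreover have "(a + b)\<^sup>2 = a\<^sup>2 + b\<^sup>2 + 2 * (a * b)" "(2 * c)\<^sup>2 = 4 * c\<^sup>2" "c\<^sup>2 \<ge> 0"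
    by (simp_all add: power2_eq_square algebra_simps)
  ultimately have "(a + b)\<^sup>2 \<le> (2 * c)\<^sup>2" using assms(1) by linarith
  then show ?thesis using assms(2) power2_le_imp_le[of "a+b" "2*c"] by simp
qed

text \<open>The path runs from p to the cut point and from there along the given geodesic to t. It stays
  quasi-geodesic when a geodesic ending at p (in A) and one starting at t (in A') are attached.\<close>
lemma detour_path:
  fixes u p t :: "'a::metric_space"
  assumes X: "CAT0 (UNIV :: 'a set)" and pt: "p \<noteq> t" and near: "dist u p \<le> dist u t"
    and bt': "\<forall>a\<in>A'. dist p t + dist t a = dist p a"
    and \<sigma>: "geodesic_segment \<sigma> t u" and \<tau>: "0 \<le> \<tau>" "\<tau> \<le> dist t u"
    and min: "\<forall>s\<in>{0..\<tau>}. dist p (\<sigma> \<tau>) \<le> dist p (\<sigma> s)"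
    and good: "\<forall>s\<in>{0..\<tau>}. \<forall>a\<in>A. dist p (\<sigma> s) \<le> dist a (\<sigma> s)"
  obtains m l where "0 \<le> l" "m 0 = p" "m l = t" "\<sigma> \<tau> \<in> m ` {0..l}"
    "\<And>s s'. 0 \<le> s \<Longrightarrow> s \<le> s' \<Longrightarrow> s' \<le> l \<Longrightarrow> dist (m s) (m s') \<le> s' - s \<and> s' - s \<le> 5 * dist (m s) (m s')"
    "\<And>s a. 0 \<le> s \<Longrightarrow> s \<le> l \<Longrightarrow> a \<in> A \<Longrightarrow> dist a p + s \<le> 5 * dist a (m s)"
    "\<And>s a. 0 \<le> s \<Longrightarrow> s \<le> l \<Longrightarrow> a \<in> A' \<Longrightarrow> (l - s) + dist t a \<le> 5 * dist (m s) a"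
proof -
  define z r D where "z = \<sigma> \<tau>" and "r = dist p z" and "D = dist p t"
  have D: "D > 0" using pt by (simp add: D_def)
  have \<sigma>0: "\<sigma> 0 = t" using \<sigma> by (simp add: geodesic_segment_def)
  have min: "dist p (\<sigma> \<tau>) \<le> dist p (\<sigma> s)" if "0 \<le> s" "s \<le> \<tau>" for s using min that by simp
  have good: "dist p (\<sigma> s) \<le> dist a (\<sigma> s)" if "0 \<le> s" "s \<le> \<tau>" "a \<in> A" for s a using good that by simp
  have r: "0 \<le> r" "r \<le> D" using min[of 0] \<tau> \<sigma>0 by (auto simp: r_def z_def D_def)
  obtain g where g: "geodesic_segment g p z" using geodesic_space_segment X unfolding CAT0_def by blast
  define l where "l = r + \<tau>"
  define m where "m s = (if s \<le> r then g s else \<sigma> (\<tau> + r - s))" for s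
  have gd: "dist p (m s) = s" "dist (m s) z = r - s" if "0 \<le> s" "s \<le> r" for s
    using geodesic_segment_dist_left[OF g, of s] geodesic_segment_dist_right[OF g, of s] that by (auto simp: m_def r_def)
  have mr: "m r = z" using g r by (simp add: m_def geodesic_segment_def r_def)
  have sd: "dist (\<sigma> s) (\<sigma> s') = \<bar>s - s'\<bar>" if "0 \<le> s" "s \<le> \<tau>" "0 \<le> s'" "s' \<le> \<tau>" for s s'
    using geodesic_segment_dist[OF \<sigma>, of s s'] that \<tau> by auto
  have m2: "m s = \<sigma> (\<tau> + r - s)" if "r \<le> s" for s using that mr by (auto simp: m_def z_def)
  \<comment> \<open>As \<open>u\<close> is no farther from \<open>p\<close> than from
    \<open>t\<close>, the comparison angle at \<open>t\<close> is at most a right angle.\<close>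
  have pc: "(dist p (\<sigma> s))\<^sup>2 \<le> D\<^sup>2 + s\<^sup>2" if s: "0 \<le> s" "s \<le> \<tau>" for s
  proof (cases "dist t u = 0")
    case True
    then have "s = 0" using s \<tau> by linarith
    then have "\<sigma> s = t" using \<sigma>0 by simp
    then show ?thesis by (simp add: D_def)
  next
    case False
    define L where "L = dist t u"
    have L: "L > 0" using False by (simp add: L_def)
    have d: "dist t (\<sigma> s) = s" "dist (\<sigma> s) u = L - s"
      using geodesic_segment_dist_left[OF \<sigma>, of s] geodesic_segment_dist_right[OF \<sigma>, of s] s \<tau> by (auto simp: L_def)
    have "L * (dist p (\<sigma> s))\<^sup>2 \<le> (L - s) * D\<^sup>2 + s * (dist p u)\<^sup>2 - s * (L - s) * L"
      using stewart[OF X, of t "\<sigma> s" u p] d by (simp add: L_def D_def)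
    also have "\<dots> \<le> (L - s) * D\<^sup>2 + s * L\<^sup>2 - s * (L - s) * L"
      using near s by (intro diff_right_mono add_left_mono mult_left_mono power_mono) (auto simp: L_def dist_commute)
    also have "\<dots> = L * (D\<^sup>2 + s\<^sup>2) - s * D\<^sup>2" by (simp add: algebra_simps power2_eq_square)
    also have "\<dots> \<le> L * (D\<^sup>2 + s\<^sup>2)" using s by simp
    finally show ?thesis using L by simp
  qed
  show ?thesis
  proof (rule that[of l m])
    show "0 \<le> l" using r \<tau> by (simp add: l_def)
    show "m 0 = p" using g r by (simp add: m_def geodesic_segment_def)
    show "m l = t" using m2[of l] \<tau> \<sigma>0 by (simp add: l_def)
    show "\<sigma> \<tau> \<in> m ` {0..l}" using mr r \<tau> by (intro image_eqI[of _ _ r]) (auto simp: z_def l_def)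
    {
      fix s s' assume s: "0 \<le> s" "s \<le> s'" "s' \<le> l"
      consider "s' \<le> r" | "r \<le> s" | "s \<le> r" "r \<le> s'" by linarith
      then show "dist (m s) (m s') \<le> s' - s \<and> s' - s \<le> 5 * dist (m s) (m s')"
      proof cases
        case 1
        then have "dist (m s) (m s') = s' - s" using geodesic_segment_dist[OF g, of s s'] s by (auto simp: m_def r_def)
        then show ?thesis using s by simp
      next
        case 2
        then have "dist (m s) (m s') = s' - s" using sd[of "\<tau> + r - s" "\<tau> + r - s'"] m2 s by (auto simp: l_def)
        then show ?thesis using s by simp
      next
        case 3
        have zs: "dist z (m s') = s' - r" using sd[of \<tau> "\<tau> + r - s'"] m2[of s'] 3 s by (auto simp: l_def z_def)
        \<comment> \<open>The first piece runs radially from \<open>p\<close> to distance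
          \<open>r\<close>, and by \<open>min\<close> the second piece stays at least that far away.
          So the two points are at least \<open>r - s\<close> apart.\<close>
        have "r \<le> dist p (m s')" using min[of "\<tau> + r - s'"] m2[of s'] 3 s by (auto simp: l_def z_def r_def)
        then have "r - s \<le> dist (m s) (m s')" using gd(1)[of s] 3 s dist_triangle[of p "m s'" "m s"] by simp
        then show ?thesis
          using gd(2)[of s] zs 3 s dist_triangle[of "m s" "m s'" z] dist_triangle[of z "m s'" "m s"]
          by (simp add: dist_commute)
      qed
    }
    {
      fix s a assume s: "0 \<le> s" "s \<le> l" and a: "a \<in> A"
      show "dist a p + s \<le> 5 * dist a (m s)"
      proof (cases "s \<le> r")
        case True
        have "r \<le> dist a z" using good[of \<tau> a] a \<tau> by (simp add: r_def z_def)
        then have "s \<le> dist a (m s)" using gd[of s] True s dist_triangle[of a z "m s"] by simp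
        then show ?thesis using gd(1)[of s] True s dist_triangle[of a p "m s"] by (simp add: dist_commute)
      next
        case False
        \<comment> \<open>This case determines the factor 5: with \<open>d = dist a (m s)\<close>,
          the lengths \<open>r\<close>, \<open>dist a p\<close> and \<open>s - r\<close> are at most
          \<open>d\<close>, \<open>2 * d\<close> and \<open>2 * d\<close>.\<close>
        have zs: "dist z (m s) = s - r" using sd[of \<tau> "\<tau> + r - s"] m2[of s] False s r by (auto simp: l_def z_def)
        have "r \<le> dist p (m s)" using min[of "\<tau> + r - s"] m2[of s] False s by (auto simp: l_def z_def r_def)
        moreover have "dist p (m s) \<le> dist a (m s)" using good[of "\<tau> + r - s" a] a m2[of s] False s by (auto simp: l_def)
        ultimately show ?thesis
          using zs dist_triangle[of z "m s" p] dist_triangle[of a p "m s"] by (simp add: r_def dist_commute)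
      qed
    }
    {
      fix s a assume s: "0 \<le> s" "s \<le> l" and a: "a \<in> A'"
      define \<rho> where "\<rho> = dist t a"
      have pa: "dist p a = D + \<rho>" using bt' a by (simp add: D_def \<rho>_def)
      \<comment> \<open>By \<open>pc\<close> the angle at \<open>t\<close> towards \<open>p\<close>
        is at most a right angle, so the angle towards the continuation \<open>a\<close> is at least
        one. Stewart at \<open>t\<close> expresses this.\<close>
      have tail: "c + \<rho> \<le> 2 * dist (\<sigma> c) a" if c: "0 \<le> c" "c \<le> \<tau>" for c
      proof -
        have ct: "dist (\<sigma> c) t = c" using sd[of c 0] c \<tau> \<sigma>0 by simp
        have "(D + \<rho>) * c\<^sup>2 \<le> \<rho> * (dist (\<sigma> c) p)\<^sup>2 + D * (dist (\<sigma> c) a)\<^sup>2 - D * \<rho> * (D + \<rho>)"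
          using stewart[OF X, of p t a "\<sigma> c"] pa ct by (simp add: D_def \<rho>_def)
        moreover have "\<rho> * (dist (\<sigma> c) p)\<^sup>2 \<le> \<rho> * (D\<^sup>2 + c\<^sup>2)"
          using pc[OF c] by (intro mult_left_mono) (auto simp: \<rho>_def dist_commute)
        ultimately have "D * (c\<^sup>2 + \<rho>\<^sup>2) \<le> D * (dist (\<sigma> c) a)\<^sup>2" by (simp add: algebra_simps power2_eq_square)
        then have "c\<^sup>2 + \<rho>\<^sup>2 \<le> (dist (\<sigma> c) a)\<^sup>2" using D by simp
        then show ?thesis by (rule add_le_twice_of_squares) simp
      qed
      show "(l - s) + dist t a \<le> 5 * dist (m s) a"
      proof (cases "s \<le> r")
        case False
        then have "l - s + dist t a \<le> 2 * dist (m s) a" using tail[of "\<tau> + r - s"] m2[of s] s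
          unfolding l_def \<rho>_def by auto
        then show ?thesis using zero_le_dist[of "m s" a] by linarith
      next
        case True
        have 1: "dist (m s) a \<ge> \<rho> + (r - s)" using gd(1)[of s] True s pa r dist_triangle[of p a "m s"] by simp
        have "\<tau> = dist z t" using sd[of \<tau> 0] \<sigma>0 \<tau> by (simp add: z_def)
        then have "\<tau> \<le> (r - s) + dist (m s) a + \<rho>"
          using gd(2)[of s] True s dist_triangle[of z t "m s"] dist_triangle[of "m s" t a] by (simp add: dist_commute \<rho>_def)
        then show ?thesis using 1 True zero_le_dist[of "m s" a] unfolding l_def \<rho>_def by linarith
      qed
    }
  qed
qed

text \<open>The hypotheses \<open>am\<close> and \<open>mb\<close> are the mixed cases of the
  quasi-geodesic inequality for the concatenation with both remaining parts of \<open>b\<close>. The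
  final bound by \<open>l\<close> supplies the a priori closeness that \<open>kmorse\<close>
  requires.\<close>

lemma detour_ray:
  fixes m :: "real \<Rightarrow> 'a::metric_space"
  assumes b: "geodesic_ray bp b" and ab: "0 \<le> \<alpha>" "\<alpha> \<le> \<beta>" and l: "0 \<le> l" "m 0 = b \<alpha>" "m l = b \<beta>"
    and mm: "\<And>s s'. 0 \<le> s \<Longrightarrow> s \<le> s' \<Longrightarrow> s' \<le> l \<Longrightarrow> dist (m s) (m s') \<le> s' - s \<and> s' - s \<le> 5 * dist (m s) (m s')"
    and am: "\<And>s a. 0 \<le> s \<Longrightarrow> s \<le> l \<Longrightarrow> 0 \<le> a \<Longrightarrow> a \<le> \<alpha> \<Longrightarrow> (\<alpha> - a) + s \<le> 5 * dist (b a) (m s)"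
    and mb: "\<And>s c. 0 \<le> s \<Longrightarrow> s \<le> l \<Longrightarrow> \<beta> \<le> c \<Longrightarrow> (l - s) + (c - \<beta>) \<le> 5 * dist (m s) (b c)"
  obtains \<eta> where "qg_ray bp 5 0 \<eta>" "m ` {0..l} \<subseteq> ray_img \<eta>" "\<forall>x\<in>ray_img \<eta>. infdist x (ray_img b) \<le> l"
proof -
  define \<eta> where "\<eta> t = (if t \<le> \<alpha> then b t else if t \<le> \<alpha> + l then m (t - \<alpha>) else b (t - \<alpha> - l + \<beta>))" for t
  have e1: "\<eta> t = b t" if "t \<le> \<alpha>" for t using that by (simp add: \<eta>_def)
  have e2: "\<eta> t = m (t - \<alpha>)" if "\<alpha> \<le> t" "t \<le> \<alpha> + l" for t using that l by (auto simp: \<eta>_def)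
  have e3: "\<eta> t = b (t - \<alpha> - l + \<beta>)" if "\<alpha> + l \<le> t" for t using that l by (auto simp: \<eta>_def)
  have bd: "dist (b s) (b t) = \<bar>s - t\<bar>" if "0 \<le> s" "0 \<le> t" for s t using geodesic_ray_dist[OF b] that by blast
  have lab: "\<beta> - \<alpha> \<le> l \<and> l \<le> 5 * (\<beta> - \<alpha>)" using mm[of 0 l] l bd[of \<alpha> \<beta>] ab by simp
  have main: "dist (\<eta> s) (\<eta> t) \<le> t - s \<and> t - s \<le> 5 * dist (\<eta> s) (\<eta> t)" if st: "0 \<le> s" "s \<le> t" for s t
  proof -
    consider "t \<le> \<alpha>" | "s \<le> \<alpha>" "\<alpha> \<le> t" "t \<le> \<alpha> + l" | "s \<le> \<alpha>" "\<alpha> + l \<le> t" | "\<alpha> \<le> s" "t \<le> \<alpha> + l"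
      | "\<alpha> \<le> s" "s \<le> \<alpha> + l" "\<alpha> + l \<le> t" | "\<alpha> + l \<le> s" by linarith
    then show ?thesis
    proof cases
      case 1 then show ?thesis using bd[of s t] st by (simp add: e1)
    next
      case 2
      have "dist (b s) (m (t - \<alpha>)) \<le> (\<alpha> - s) + (t - \<alpha>)"
        using dist_triangle[of "b s" "m (t - \<alpha>)" "b \<alpha>"] bd[of s \<alpha>] mm[of 0 "t - \<alpha>"] 2 st ab l by simp
      then show ?thesis using am[of "t - \<alpha>" s] 2 st by (simp add: e1 e2)
    next
      case 3
      then show ?thesis using bd[of s "t - \<alpha> - l + \<beta>"] st ab lab by (simp add: e1 e3)
    next
      case 4 then show ?thesis using mm[of "s - \<alpha>" "t - \<alpha>"] st by (simp add: e2)
    next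
      case 5
      have "dist (m (s - \<alpha>)) (b (t - \<alpha> - l + \<beta>)) \<le> (l - (s - \<alpha>)) + (t - \<alpha> - l)"
        using dist_triangle[of "m (s - \<alpha>)" "b (t - \<alpha> - l + \<beta>)" "b \<beta>"] bd[of \<beta> "t - \<alpha> - l + \<beta>"] mm[of "s - \<alpha>" l] 5 st ab l by simp
      then show ?thesis using mb[of "s - \<alpha>" "t - \<alpha> - l + \<beta>"] 5 st by (simp add: e2 e3)
    next
      case 6 then show ?thesis using bd[of "s - \<alpha> - l + \<beta>" "t - \<alpha> - l + \<beta>"] st ab lab by (simp add: e3)
    qed
  qed
  have "coarse_ray 5 0 \<eta>"
  proof (rule coarse_rayI)
    fix s t :: real assume "0 \<le> s" "s \<le> t"
    then show "t - s \<le> 5 * (dist (\<eta> s) (\<eta> t) + 0)" "dist (\<eta> s) (\<eta> t) \<le> 5 * (t - s) + 0" using main[of s t] by auto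
  qed auto
  moreover have "continuous_on {0..} \<eta>"
  proof (rule continuous_onI)
    fix x e :: real assume x: "x \<in> {0..}" and e: "0 < e"
    show "\<exists>d>0. \<forall>x'\<in>{0..}. dist x' x < d \<longrightarrow> dist (\<eta> x') (\<eta> x) \<le> e"
    proof (intro exI[of _ e] conjI ballI impI e)
      fix x' :: real assume "x' \<in> {0..}" "dist x' x < e"
      then show "dist (\<eta> x') (\<eta> x) \<le> e"
        using main[of x x'] main[of x' x] x by (cases "x \<le> x'") (auto simp: dist_commute dist_real_def)
    qed
  qed
  moreover have "\<eta> 0 = bp" using e1[of 0] ab b by (simp add: geodesic_ray_def)
  ultimately have "qg_ray bp 5 0 \<eta>" by (simp add: qg_ray_coarse)
  moreover have "m ` {0..l} \<subseteq> ray_img \<eta>"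
  proof safe
    fix s assume "s \<in> {0..l}"
    then have "m s = \<eta> (s + \<alpha>)" "0 \<le> s + \<alpha>" using e2[of "s + \<alpha>"] ab by auto
    then show "m s \<in> ray_img \<eta>" by (simp add: ray_imgI)
  qed
  moreover have "infdist (\<eta> t) (ray_img b) \<le> l" if t: "0 \<le> t" for t
  proof -
    consider "t \<le> \<alpha>" | "\<alpha> \<le> t" "t \<le> \<alpha> + l" | "\<alpha> + l \<le> t" by linarith
    then show ?thesis
    proof cases
      case 1 then show ?thesis using t l by (simp add: e1 ray_imgI)
    next
      case 2
      have "dist (m (t - \<alpha>)) (b \<alpha>) \<le> l" using mm[of 0 "t - \<alpha>"] 2 l by (simp add: dist_commute)
      then show ?thesis using 2 ab by (auto simp: e2 intro!: infdist_le2[of "b \<alpha>"] ray_imgI)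
    next
      case 3 then show ?thesis using t l ab by (simp add: e3 ray_imgI)
    qed
  qed
  ultimately show ?thesis using that[of \<eta>] by (auto simp: ray_img_def)
qed

text \<open>The detour through the cut point is quasi-geodesic with fixed constants, so the Morse
  property puts the cut point within \<open>e\<close> of the ray. It is then near the nearest point
  of \<open>u\<close> as well, up to the square root of \<open>e\<close> times the height, and the
  geodesic from \<open>u\<close> to \<open>b \<beta>\<close> almost passes through that nearest
  point.\<close>

lemma kmorse_slim:
  fixes b :: "real \<Rightarrow> 'a::metric_space"
  assumes X: "CAT0 (UNIV :: 'a set)" and \<kappa>: "kappa_fun \<kappa>" and b: "geodesic_ray bp b"
    and M: "kmorse bp \<kappa> (ray_img b)"
  obtains M where "M \<ge> 1"
    "\<And>u \<alpha> \<beta> e. 0 \<le> \<alpha> \<Longrightarrow> 0 \<le> \<beta> \<Longrightarrow> (\<forall>z\<in>ray_img b. dist u (b \<alpha>) \<le> dist u z) \<Longrightarrow>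
        M * \<kappa> (\<alpha> + \<bar>\<alpha> - \<beta>\<bar>) \<le> e \<Longrightarrow>
        dist u (b \<alpha>) + \<bar>\<alpha> - \<beta>\<bar> \<le> dist u (b \<beta>) + 2 * sqrt (2 * e * dist u (b \<alpha>) + e\<^sup>2)"
proof -
  obtain M0 where M0: "\<And>\<eta>. qg_ray bp 5 0 \<eta> \<Longrightarrow> \<exists>C. kclose bp \<kappa> C (ray_img \<eta>) (ray_img b) \<Longrightarrow>
      kclose bp \<kappa> M0 (ray_img \<eta>) (ray_img b)" using M unfolding kmorse_def by blast
  define M where "M = max M0 1"
  have bd: "dist (b s) (b t) = \<bar>s - t\<bar>" if "0 \<le> s" "0 \<le> t" for s t using geodesic_ray_dist[OF b] that by blast
  have main: "dist u (b \<alpha>) + \<bar>\<alpha> - \<beta>\<bar> \<le> dist u (b \<beta>) + 2 * sqrt (2 * e * dist u (b \<alpha>) + e\<^sup>2)"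
    if ab: "0 \<le> \<alpha>" "0 \<le> \<beta>" and near: "\<forall>z\<in>ray_img b. dist u (b \<alpha>) \<le> dist u z"
      and e: "M * \<kappa> (\<alpha> + \<bar>\<alpha> - \<beta>\<bar>) \<le> e" for u \<alpha> \<beta> e
  proof (cases "\<alpha> = \<beta>")
    case True
    have "0 \<le> M * \<kappa> (\<alpha> + \<bar>\<alpha> - \<beta>\<bar>)" using kappa_ge_1[OF \<kappa>, of "\<alpha> + \<bar>\<alpha> - \<beta>\<bar>"] ab by (simp add: M_def)
    then show ?thesis using True e by (simp add: add_nonneg_nonneg)
  next
    case False
    define p t where "p = b \<alpha>" and "t = b \<beta>"
    \<comment> \<open>\<open>A\<close> is the part of the ray on the far side of \<open>p\<close>
      from \<open>t\<close>, and \<open>A'\<close> the part from \<open>t\<close> away from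
      \<open>p\<close>. For \<open>\<beta> < \<alpha>\<close> the detour is later traversed
      backwards, from \<open>t\<close> to \<open>p\<close>.\<close>
    define I where "I = (if \<alpha> < \<beta> then {0..\<alpha>} else {\<alpha>..})"
    define A where "A = b ` I"
    define A' where "A' = (if \<alpha> < \<beta> then b ` {\<beta>..} else b ` {0..\<beta>})"
    obtain \<sigma> where \<sigma>: "geodesic_segment \<sigma> t u" using geodesic_space_segment X unfolding CAT0_def by blast
    have pA: "p \<in> A" "A \<subseteq> ray_img b" "t \<in> ray_img b" using ab by (auto simp: p_def t_def A_def I_def ray_img_def)
    have bt: "\<forall>a\<in>A. dist a p + dist p t = dist a t"
      using ab False by (auto simp: A_def I_def p_def t_def bd split: if_splits)
    have cover: "\<forall>w\<in>ray_img b - A. \<forall>a\<in>A. dist a p + dist p w = dist a w"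
    proof (intro ballI)
      fix w a assume w: "w \<in> ray_img b - A" and a: "a \<in> A"
      then obtain \<gamma> where \<gamma>: "w = b \<gamma>" "0 \<le> \<gamma>" by (auto simp: ray_img_def)
      then have "\<gamma> \<notin> I" using w by (auto simp: A_def)
      then show "dist a p + dist p w = dist a w"
        using a ab \<gamma> by (auto simp: A_def I_def p_def bd split: if_splits)
    qed
    have bt': "\<forall>a\<in>A'. dist p t + dist t a = dist p a"
      using ab False by (auto simp: A'_def p_def t_def bd split: if_splits)
    have pt: "p \<noteq> t" using bd[of \<alpha> \<beta>] ab False by (auto simp: p_def t_def)
    obtain \<tau> where \<tau>: "0 \<le> \<tau>" "\<tau> \<le> dist t u"
      "\<forall>s\<in>{0..\<tau>}. dist p (\<sigma> \<tau>) \<le> dist p (\<sigma> s)"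
      "\<forall>s\<in>{0..\<tau>}. \<forall>a\<in>A. dist p (\<sigma> s) \<le> dist a (\<sigma> s)"
      "infdist (\<sigma> \<tau>) (ray_img b) = dist p (\<sigma> \<tau>) \<or> (dist p (\<sigma> \<tau>))\<^sup>2 + (dist u (\<sigma> \<tau>))\<^sup>2 \<le> (dist u p)\<^sup>2"
      by (rule cut_point[OF X near[folded p_def] pA bt cover \<sigma>])
    have near': "dist u p \<le> dist u t" using near pA(3) unfolding p_def by blast
    obtain l m where m: "0 \<le> l" "m 0 = p" "m l = t" "\<sigma> \<tau> \<in> m ` {0..l}"
      "\<And>s s'. 0 \<le> s \<Longrightarrow> s \<le> s' \<Longrightarrow> s' \<le> l \<Longrightarrow> dist (m s) (m s') \<le> s' - s \<and> s' - s \<le> 5 * dist (m s) (m s')"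
      "\<And>s a. 0 \<le> s \<Longrightarrow> s \<le> l \<Longrightarrow> a \<in> A \<Longrightarrow> dist a p + s \<le> 5 * dist a (m s)"
      "\<And>s a. 0 \<le> s \<Longrightarrow> s \<le> l \<Longrightarrow> a \<in> A' \<Longrightarrow> (l - s) + dist t a \<le> 5 * dist (m s) a"
      by (rule detour_path[OF X pt near' bt' \<sigma> \<tau>(1-4)], rule that)
    have "\<exists>\<eta>. qg_ray bp 5 0 \<eta> \<and> m ` {0..l} \<subseteq> ray_img \<eta> \<and> (\<forall>x\<in>ray_img \<eta>. infdist x (ray_img b) \<le> l)"
    proof (cases "\<alpha> < \<beta>")
      case True
      have 1: "(\<alpha> - a) + s \<le> 5 * dist (b a) (m s)" if "0 \<le> s" "s \<le> l" "0 \<le> a" "a \<le> \<alpha>" for s a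
        using m(6)[of s "b a"] that True bd[of a \<alpha>] by (auto simp: A_def I_def p_def)
      have 2: "(l - s) + (c - \<beta>) \<le> 5 * dist (m s) (b c)" if "0 \<le> s" "s \<le> l" "\<beta> \<le> c" for s c
        using m(7)[of s "b c"] that True bd[of \<beta> c] ab by (auto simp: A'_def t_def)
      have \<beta>: "\<alpha> \<le> \<beta>" using True by simp
      obtain \<eta> where "qg_ray bp 5 0 \<eta>" "m ` {0..l} \<subseteq> ray_img \<eta>" "\<forall>x\<in>ray_img \<eta>. infdist x (ray_img b) \<le> l"
        by (rule detour_ray[OF b ab(1) \<beta> m(1), of m]) (use m(2,3,5) 1 2 in \<open>auto simp: p_def t_def\<close>)
      then show ?thesis by blast
    next
      case f: False
      have 0: "dist (m (l - s)) (m (l - s')) \<le> s' - s \<and> s' - s \<le> 5 * dist (m (l - s)) (m (l - s'))"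
        if "0 \<le> s" "s \<le> s'" "s' \<le> l" for s s'
        using m(5)[of "l - s'" "l - s"] that by (auto simp: dist_commute)
      have 1: "(\<beta> - a) + s \<le> 5 * dist (b a) (m (l - s))" if "0 \<le> s" "s \<le> l" "0 \<le> a" "a \<le> \<beta>" for s a
        using m(7)[of "l - s" "b a"] that f bd[of \<beta> a] by (auto simp: A'_def t_def dist_commute)
      have 2: "(l - s) + (c - \<alpha>) \<le> 5 * dist (m (l - s)) (b c)" if "0 \<le> s" "s \<le> l" "\<alpha> \<le> c" for s c
        using m(6)[of "l - s" "b c"] that f bd[of c \<alpha>] ab by (auto simp: A_def I_def p_def dist_commute)
      have i: "(\<lambda>s. m (l - s)) ` {0..l} = m ` {0..l}"
      proof safe
        fix s assume "s \<in> {0..l}"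
        then show "m (l - s) \<in> m ` {0..l}" "m s \<in> (\<lambda>s. m (l - s)) ` {0..l}"
          by (auto intro!: image_eqI[of _ _ "l - s"])
      qed
      have \<beta>: "\<beta> \<le> \<alpha>" using f by simp
      obtain \<eta> where "qg_ray bp 5 0 \<eta>" "(\<lambda>s. m (l - s)) ` {0..l} \<subseteq> ray_img \<eta>" "\<forall>x\<in>ray_img \<eta>. infdist x (ray_img b) \<le> l"
        by (rule detour_ray[OF b ab(2) \<beta> m(1), of "\<lambda>s. m (l - s)"]) (use m(2,3) 0 1 2 in \<open>auto simp: p_def t_def\<close>)
      then show ?thesis using i by auto
    qed
    then obtain \<eta> where \<eta>: "qg_ray bp 5 0 \<eta>" "m ` {0..l} \<subseteq> ray_img \<eta>" "\<forall>x\<in>ray_img \<eta>. infdist x (ray_img b) \<le> l" by blast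
    define z where "z = \<sigma> \<tau>"
    have "kclose bp \<kappa> l (ray_img \<eta>) (ray_img b)" unfolding kclose_def
    proof
      fix x assume "x \<in> ray_img \<eta>"
      then have "infdist x (ray_img b) \<le> l * 1" using \<eta>(3) by simp
      also have "\<dots> \<le> l * \<kappa> (dist bp x)" using m(1) kappa_ge_1[OF \<kappa>] by (intro mult_left_mono) auto
      finally show "infdist x (ray_img b) \<le> l * \<kappa> (dist bp x)" .
    qed
    then have "kclose bp \<kappa> M0 (ray_img \<eta>) (ray_img b)" using M0[OF \<eta>(1)] by blast
    moreover have "z \<in> ray_img \<eta>" using m(4) \<eta>(2) by (auto simp: z_def)
    ultimately have "infdist z (ray_img b) \<le> M0 * \<kappa> (dist bp z)" by (simp add: kclose_def)
    also have "\<dots> \<le> M * \<kappa> (dist bp z)" using kappa_ge_1[OF \<kappa>, of "dist bp z"] by (intro mult_right_mono) (auto simp: M_def)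
    also have "\<dots> \<le> M * \<kappa> (\<alpha> + \<bar>\<alpha> - \<beta>\<bar>)"
    proof -
      have "dist p z \<le> dist p t" using bspec[OF \<tau>(3), of 0] \<tau>(1) \<sigma> by (auto simp: z_def geodesic_segment_def)
      then have "dist bp z \<le> \<alpha> + \<bar>\<alpha> - \<beta>\<bar>"
        using dist_triangle[of bp z p] geodesic_ray_dist_base[OF b ab(1)] bd[OF ab] by (simp add: p_def t_def)
      then show ?thesis using kappa_mono[OF \<kappa>] by (intro mult_left_mono) (auto simp: M_def)
    qed
    finally have ze: "infdist z (ray_img b) \<le> e" using e by simp
    have e0: "e \<ge> 0" using ze infdist_nonneg[of z "ray_img b"] by linarith
    define H where "H = dist u p"
    have zt: "dist u z + dist z t = dist u t" "H \<ge> 0"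
      using geodesic_segment_dist_left[OF \<sigma> \<tau>(1,2)] geodesic_segment_dist_right[OF \<sigma> \<tau>(1,2)] by (auto simp: z_def H_def dist_commute)
    have Hz: "H \<le> dist u z + e"
    proof -
      have "H \<le> infdist u (ray_img b)"
        using near by (auto simp: infdist_notempty H_def p_def intro!: cINF_greatest)
      also have "\<dots> \<le> infdist z (ray_img b) + dist u z" by (rule infdist_triangle)
      finally show ?thesis using ze by simp
    qed
    \<comment> \<open>The first alternative of \<open>cut_point\<close> gives
      \<open>dist p z \<le> e\<close>. In the second, \<open>z\<close> is at least
      \<open>H - e\<close> away from \<open>u\<close>, so the squared leg is at most
      \<open>H\<^sup>2 - (H - e)\<^sup>2\<close> when \<open>H > e\<close>.\<close>
    have "(dist p z)\<^sup>2 \<le> 2 * e * H + e\<^sup>2"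
    proof (rule disjE[OF \<tau>(5)])
      assume "infdist (\<sigma> \<tau>) (ray_img b) = dist p (\<sigma> \<tau>)"
      then have "(dist p z)\<^sup>2 \<le> e\<^sup>2" using ze by (intro power_mono) (auto simp: z_def)
      then show ?thesis using e0 zt(2) by (simp add: add_increasing)
    next
      assume "(dist p (\<sigma> \<tau>))\<^sup>2 + (dist u (\<sigma> \<tau>))\<^sup>2 \<le> (dist u p)\<^sup>2"
      then have 1: "(dist p z)\<^sup>2 \<le> H\<^sup>2 - (dist u z)\<^sup>2" by (simp add: z_def H_def)
      show ?thesis
      proof (cases "H \<le> e")
        case True
        then have "H\<^sup>2 \<le> e\<^sup>2" using zt(2) by (intro power_mono) auto
        then show ?thesis using 1 e0 zt(2) by (smt (verit) mult_nonneg_nonneg zero_le_power2)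
      next
        case False
        then have "(H - e)\<^sup>2 \<le> (dist u z)\<^sup>2" using Hz by (intro power_mono) auto
        then have "(dist p z)\<^sup>2 \<le> H\<^sup>2 - (H - e)\<^sup>2" using 1 by simp
        also have "\<dots> = 2 * e * H - e\<^sup>2" by (simp add: power2_eq_square algebra_simps)
        also have "\<dots> \<le> 2 * e * H + e\<^sup>2" by simp
        finally show ?thesis .
      qed
    qed
    then have "dist p z \<le> sqrt (2 * e * H + e\<^sup>2)" by (rule real_le_rsqrt)
    then have "H + dist p t \<le> dist u t + 2 * sqrt (2 * e * H + e\<^sup>2)"
      using zt dist_triangle[of u p z] dist_triangle[of p t z] by (simp add: H_def dist_commute)
    then show ?thesis using bd[OF ab] by (simp add: H_def p_def t_def)
  qed
  show ?thesis by (rule that[of M]) (use main in \<open>auto simp: M_def\<close>)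
qed

text \<open>Suppose that p and p' are far apart and compare at distance s = 200 e from p. By slim1 the
  geodesic from xs to the point q' towards p' almost passes through p, whereas the angle at p
  between x and y is at most a right angle because y is closer to x than p is. By slim2 the
  geodesics from p to p' and to y stay close up to q' and q, a contradiction.\<close>
lemma nearest_points_close:
  fixes x y p p' :: "'a::metric_space"
  assumes X: "CAT0 (UNIV :: 'a set)" and b: "geodesic_ray bp b" and ab: "0 \<le> \<alpha>" "0 \<le> \<beta>"
    and p: "p = b \<alpha>" "\<forall>z\<in>ray_img b. dist x p \<le> dist x z"
    and p': "p' = b \<beta>" "\<forall>z\<in>ray_img b. dist y p' \<le> dist y z"
    and xy: "dist x y \<le> dist x p" and e: "0 < e"
    and slim1: "\<And>u \<gamma>. 0 \<le> \<gamma> \<Longrightarrow> \<bar>\<alpha> - \<gamma>\<bar> \<le> \<bar>\<alpha> - \<beta>\<bar> \<Longrightarrow> (\<forall>z\<in>ray_img b. dist u p \<le> dist u z) \<Longrightarrow>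
        dist u p + \<bar>\<alpha> - \<gamma>\<bar> \<le> dist u (b \<gamma>) + 2 * sqrt (2 * e * dist u p + e\<^sup>2)"
    and slim2: "\<And>u. (\<forall>z\<in>ray_img b. dist u p' \<le> dist u z) \<Longrightarrow>
        dist u p' + \<bar>\<alpha> - \<beta>\<bar> \<le> dist u p + 2 * sqrt (2 * e * dist u p' + e\<^sup>2)"
  shows "\<bar>\<alpha> - \<beta>\<bar> \<le> 90000 * e"
proof (rule ccontr)
  assume "\<not> \<bar>\<alpha> - \<beta>\<bar> \<le> 90000 * e"
  \<comment> \<open>At height \<open>s = 200 * e\<close> the square root in \<open>slim1\<close> is
    at most \<open>20.1 * e\<close>, so at least \<open>1.799 * s\<close> of the full length
    \<open>2 * s\<close> remains. The other two sides come out as at most \<open>1.415 * s\<close>,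
    from a right angle, and \<open>0.283 * s\<close>, which together are too short.\<close>
  define D H h Y s where "D = dist p p'" and "H = dist x p" and "h = dist y p'" and "Y = dist y p" and "s = 200 * e"
  have Dab: "D = \<bar>\<alpha> - \<beta>\<bar>" using geodesic_ray_dist[OF b ab] by (simp add: D_def p p')
  have D: "D > 90000 * e" using \<open>\<not> _\<close> Dab by simp
  have pb: "p \<in> ray_img b" "p' \<in> ray_img b" using ab by (auto simp: p p' ray_imgI)
  have hY: "h \<le> Y" using p'(2) pb by (simp add: h_def Y_def)
  have DYh: "D \<le> Y + h" "Y \<le> D + h" using dist_triangle[of p p' y] dist_triangle[of p y p'] by (auto simp: D_def Y_def h_def dist_commute)
  have YH: "Y \<le> 2 * H" using xy dist_triangle[of y p x] by (simp add: Y_def H_def dist_commute)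
  have sY: "s < Y" "s < H" "s < D" using D hY DYh YH e by (auto simp: s_def)
  have pos: "0 < s" "0 < Y" "0 < H" "0 < D" "0 \<le> h" using sY e by (auto simp: s_def h_def)
  have sl: "\<exists>w. dist p w = s \<and> dist p w + dist w v = dist p v" if "s \<le> dist p v" for v
  proof -
    obtain g where g: "geodesic_segment g p v" using geodesic_space_segment X unfolding CAT0_def by blast
    show ?thesis using geodesic_segment_dist_left[OF g, of s] geodesic_segment_dist_right[OF g, of s] that pos
      by (intro exI[of _ "g s"]) auto
  qed
  obtain xs where xs: "dist p xs = s" "dist p xs + dist xs x = dist p x" using sl[of x] sY by (auto simp: H_def dist_commute)
  obtain q where q: "dist p q = s" "dist p q + dist q y = dist p y" using sl[of y] sY by (auto simp: Y_def dist_commute)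
  define \<gamma> where "\<gamma> = (if \<alpha> < \<beta> then \<alpha> + s else \<alpha> - s)"
  define q' where "q' = b \<gamma>"
  have \<gamma>: "0 \<le> \<gamma>" "\<bar>\<alpha> - \<gamma>\<bar> = s" "\<bar>\<gamma> - \<beta>\<bar> = D - s" using sY pos ab unfolding \<gamma>_def Dab by (auto split: if_splits)
  have q': "dist p q' = s" "dist p q' + dist q' p' = dist p p'"
    using geodesic_ray_dist[OF b ab(1) \<gamma>(1)] geodesic_ray_dist[OF b \<gamma>(1) ab(2)] \<gamma> by (auto simp: p p' q'_def D_def[symmetric, unfolded p p'])
  have "\<forall>z\<in>ray_img b. dist xs p \<le> dist xs z"
  proof
    fix z assume "z \<in> ray_img b"
    then have "dist x p \<le> dist x xs + dist xs z" using p(2) dist_triangle[of x z xs] by force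
    then show "dist xs p \<le> dist xs z" using xs by (simp add: dist_commute)
  qed
  from slim1[OF \<gamma>(1) _ this] have "s + s \<le> dist xs q' + 2 * sqrt (2 * e * s + e\<^sup>2)"
    using \<gamma> xs sY Dab by (simp add: q'_def dist_commute)
  moreover have "sqrt (2 * e * s + e\<^sup>2) \<le> 20.1 * e"
    using e by (intro real_le_lsqrt) (auto simp: s_def power2_eq_square)
  ultimately have 3: "1.799 * s \<le> dist xs q'" by (simp add: s_def)
  have 4: "dist xs q \<le> 1.415 * s"
  proof -
    have "H * Y * (dist xs q)\<^sup>2 \<le> H * Y * (s\<^sup>2 + s\<^sup>2) - s * s * (H\<^sup>2 + Y\<^sup>2 - (dist x y)\<^sup>2)"
      using fork[OF X xs(2) q(2)] xs(1) q(1) by (simp add: H_def Y_def dist_commute)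
    moreover have "(dist x y)\<^sup>2 \<le> H\<^sup>2" using xy unfolding H_def by (intro power_mono) auto
    then have "0 \<le> H\<^sup>2 + Y\<^sup>2 - (dist x y)\<^sup>2" by (smt (verit) zero_le_power2)
    then have "0 \<le> s * s * (H\<^sup>2 + Y\<^sup>2 - (dist x y)\<^sup>2)" using pos by (intro mult_nonneg_nonneg) auto
    ultimately have "H * Y * (dist xs q)\<^sup>2 \<le> H * Y * (2 * s\<^sup>2)" by simp
    then have "(dist xs q)\<^sup>2 \<le> 2 * s\<^sup>2" using pos by (simp add: mult_le_cancel_left_pos)
    also have "\<dots> \<le> (1.415 * s)\<^sup>2" by (simp add: power_mult_distrib power2_eq_square)
    finally show ?thesis using pos by (intro power2_le_imp_le[of "dist xs q"]) auto
  qed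
  \<comment> \<open>Here \<open>90000\<close> enters: at heights up to \<open>D\<close> the doubled
    error of \<open>slim2\<close> is at most one percent of \<open>D\<close>.\<close>
  have \<delta>: "sqrt (2 * e * u + e\<^sup>2) \<le> D / 200" if "u \<le> D" for u
  proof (rule real_le_lsqrt)
    have "e * u \<le> e * D" "90000 * (e * D) \<le> D * D" using that e D pos by (auto intro: mult_mono mult_right_mono simp: mult.assoc[symmetric])
    moreover have "90000 * (e * e) \<le> e * D" using e D by (simp add: mult.left_commute)
    moreover have "2 * e * u + e\<^sup>2 = 2 * (e * u) + e * e" "(D / 200)\<^sup>2 = D * D / 40000" "0 \<le> D * D"
      by (simp_all add: power2_eq_square)
    ultimately show "2 * e * u + e\<^sup>2 \<le> (D / 200)\<^sup>2" by linarith
  qed (use pos in auto)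
  \<comment> \<open>Equivalently, the comparison angle at \<open>p\<close> between \<open>p'\<close>
    and \<open>y\<close> has cosine at least \<open>0.96\<close>. The triangle is almost degenerate,
    since \<open>slim2\<close> forces \<open>Y\<close> to be nearly \<open>D + h\<close>.\<close>
  have star: "h\<^sup>2 - (Y - D)\<^sup>2 \<le> 0.08 * (D * Y)"
  proof (cases "h \<le> D")
    case True
    have "h + D \<le> Y + 2 * sqrt (2 * e * h + e\<^sup>2)" using slim2[OF p'(2)] Dab by (simp add: h_def Y_def)
    then have 1: "h - (Y - D) \<le> D / 100" using \<delta>[OF True] by simp
    have "h\<^sup>2 - (Y - D)\<^sup>2 = (h + (Y - D)) * (h - (Y - D))" by (simp add: power2_eq_square algebra_simps)
    also have "\<dots> \<le> (h + (Y - D)) * (D / 100)" using 1 DYh by (intro mult_left_mono) auto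
    also have "\<dots> \<le> (2 * Y) * (D / 100)" using DYh hY pos by (intro mult_right_mono) auto
    also have "\<dots> \<le> 0.08 * (D * Y)" using pos by simp
    finally show ?thesis .
  next
    case False
    obtain g where g: "geodesic_segment g p' y" using geodesic_space_segment X unfolding CAT0_def by blast
    \<comment> \<open>The error in \<open>slim2\<close> grows with the height, so for
      \<open>h > D\<close> it is applied at height \<open>D\<close> on the way to \<open>y\<close>,
      and Stewart carries the result on to \<open>y\<close>.\<close>
    define yu where "yu = g D"
    have yu: "dist p' yu = D" "dist yu y = h - D" "dist p' yu + dist yu y = dist p' y"
      using geodesic_segment_dist_left[OF g, of D] geodesic_segment_dist_right[OF g, of D] False pos
      by (auto simp: h_def yu_def dist_commute)
    have "\<forall>z\<in>ray_img b. dist yu p' \<le> dist yu z"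
    proof
      fix z assume "z \<in> ray_img b"
      then have "dist y p' \<le> dist y yu + dist yu z" using p'(2) dist_triangle[of y z yu] by force
      then show "dist yu p' \<le> dist yu z" using yu by (simp add: dist_commute)
    qed
    from slim2[OF this] have "D + D \<le> dist yu p + 2 * sqrt (2 * e * D + e\<^sup>2)" using yu(1) Dab by (simp add: dist_commute)
    then have "1.99 * D \<le> dist p yu" using \<delta>[of D] by (simp add: dist_commute)
    then have "(1.99 * D)\<^sup>2 \<le> (dist p yu)\<^sup>2" using pos by (intro power_mono) auto
    moreover have "3.96 * D\<^sup>2 \<le> (1.99 * D)\<^sup>2" by (simp add: power_mult_distrib power2_eq_square mult_right_mono)
    ultimately have "3.96 * D\<^sup>2 \<le> (dist p yu)\<^sup>2" by (rule order_trans[rotated])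
    then have "h * (3.96 * D\<^sup>2) \<le> h * (dist p yu)\<^sup>2" using pos by (intro mult_left_mono) auto
    also have "\<dots> \<le> (h - D) * D\<^sup>2 + D * Y\<^sup>2 - D * (h - D) * h"
      using stewart[OF X yu(3), of p] yu by (simp add: h_def Y_def D_def dist_commute)
    finally have "D * (h\<^sup>2 + D\<^sup>2 + 1.96 * (h * D)) \<le> D * Y\<^sup>2" by (simp add: power2_eq_square algebra_simps)
    then have Y2: "h\<^sup>2 + D\<^sup>2 + 1.96 * (h * D) \<le> Y\<^sup>2" using pos by (simp add: mult_le_cancel_left_pos)
    have "h\<^sup>2 - (Y - D)\<^sup>2 = h\<^sup>2 + 2 * (D * Y) - D\<^sup>2 - Y\<^sup>2" by (simp add: power2_eq_square algebra_simps)
    also have "\<dots> \<le> 2 * (D * Y) - 2 * D\<^sup>2 - 1.96 * (h * D)" using Y2 by simp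
    also have "\<dots> = D * (2 * Y - 2 * D - 1.96 * h)" by (simp add: power2_eq_square algebra_simps)
    also have "\<dots> \<le> D * (0.04 * Y)" using DYh hY pos by (intro mult_left_mono) auto
    also have "\<dots> \<le> 0.08 * (D * Y)" using pos by simp
    finally show ?thesis .
  qed
  have 2: "dist q' q \<le> 0.283 * s"
  proof -
    have "D * Y * (dist q' q)\<^sup>2 \<le> D * Y * (s\<^sup>2 + s\<^sup>2) - s * s * (D\<^sup>2 + Y\<^sup>2 - h\<^sup>2)"
      using fork[OF X q'(2) q(2)] q'(1) q(1) by (simp add: D_def Y_def h_def dist_commute)
    also have "\<dots> = s\<^sup>2 * (h\<^sup>2 - (Y - D)\<^sup>2)" by (simp add: power2_eq_square algebra_simps)
    also have "\<dots> \<le> s\<^sup>2 * (0.08 * (D * Y))" using star by (intro mult_left_mono) auto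
    finally have "D * Y * (dist q' q)\<^sup>2 \<le> D * Y * (0.08 * s\<^sup>2)" by (simp add: algebra_simps)
    then have "(dist q' q)\<^sup>2 \<le> 0.08 * s\<^sup>2" using pos by (simp add: mult_le_cancel_left_pos)
    also have "\<dots> \<le> (0.283 * s)\<^sup>2" by (simp add: power_mult_distrib power2_eq_square)
    finally show ?thesis using pos by (intro power2_le_imp_le[of "dist q' q"]) auto
  qed
  show False using 2 3 4 dist_triangle[of xs q' q] pos by (simp add: dist_commute)
qed

theorem kmorse_contracting:
  fixes b :: "real \<Rightarrow> 'a::metric_space"
  assumes P: "proper_space (UNIV :: 'a set)" and X: "CAT0 (UNIV :: 'a set)" and \<kappa>: "kappa_fun \<kappa>"
    and b: "geodesic_ray bp b" and M: "kmorse bp \<kappa> (ray_img b)"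
  shows "kcontracting bp \<kappa> (ray_img b)"
proof -
  obtain M where M: "M \<ge> 1"
    "\<And>u \<alpha> \<beta> e. 0 \<le> \<alpha> \<Longrightarrow> 0 \<le> \<beta> \<Longrightarrow> (\<forall>z\<in>ray_img b. dist u (b \<alpha>) \<le> dist u z) \<Longrightarrow>
        M * \<kappa> (\<alpha> + \<bar>\<alpha> - \<beta>\<bar>) \<le> e \<Longrightarrow>
        dist u (b \<alpha>) + \<bar>\<alpha> - \<beta>\<bar> \<le> dist u (b \<beta>) + 2 * sqrt (2 * e * dist u (b \<alpha>) + e\<^sup>2)"
    using kmorse_slim[OF X \<kappa> b M] by metis
  have core: "dist p p' \<le> 900000 * M * \<kappa> (dist bp x)"
    if xy: "dist x y \<le> infdist x (ray_img b)" and p: "p \<in> proj_set x (ray_img b)" and p': "p' \<in> proj_set y (ray_img b)" for x y p p'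
  proof -
    define k where "k = \<kappa> (dist bp x)"
    have k1: "k \<ge> 1" using kappa_ge_1[OF \<kappa>] by (simp add: k_def)
    obtain \<alpha> \<beta> where ab: "p = b \<alpha>" "0 \<le> \<alpha>" "p' = b \<beta>" "0 \<le> \<beta>" using p p' by (auto simp: proj_set_def ray_img_def)
    have near: "\<forall>z\<in>ray_img b. dist x p \<le> dist x z" "\<forall>z\<in>ray_img b. dist y p' \<le> dist y z"
      using p p' by (auto simp: proj_set_def infdist_le)
    have xyp: "dist x y \<le> dist x p" using xy p by (simp add: proj_set_def)
    have "b 0 = bp" using b by (simp add: geodesic_ray_def)
    then have "dist x p \<le> dist bp x" using near(1) ray_imgI[of 0 b] by (metis dist_commute order_refl)
    moreover have "dist y p' \<le> dist y p" using near(2) ab by (simp add: ray_imgI)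
    ultimately have "\<alpha> \<le> 2 * dist bp x" "dist p p' \<le> 4 * dist bp x"
      using xyp dist_triangle[of bp p x] dist_triangle[of y p x] dist_triangle[of p p' y] geodesic_ray_dist_base[OF b ab(2)] ab
      by (auto simp: dist_commute)
    then have ab2: "\<alpha> \<le> 2 * dist bp x" "\<bar>\<alpha> - \<beta>\<bar> \<le> 4 * dist bp x" using geodesic_ray_dist[OF b ab(2,4)] ab by auto
    have "\<bar>\<alpha> - \<beta>\<bar> \<le> 90000 * (10 * M * k)"
    proof (rule nearest_points_close[OF X b ab(2,4,1) near(1) ab(3) near(2) xyp])
      show "0 < 10 * M * k" using M(1) k1 by simp
      \<comment> \<open>The largest argument of \<open>\<kappa>\<close> is
        \<open>\<beta> + \<bar>\<beta> - \<alpha>\<bar>\<close>, at most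
        \<open>\<alpha> + 2 * \<bar>\<alpha> - \<beta>\<bar>\<close>, which \<open>ab2\<close>
        bounds by ten times \<open>dist bp x\<close>.\<close>
      have kb: "M * \<kappa> t \<le> 10 * M * k" if "0 \<le> t" "t \<le> 10 * dist bp x" for t
        using kappa_scale_le[OF \<kappa>, of 10 "dist bp x" t] that M(1) by (simp add: k_def)
      {
        fix u \<gamma> assume "0 \<le> \<gamma>" "\<bar>\<alpha> - \<gamma>\<bar> \<le> \<bar>\<alpha> - \<beta>\<bar>" "\<forall>z\<in>ray_img b. dist u p \<le> dist u z"
        then show "dist u p + \<bar>\<alpha> - \<gamma>\<bar> \<le> dist u (b \<gamma>) + 2 * sqrt (2 * (10 * M * k) * dist u p + (10 * M * k)\<^sup>2)"
          unfolding ab(1) by (intro M(2) kb) (use ab ab2 in auto)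
      }
      {
        fix u assume "\<forall>z\<in>ray_img b. dist u p' \<le> dist u z"
        then have "dist u p' + \<bar>\<beta> - \<alpha>\<bar> \<le> dist u p + 2 * sqrt (2 * (10 * M * k) * dist u p' + (10 * M * k)\<^sup>2)"
          unfolding ab(1,3) by (intro M(2) kb) (use ab ab2 in auto)
        then show "dist u p' + \<bar>\<alpha> - \<beta>\<bar> \<le> dist u p + 2 * sqrt (2 * (10 * M * k) * dist u p' + (10 * M * k)\<^sup>2)"
          by (simp add: abs_minus_commute)
      }
    qed
    then show ?thesis using geodesic_ray_dist[OF b ab(2,4)] ab by (simp add: k_def)
  qed
  have cl: "closed (ray_img b)" by (rule closed_coarse_ray[OF P geodesic_ray_qg[OF b]])
  show ?thesis unfolding kcontracting_def
  proof (intro exI allI impI)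
    fix x y assume xy: "dist x y \<le> infdist x (ray_img b)"
    define S where "S = proj_set x (ray_img b) \<union> proj_set y (ray_img b)"
    obtain p0 where p0: "p0 \<in> proj_set x (ray_img b)"
      using proj_set_nonempty[OF P cl ray_img_nonempty, of x] by (auto simp: proj_set_def)
    \<comment> \<open>The pair \<open>x, x\<close> bounds the projections of \<open>x\<close>
      itself. All points of \<open>S\<close> are compared with \<open>p0\<close>, which doubles the
      constant.\<close>
    have x0: "dist x x \<le> infdist x (ray_img b)" by (simp add: infdist_nonneg)
    have 1: "dist p0 w \<le> 900000 * M * \<kappa> (dist bp x)" if "w \<in> S" for w
      using that core[OF xy p0] core[OF x0 p0] by (auto simp: S_def)
    have 2: "dist v w \<le> 1800000 * M * \<kappa> (dist bp x)" if "v \<in> S" "w \<in> S" for v w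
      using 1[OF that(1)] 1[OF that(2)] dist_triangle[of v w p0] by (simp add: dist_commute)
    have "p0 \<in> S" using p0 by (simp add: S_def)
    then show "diameter S \<le> (1800000 * M) * \<kappa> (dist bp x)"
      unfolding diameter_def using 2 by (auto intro!: cSUP_least)
  qed
qed

section \<open>Geodesic rays as limits of geodesic segments\<close>

text \<open>By Tychonoff's theorem the maps h with h t in cball bp (abs t) form a compact space, in which
  being a geodesic close to Z up to time n is a closed condition.\<close>
lemma geodesic_limit:
  fixes Z :: "'a::metric_space set"
  assumes P: "proper_space (UNIV :: 'a set)"
    and seg: "\<And>n::nat. \<exists>y g. geodesic_segment g bp y \<and> real n \<le> dist bp y \<and>
        (\<forall>t\<in>{0..dist bp y}. infdist (g t) Z \<le> M * \<kappa> t)"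
  obtains b where "geodesic_ray bp b" "\<forall>t\<ge>0. infdist (b t) Z \<le> M * \<kappa> t"
proof -
  define K :: "(real \<Rightarrow> 'a) set" where "K = (\<Pi>\<^sub>E t\<in>UNIV. cball bp \<bar>t\<bar>)"
  define F :: "nat \<Rightarrow> (real \<Rightarrow> 'a) set" where "F n = (\<Inter>s\<in>{0..real n}. \<Inter>t\<in>{0..real n}.
      {h. dist (h s) (h t) = \<bar>s - t\<bar>} \<inter> {h. infdist (h t) Z \<le> M * \<kappa> t}) \<inter> {h. h 0 = bp}" for n
  have "compact (cball bp r)" for r
    using P by (simp add: proper_space_def)
  then have "compactin (product_topology (\<lambda>t. euclidean) UNIV) K"
    unfolding K_def by (subst compactin_PiE) auto
  then have cK: "compact K" by (simp add: euclidean_product_topology)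
  have clF: "closed (F n)" for n
    unfolding F_def
    by (intro closed_Int closed_INT ballI closed_Collect_eq closed_Collect_le continuous_intros continuous_on_product_coordinates)
  have fipF: "K \<inter> \<Inter>F' \<noteq> {}" if F': "finite F'" "F' \<subseteq> range F" for F'
  proof -
    obtain C where C: "finite C" "F' = F ` C" using finite_subset_image[OF F'] by blast
    define N where "N = (if C = {} then 0 else Max C)"
    have N: "n \<le> N" if "n \<in> C" for n using that C(1) by (auto simp: N_def)
    obtain y g where g: "geodesic_segment g bp y" "real N \<le> dist bp y" "\<forall>t\<in>{0..dist bp y}. infdist (g t) Z \<le> M * \<kappa> t"
      using seg by blast
    \<comment> \<open>Clamping the parameter extends \<open>g\<close> to all times without leaving
      \<open>K\<close>.\<close>
    define h where "h t = g (max 0 (min t (dist bp y)))" for t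
    have "h \<in> K"
      using geodesic_segment_dist_left[OF g(1)] by (auto simp: K_def h_def)
    moreover have "h \<in> F n" if "n \<in> C" for n
    proof -
      have n: "real n \<le> dist bp y" using N[OF that] g(2) by (meson of_nat_le_iff order_trans)
      have "h t = g t" if "t \<in> {0..real n}" for t using that n by (auto simp: h_def)
      moreover have "g 0 = bp" using g(1) by (simp add: geodesic_segment_def)
      ultimately show ?thesis
        unfolding F_def using n g(3) by (auto simp: geodesic_segment_dist[OF g(1)])
    qed
    ultimately show ?thesis using C by blast
  qed
  have "K \<inter> \<Inter>(range F) \<noteq> {}"
    by (rule compact_imp_fip[OF cK _ fipF]) (use clF in blast)
  then obtain b where "b \<in> \<Inter>(range F)" by blast
  then have b: "b \<in> F n" for n by blast
  have main: "dist (b s) (b t) = \<bar>s - t\<bar> \<and> infdist (b t) Z \<le> M * \<kappa> t" if st: "0 \<le> s" "0 \<le> t" for s t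
  proof -
    obtain n :: nat where "max s t \<le> real n" using real_arch_simple by blast
    then have "s \<in> {0..real n}" "t \<in> {0..real n}" using st by auto
    then show ?thesis using b[of n] unfolding F_def by blast
  qed
  have "b 0 = bp" using b[of 0] unfolding F_def by blast
  then show ?thesis using that[of b] main by (auto simp: geodesic_ray_def)
qed

text \<open>The limit only preserves closeness of the geodesics to \<open>\<zeta>\<close>; the other
  half of fellow travelling comes from \<open>kclose_reverse\<close>.\<close>

lemma geodesic_limit_fellow:
  fixes \<zeta> :: "real \<Rightarrow> 'a::metric_space"
  assumes P: "proper_space (UNIV :: 'a set)" and \<kappa>: "kappa_fun \<kappa>" and \<zeta>: "qg_ray bp q Q \<zeta>"
    and seg: "\<And>n::nat. \<exists>y g. geodesic_segment g bp y \<and> real n \<le> dist bp y \<and>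
        (\<forall>t\<in>{0..dist bp y}. infdist (g t) (ray_img \<zeta>) \<le> M * \<kappa> t)"
  obtains b where "geodesic_ray bp b" "fellow_travel bp \<kappa> b \<zeta>"
proof -
  obtain b where b: "geodesic_ray bp b" "\<forall>t\<ge>0. infdist (b t) (ray_img \<zeta>) \<le> M * \<kappa> t"
    by (rule geodesic_limit[OF P seg])
  have 1: "kclose bp \<kappa> M (ray_img b) (ray_img \<zeta>)"
    using b by (auto simp: kclose_def ray_img_def geodesic_ray_dist_base)
  have "coarse_ray 1 0 b" using geodesic_ray_qg[OF b(1)] by (simp add: qg_ray_coarse)
  moreover have "coarse_ray q Q \<zeta>" using \<zeta> by (simp add: qg_ray_coarse)
  ultimately obtain m where "kclose bp \<kappa> m (ray_img \<zeta>) (ray_img b)"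
    using kclose_reverse[OF \<kappa> _ _ 1] by blast
  then show ?thesis using that b 1 by (auto simp: fellow_travel_kclose)
qed

section \<open>Geodesics with endpoints on a contracting set\<close>

lemma contracting_proj_dist:
  assumes "kcontracting bp \<kappa> Z" and \<kappa>: "kappa_fun \<kappa>"
  obtains c where "c \<ge> 1" "\<And>x y p p'. dist x y \<le> infdist x Z \<Longrightarrow> p \<in> proj_set x Z \<Longrightarrow> p' \<in> proj_set y Z \<Longrightarrow>
      dist p p' \<le> c * \<kappa> (dist bp x)"
proof -
  obtain c where c: "\<And>x y. dist x y \<le> infdist x Z \<Longrightarrow>
       diameter (proj_set x Z \<union> proj_set y Z) \<le> c * \<kappa> (dist bp x)"
    using assms unfolding kcontracting_def by blast
  have bdd: "bounded (proj_set x Z)" for x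
    by (rule bounded_subset[OF bounded_cball[of x "infdist x Z"]]) (auto simp: proj_set_def)
  have "dist p p' \<le> max c 1 * \<kappa> (dist bp x)"
    if "dist x y \<le> infdist x Z" "p \<in> proj_set x Z" "p' \<in> proj_set y Z" for x y p p'
  proof -
    have "dist p p' \<le> diameter (proj_set x Z \<union> proj_set y Z)"
      using that bdd by (intro diameter_bounded_bound) auto
    also have "\<dots> \<le> c * \<kappa> (dist bp x)" by (rule c[OF that(1)])
    also have "\<dots> \<le> max c 1 * \<kappa> (dist bp x)" using kappa_ge_1[OF \<kappa>, of "dist bp x"] by (intro mult_right_mono) auto
    finally show ?thesis .
  qed
  then show ?thesis using that[of "max c 1"] by auto
qed

text \<open>While a geodesic stays far from Z, each step of length infdist (g s) Z moves the projection
  by a small fraction of the step, so the geodesic cannot stay far from Z for long.\<close>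
lemma contracting_excursion:
  fixes Z :: "'a::metric_space set"
  assumes P: "proper_space (UNIV :: 'a set)" and Z: "closed Z" "Z \<noteq> {}"
    and c: "c \<ge> 1" "\<And>x y p p'. dist x y \<le> infdist x Z \<Longrightarrow> p \<in> proj_set x Z \<Longrightarrow> p' \<in> proj_set y Z \<Longrightarrow>
      dist p p' \<le> c * \<kappa> (dist bp x)"
    and \<kappa>: "kappa_fun \<kappa>" and g: "geodesic_segment g bp y"
    and ae: "0 \<le> a" "a \<le> e" "e \<le> dist bp y"
    and far: "\<And>s. a \<le> s \<Longrightarrow> s \<le> e \<Longrightarrow> 4 * c * \<kappa> s \<le> infdist (g s) Z"
  shows "e - a \<le> 2 * infdist (g a) Z + 3 * infdist (g e) Z"
proof -
  define D where "D s = infdist (g s) Z" for s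
  have gd: "dist (g s) (g t) = \<bar>s - t\<bar>" if "a \<le> s" "s \<le> e" "a \<le> t" "t \<le> e" for s t
    using geodesic_segment_dist[OF g, of s t] that ae by simp
  have D1: "D s \<le> D t + \<bar>s - t\<bar>" if "a \<le> s" "s \<le> e" "a \<le> t" "t \<le> e" for s t
    using infdist_triangle[of "g s" Z "g t"] gd[OF that] by (simp add: D_def)
  have jump: "4 * c * dist p p' \<le> c * D s"
    if "a \<le> s" "s \<le> t" "t \<le> e" "t - s \<le> D s" "p \<in> proj_set (g s) Z" "p' \<in> proj_set (g t) Z" for s t p p'
  proof -
    have "dist p p' \<le> c * \<kappa> (dist bp (g s))" using c(2)[of "g s" "g t" p p'] gd[of s t] that by (simp add: D_def)
    also have "dist bp (g s) = s" using geodesic_segment_dist_left[OF g, of s] that ae by auto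
    finally have "4 * c * dist p p' \<le> 4 * c * (c * \<kappa> s)" using c(1) by (intro mult_left_mono) auto
    also have "\<dots> = c * (4 * c * \<kappa> s)" by simp
    also have "\<dots> \<le> c * D s" using far[of s] that c(1) by (intro mult_left_mono) (auto simp: D_def)
    finally show ?thesis .
  qed
  \<comment> \<open>Each step advances by \<open>D s\<close>, which is at least \<open>1\<close>, so
    \<open>n\<close> steps suffice, and moves the projection by at most a quarter of that. The last,
    incomplete step is paid for by \<open>D s \<le> D e + (e - s)\<close>.\<close>
  have chain: "4 * c * dist p z \<le> c * (2 * (e - s) + D e)"
    if "e - s \<le> real n" "a \<le> s" "s \<le> e" "p \<in> proj_set (g s) Z" "z \<in> proj_set (g e) Z" for n s p z
    using that
  proof (induction n arbitrary: s p)
    case 0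
    then have "s = e" by simp
    then show ?case using jump[of s e p z] 0 by (simp add: D_def infdist_nonneg)
  next
    case (Suc n)
    have De: "D s \<le> D e + (e - s)" using D1[of s e] Suc.prems by simp
    show ?case
    proof (cases "s + D s \<le> e")
      case False
      then have "4 * c * dist p z \<le> c * D s" using jump[of s e p z] Suc.prems by simp
      also have "\<dots> \<le> c * (2 * (e - s) + D e)" using De Suc.prems c(1) by (intro mult_left_mono) auto
      finally show ?thesis .
    next
      case True
      define s' where "s' = s + D s"
      obtain p' where p': "p' \<in> proj_set (g s') Z"
        using proj_set_nonempty[OF P Z, of "g s'"] by (auto simp: proj_set_def)
      have "\<kappa> s \<ge> 1" using kappa_ge_1[OF \<kappa>] Suc.prems ae by simp
      then have "1 \<le> 4 * c * \<kappa> s" using c(1) mult_mono[of 1 "4 * c" 1 "\<kappa> s"] by simp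
      then have D1': "1 \<le> D s" using far[of s] Suc.prems by (simp add: D_def)
      have "4 * c * dist p' z \<le> c * (2 * (e - s') + D e)"
        by (rule Suc.IH) (use D1' Suc.prems True p' in \<open>auto simp: s'_def\<close>)
      moreover have "4 * c * dist p p' \<le> c * D s"
        using jump[of s s' p p'] Suc.prems True p' D1' by (simp add: s'_def)
      moreover have "4 * c * dist p z \<le> 4 * c * dist p p' + 4 * c * dist p' z"
        using mult_left_mono[OF dist_triangle[of p z p'], of "4 * c"] c(1) by (simp add: distrib_left)
      ultimately have "4 * c * dist p z \<le> c * (2 * (e - s') + D e + D s)" by (simp add: distrib_left)
      also have "\<dots> \<le> c * (2 * (e - s) + D e)" using D1' c(1) by (intro mult_left_mono) (auto simp: s'_def)
      finally show ?thesis .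
    qed
  qed
  obtain p where p: "p \<in> proj_set (g a) Z" using proj_set_nonempty[OF P Z, of "g a"] by (auto simp: proj_set_def)
  obtain z where z: "z \<in> proj_set (g e) Z" using proj_set_nonempty[OF P Z, of "g e"] by (auto simp: proj_set_def)
  obtain n :: nat where "e - a \<le> real n" using real_arch_simple by blast
  then have "c * (4 * dist p z) \<le> c * (2 * (e - a) + D e)" using chain[of a n p z] ae p z by simp
  then have 1: "4 * dist p z \<le> 2 * (e - a) + D e" using c(1) by (simp only: mult_le_cancel_left_pos)
  have "e - a \<le> dist (g a) p + dist p z + dist z (g e)"
    using gd[of a e] ae dist_triangle[of "g a" "g e" p] dist_triangle[of p "g e" z] by simp
  then have 2: "e - a \<le> D a + dist p z + D e" using p z by (simp add: proj_set_def D_def dist_commute)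
  have "0 \<le> D e" by (simp add: D_def infdist_nonneg)
  then have "e - a \<le> 2 * D a + 3 * D e" using 1 2 by argo
  then show ?thesis by (simp add: D_def)
qed

text \<open>Around a time \<open>s\<close>, the geodesic is far from \<open>Z\<close> only on an
  excursion whose ends are within a multiple of \<open>\<kappa>\<close> of \<open>Z\<close>. By
  \<open>contracting_excursion\<close> its length, and with it the distance at \<open>s\<close>, is
  bounded by the distances at its ends.\<close>

lemma contracting_geodesics_close:
  fixes Z :: "'a::metric_space set"
  assumes P: "proper_space (UNIV :: 'a set)" and \<kappa>: "kappa_fun \<kappa>" and con: "kcontracting bp \<kappa> Z"
    and Z: "closed Z" "bp \<in> Z"
  obtains M where "\<And>g y s. geodesic_segment g bp y \<Longrightarrow> y \<in> Z \<Longrightarrow> 0 \<le> s \<Longrightarrow> s \<le> dist bp y \<Longrightarrow>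
      infdist (g s) Z \<le> M * \<kappa> s"
proof -
  obtain c where c: "c \<ge> 1" "\<And>x y p p'. dist x y \<le> infdist x Z \<Longrightarrow> p \<in> proj_set x Z \<Longrightarrow> p' \<in> proj_set y Z \<Longrightarrow>
      dist p p' \<le> c * \<kappa> (dist bp x)" using contracting_proj_dist[OF con \<kappa>] by metis
  define N where "N = 4 * c + 1"
  obtain C where C: "C \<ge> 1" "\<And>s t. 0 \<le> s \<Longrightarrow> 0 \<le> t \<Longrightarrow> t \<le> (3 * N + 1) * (s + \<kappa> t + \<kappa> s + 1) \<Longrightarrow> \<kappa> t \<le> C * \<kappa> s"
    using kappa_control[OF \<kappa>, of "3 * N + 1"] by blast
  have N: "N \<ge> 1" using c by (simp add: N_def)
  have "infdist (g s) Z \<le> (3 * N + 3 * (N * C)) * \<kappa> s"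
    if g: "geodesic_segment g bp y" and y: "y \<in> Z" and s: "0 \<le> s" "s \<le> dist bp y" for g y s
  proof -
    define D where "D t = infdist (g t) Z" for t
    define L where "L = dist bp y"
    have D1: "D t \<le> D t' + \<bar>t - t'\<bar>" if "0 \<le> t" "t \<le> L" "0 \<le> t'" "t' \<le> L" for t t'
      using infdist_triangle[of "g t" Z "g t'"] geodesic_segment_dist[OF g, of t t'] that by (simp add: D_def L_def)
    have D0: "D 0 = 0" "D L = 0" using g y Z by (auto simp: D_def L_def geodesic_segment_def)
    have k: "\<kappa> t \<ge> 1" if "0 \<le> t" for t using kappa_ge_1[OF \<kappa> that] .
    define S where "S = {t. 0 \<le> t \<and> t \<le> s \<and> D t \<le> 4 * c * \<kappa> t}"
    define S' where "S' = {t. s \<le> t \<and> t \<le> L \<and> D t \<le> 4 * c * \<kappa> t}"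
    have "0 \<le> 4 * c * \<kappa> 0" "0 \<le> 4 * c * \<kappa> L" using c k[of 0] k[of L] by (simp_all add: L_def)
    then have mem: "0 \<in> S" "L \<in> S'" using s D0 by (auto simp: S_def S'_def L_def)
    have bdd: "bdd_above S" "bdd_below S'" by (auto simp: S_def S'_def bdd_above_def bdd_below_def)
    \<comment> \<open>Supremum and infimum are approached up to \<open>1\<close> instead of
      attained; from \<open>a + 1\<close> to \<open>e - 1\<close> the geodesic is certainly far from
      \<open>Z\<close>.\<close>
    obtain a where a: "a \<in> S" "Sup S - 1 < a" using less_cSupE[of "Sup S - 1" S] mem by auto
    obtain e where e: "e \<in> S'" "e < Inf S' + 1" using cInf_lessD[of S' "Inf S' + 1"] mem by auto
    have a': "0 \<le> a" "a \<le> s" "D a \<le> 4 * c * \<kappa> a" and e': "s \<le> e" "e \<le> L" "D e \<le> 4 * c * \<kappa> e"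
      using a e by (auto simp: S_def S'_def)
    have Nt: "N * \<kappa> t = 4 * c * \<kappa> t + \<kappa> t" for t by (simp add: N_def algebra_simps)
    have "\<kappa> a \<le> \<kappa> s" using kappa_mono[OF \<kappa>] a' by auto
    then have "4 * c * \<kappa> a \<le> 4 * c * \<kappa> s" using c(1) by (intro mult_left_mono) auto
    then have Da: "D a + 1 \<le> N * \<kappa> s" using a' k[OF s(1)] Nt[of s] by linarith
    have De: "D e + 1 \<le> N * \<kappa> e" using e' k[of e] s Nt[of e] by linarith
    \<comment> \<open>The excursion is bounded through \<open>\<kappa> e\<close> at its unknown end;
      \<open>kappa_control\<close> replaces this by \<open>\<kappa> s\<close>.\<close>
    have ctrl: "\<kappa> e \<le> C * \<kappa> s" if "e \<le> s + 2 + 2 * (N * \<kappa> s) + 3 * (N * \<kappa> e)"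
    proof (rule C(2))
      have "0 \<le> N * s" "N \<le> N * \<kappa> s" "1 \<le> \<kappa> s" "1 \<le> \<kappa> e" "0 \<le> N * \<kappa> e" using N k[of s] k[of e] s e' by auto
      moreover have "(3 * N + 1) * (s + \<kappa> e + \<kappa> s + 1)
         = 3 * (N * s) + 3 * (N * \<kappa> e) + 3 * (N * \<kappa> s) + 3 * N + s + \<kappa> e + \<kappa> s + 1" by (simp add: algebra_simps)
      ultimately show "e \<le> (3 * N + 1) * (s + \<kappa> e + \<kappa> s + 1)" using that N s by linarith
    qed (use s e' in auto)
    have Nk: "0 \<le> N * \<kappa> s" "0 \<le> N * \<kappa> e" using N k[of s] k[of e] s e' by auto
    have fin: ?thesis if 1: "D s \<le> 3 * (N * \<kappa> s) + 3 * (N * \<kappa> e)" and 2: "e \<le> s + 2 + 2 * (N * \<kappa> s) + 3 * (N * \<kappa> e)"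
    proof -
      have "N * \<kappa> e \<le> N * (C * \<kappa> s)" using ctrl[OF 2] N by (intro mult_left_mono) auto
      then show ?thesis using 1 by (simp add: D_def algebra_simps)
    qed
    consider "s < a + 1" | "e - 1 < s" | "a + 1 \<le> s" "s \<le> e - 1" by linarith
    then show ?thesis
    proof cases
      case 1
      then have "D s \<le> N * \<kappa> s" using D1[of s a] a' s Da by (simp add: L_def)
      also have "\<dots> \<le> (3 * N + 3 * (N * C)) * \<kappa> s" using N C(1) k[of s] s by (intro mult_right_mono) auto
      finally show ?thesis by (simp add: D_def)
    next
      case 2
      then have "D s \<le> N * \<kappa> e" using D1[of s e] e' s De by (simp add: L_def)
      then show ?thesis using fin 2 Nk by simp
    next
      case 3
      have far: "4 * c * \<kappa> t \<le> infdist (g t) Z" if t: "a + 1 \<le> t" "t \<le> e - 1" for t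
      proof (cases "t \<le> s")
        case True
        have "t \<notin> S" using a(2) t cSup_upper[OF _ bdd(1), of t] by auto
        then show ?thesis using True t a' by (auto simp: S_def D_def)
      next
        case False
        have "t \<notin> S'" using e(2) t cInf_lower[OF _ bdd(2), of t] by auto
        then show ?thesis using False t e' by (auto simp: S'_def D_def)
      qed
      have "(e - 1) - (a + 1) \<le> 2 * D (a + 1) + 3 * D (e - 1)" unfolding D_def
        by (rule contracting_excursion[OF P Z(1) _ c \<kappa> g]) (use Z 3 a' e' far in \<open>auto simp: L_def\<close>)
      moreover have "D (a + 1) \<le> D a + 1" "D (e - 1) \<le> D e + 1" "D s \<le> D (a + 1) + (s - (a + 1))"
        using D1[of "a + 1" a] D1[of "e - 1" e] D1[of s "a + 1"] 3 a' e' by auto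
      ultimately show ?thesis using fin Da De 3 a' by linarith
    qed
  qed
  then show ?thesis using that by blast
qed

lemma contracting_geodesic_ray:
  fixes \<beta> :: "real \<Rightarrow> 'a::metric_space"
  assumes P: "proper_space (UNIV :: 'a set)" and X: "geodesic_space (UNIV :: 'a set)"
    and \<kappa>: "kappa_fun \<kappa>" and \<beta>: "qg_ray bp q Q \<beta>" and con: "kcontracting bp \<kappa> (ray_img \<beta>)"
  obtains b where "geodesic_ray bp b" "fellow_travel bp \<kappa> b \<beta>"
proof -
  have bp: "bp \<in> ray_img \<beta>" using \<beta> by (auto simp: qg_ray_def ray_img_def)
  obtain M where M: "\<And>g y s. geodesic_segment g bp y \<Longrightarrow> y \<in> ray_img \<beta> \<Longrightarrow> 0 \<le> s \<Longrightarrow> s \<le> dist bp y \<Longrightarrow>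
      infdist (g s) (ray_img \<beta>) \<le> M * \<kappa> s"
    using contracting_geodesics_close[OF P \<kappa> con closed_coarse_ray[OF P \<beta>] bp] by metis
  have q: "coarse_ray q Q \<beta>" "\<beta> 0 = bp" using \<beta> by (auto simp: qg_ray_coarse)
  then have q1: "q \<ge> 1" "Q \<ge> 0" by (auto simp: coarse_ray_def)
  have "\<exists>y g. geodesic_segment g bp y \<and> real n \<le> dist bp y \<and>
        (\<forall>t\<in>{0..dist bp y}. infdist (g t) (ray_img \<beta>) \<le> M * \<kappa> t)" for n
  proof -
    define t where "t = q * (real n + Q)"
    have t: "t \<ge> 0" using q1 by (simp add: t_def)
    have "q * (real n + Q) \<le> q * (dist bp (\<beta> t) + Q)"
      using coarse_ray_lower[OF q(1), of 0 t] t q(2) by (simp add: t_def)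
    then have "real n \<le> dist bp (\<beta> t)" using q1 by simp
    moreover obtain g where "geodesic_segment g bp (\<beta> t)" using geodesic_space_segment[OF X] by blast
    ultimately show ?thesis using M[of g "\<beta> t"] t by (intro exI[of _ "\<beta> t"] exI[of _ g]) (auto simp: ray_imgI)
  qed
  from geodesic_limit_fellow[OF P \<kappa> \<beta> this] show ?thesis using that by blast
qed

section \<open>Morse rays\<close>

text \<open>After time \<open>N\<close> the lower bound keeps the ray outside the ball, so the last
  time inside is a maximum over a compact set; the intermediate value theorem puts that point on the
  sphere.\<close>

lemma last_exit:
  fixes \<zeta> :: "real \<Rightarrow> 'a::metric_space"
  assumes \<zeta>: "qg_ray bp q Q \<zeta>" and R: "0 \<le> R"
  obtains T where "0 \<le> T" "dist bp (\<zeta> T) = R" "\<forall>t\<ge>T. R \<le> dist bp (\<zeta> t)"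
proof -
  have z: "coarse_ray q Q \<zeta>" "continuous_on {0..} \<zeta>" "\<zeta> 0 = bp" using \<zeta> by (auto simp: qg_ray_coarse)
  have q: "q \<ge> 1" "Q \<ge> 0" using z(1) by (auto simp: coarse_ray_def)
  define N where "N = q * (R + 1 + Q)"
  define S where "S = {0..N} \<inter> (\<lambda>t. dist bp (\<zeta> t)) -` {..R}"
  have far: "R < dist bp (\<zeta> t)" if "N \<le> t" for t
  proof -
    have N0: "0 \<le> N" using q R by (simp add: N_def)
    have "q * (R + 1 + Q) \<le> q * (dist bp (\<zeta> t) + Q)" using coarse_ray_lower[OF z(1), of 0 t] that N0 z(3) by (simp add: N_def)
    then have "R + 1 + Q \<le> dist bp (\<zeta> t) + Q" using q(1) mult_le_cancel_left_pos[of q] by simp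
    then show ?thesis by simp
  qed
  have N0: "0 \<le> N" using q R by (simp add: N_def)
  have cont: "continuous_on A (\<lambda>t. dist bp (\<zeta> t))" if "A \<subseteq> {0..}" for A
    using continuous_on_subset[OF z(2) that] by (intro continuous_intros)
  have "closed S" unfolding S_def by (intro continuous_closed_preimage cont) auto
  moreover have "bounded S" by (rule bounded_subset[of "{0..N}"]) (auto simp: S_def)
  ultimately have "compact S" by (simp add: compact_eq_bounded_closed)
  moreover have "0 \<in> S" using z R N0 by (auto simp: S_def)
  ultimately obtain T where T: "T \<in> S" "\<forall>t\<in>S. t \<le> T" using compact_attains_sup[of S] by blast
  have T0: "0 \<le> T" "T \<le> N" "dist bp (\<zeta> T) \<le> R" using T by (auto simp: S_def)
  have late: "R < dist bp (\<zeta> t)" if "T < t" for t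
  proof (cases "t \<le> N")
    case True
    have "t \<notin> S" using T(2) that by auto
    then show ?thesis using True that T0 by (auto simp: S_def)
  qed (use far[of t] in simp)
  have "R \<le> dist bp (\<zeta> T)"
  proof (rule ccontr)
    assume "\<not> R \<le> dist bp (\<zeta> T)"
    then obtain t where t: "T \<le> t" "t \<le> N" "dist bp (\<zeta> t) = R"
      using IVT'[of "\<lambda>t. dist bp (\<zeta> t)" T R N] far[of N] cont[of "{T..N}"] T0 by auto
    then show False using late[of t] \<open>\<not> R \<le> _\<close> by (cases "t = T") auto
  qed
  then have "R \<le> dist bp (\<zeta> t)" if "T \<le> t" for t using late[of t] that by (cases "t = T") auto
  then show ?thesis using that[of T] T0 \<open>R \<le> dist bp (\<zeta> T)\<close> by auto
qed

text \<open>Following a geodesic up to the last time at which a quasi-geodesic ray meets a sphere, and the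
  ray itself from then on, is again quasi-geodesic, with constants independent of the sphere.\<close>
lemma exit_ray:
  fixes \<zeta> :: "real \<Rightarrow> 'a::metric_space"
  assumes X: "geodesic_space (UNIV :: 'a set)" and \<zeta>: "qg_ray bp q Q \<zeta>" and R: "0 \<le> R"
  obtains y g \<eta> where "geodesic_segment g bp y" "dist bp y = R" "qg_ray bp (3 * q) Q \<eta>"
    "\<forall>t\<in>{0..R}. g t \<in> ray_img \<eta>" "\<forall>x\<in>ray_img \<eta>. infdist x (ray_img \<zeta>) \<le> R"
proof -
  have z: "coarse_ray q Q \<zeta>" "continuous_on {0..} \<zeta>" "\<zeta> 0 = bp" using \<zeta> by (auto simp: qg_ray_coarse)
  have q: "q \<ge> 1" "Q \<ge> 0" using z(1) by (auto simp: coarse_ray_def)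
  obtain T where T: "0 \<le> T" "dist bp (\<zeta> T) = R" "\<forall>t\<ge>T. R \<le> dist bp (\<zeta> t)" by (rule last_exit[OF \<zeta> R])
  define y where "y = \<zeta> T"
  obtain g where g: "geodesic_segment g bp y" by (rule geodesic_space_segment[OF X])
  have y: "dist bp y = R" using T by (simp add: y_def)
  have gd: "dist (g s) (g t) = \<bar>s - t\<bar>" if "0 \<le> s" "s \<le> R" "0 \<le> t" "t \<le> R" for s t
    using geodesic_segment_dist[OF g] that y by simp
  have gR: "g 0 = bp" "g R = y" using g y by (auto simp: geodesic_segment_def)
  define \<eta> where "\<eta> t = (if t \<le> R then g t else \<zeta> (T + t - R))" for t
  have e1: "\<eta> t = g t" if "t \<le> R" for t using that by (simp add: \<eta>_def)
  have e2: "\<eta> t = \<zeta> (T + t - R)" if "R \<le> t" for t using that gR by (cases "t = R") (auto simp: \<eta>_def y_def)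
  have "coarse_ray (3 * q) Q \<eta>"
  proof (rule coarse_rayI)
    show "3 * q \<ge> 1" "Q \<ge> 0" using q by auto
    fix s t :: real assume st: "0 \<le> s" "s \<le> t"
    have "dist (\<eta> s) (\<eta> t) \<le> 3 * q * (t - s) + Q \<and> t - s \<le> 3 * q * (dist (\<eta> s) (\<eta> t) + Q)"
    proof -
      consider "t \<le> R" | "s \<le> R" "R \<le> t" | "R \<le> s" by linarith
      then show ?thesis
      proof cases
        case 1
        then have d: "dist (\<eta> s) (\<eta> t) = t - s" using gd[of s t] st by (simp add: e1)
        moreover have "1 * (t - s) \<le> 3 * q * (t - s)" "3 * q * (t - s) \<le> 3 * q * (t - s + Q)"
          using q st by (intro mult_right_mono mult_left_mono; simp)+
        ultimately have "t - s \<le> 3 * q * (t - s) + Q \<and> t - s \<le> 3 * q * (t - s + Q)" using q by argo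
        then show ?thesis unfolding d .
      next
        case 2
        define c where "c = \<zeta> (T + t - R)"
        have st': "\<eta> s = g s" "\<eta> t = c" using 2 by (auto simp: e1 e2 c_def)
        have sy: "dist (g s) y = R - s" "dist bp (g s) = s" using gd[of s R] gd[of 0 s] gR 2 st R by auto
        have yc: "dist y c \<le> q * (t - R) + Q" using coarse_ray_upper[OF z(1), of T "T + t - R"] T 2 by (simp add: y_def c_def)
        have yc': "t - R \<le> q * (dist y c + Q)" using coarse_ray_lower[OF z(1), of T "T + t - R"] T 2 by (simp add: y_def c_def)
        \<comment> \<open>After the last exit the ray never re-enters the ball, so
          \<open>g s\<close> and \<open>c\<close> are at least \<open>R - s\<close> apart and the
          route through \<open>y\<close> costs at most
          \<open>dist y c \<le> 2 * dist (g s) c\<close>. These two bounds produce the factor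
          3.\<close>
        have "R \<le> dist bp c" using T(3) 2 by (simp add: c_def)
        then have low: "R - s \<le> dist (g s) c" using sy dist_triangle[of bp c "g s"] by simp
        then have "dist y c \<le> 2 * dist (g s) c" using sy dist_triangle[of y c "g s"] by (simp add: dist_commute)
        then have "q * (dist y c + Q) \<le> q * (2 * dist (g s) c + Q)" using q by (intro mult_left_mono) auto
        moreover have "dist (g s) c \<le> q * dist (g s) c" "0 \<le> q * Q" using q mult_right_mono[of 1 q "dist (g s) c"] by auto
        ultimately have 1: "t - s \<le> 3 * q * (dist (g s) c + Q)" using low yc' by (simp add: distrib_left) 
        have "R - s \<le> q * (R - s)" using q 2 mult_right_mono[of 1 q "R - s"] by simp
        then have "dist (g s) c \<le> q * (t - s) + Q" using sy yc dist_triangle[of "g s" c y] by (simp add: right_diff_distrib)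
        moreover have "0 \<le> q * (t - s)" using q st by simp
        ultimately show ?thesis using 1 st' by auto
      next
        case 3
        have 1: "dist (\<eta> s) (\<eta> t) \<le> q * (t - s) + Q" "t - s \<le> q * (dist (\<eta> s) (\<eta> t) + Q)"
          using coarse_ray_upper[OF z(1), of "T + s - R" "T + t - R"] coarse_ray_lower[OF z(1), of "T + s - R" "T + t - R"] 3 st T(1)
          by (auto simp: e2)
        moreover have "0 \<le> q * (t - s)" "0 \<le> q * (dist (\<eta> s) (\<eta> t) + Q)" using q st by auto
        ultimately show ?thesis by auto
      qed
    qed
    then show "t - s \<le> 3 * q * (dist (\<eta> s) (\<eta> t) + Q)" "dist (\<eta> s) (\<eta> t) \<le> 3 * q * (t - s) + Q" by auto
  qed
  moreover have "continuous_on {0..} \<eta>" unfolding \<eta>_def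
  proof (rule continuous_on_cases_le)
    show "continuous_on {t \<in> {0..}. t \<le> R} g"
      by (rule continuous_on_subset[OF geodesic_segment_cont[OF g]]) (use y in auto)
    show "continuous_on {t \<in> {0..}. R \<le> t} (\<lambda>t. \<zeta> (T + t - R))"
      by (rule continuous_on_compose2[OF z(2)]) (use T in \<open>auto intro!: continuous_intros\<close>)
  qed (use gR in \<open>auto intro!: continuous_intros simp: y_def\<close>)
  moreover have "\<eta> 0 = bp" using e1[of 0] gR R by simp
  ultimately have "qg_ray bp (3 * q) Q \<eta>" by (simp add: qg_ray_coarse)
  moreover have "\<forall>t\<in>{0..R}. g t \<in> ray_img \<eta>" using e1 ray_imgI[of _ \<eta>] by (metis atLeastAtMost_iff)
  moreover have "infdist (\<eta> t) (ray_img \<zeta>) \<le> R" if t: "0 \<le> t" for t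
  proof (cases "t \<le> R")
    case True
    then have "dist (\<eta> t) bp \<le> R" using gd[of t 0] gR t by (simp add: e1)
    then show ?thesis using z(3) ray_imgI[of 0 \<zeta>] by (intro infdist_le2[of bp]) auto
  next
    case False
    then show ?thesis using R T by (simp add: e2 ray_imgI)
  qed
  ultimately show ?thesis using that[of g y \<eta>] g y by (auto simp: ray_img_def)
qed


lemma kclose_of_infdist:
  assumes "kappa_fun \<kappa>" "0 \<le> D" "\<forall>x\<in>S. infdist x T \<le> D"
  shows "kclose bp \<kappa> D S T"
  unfolding kclose_def
proof
  fix x assume "x \<in> S"
  then have "infdist x T \<le> D" using assms(3) by auto
  also have "D \<le> D * \<kappa> (dist bp x)" using assms(2) kappa_ge_1[OF assms(1)] by (simp add: mult_le_cancel_left1)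
  finally show "infdist x T \<le> D * \<kappa> (dist bp x)" .
qed

lemma kclose_bounded_set:
  assumes "kappa_fun \<kappa>" "0 \<le> D" "\<forall>x\<in>S. \<exists>y\<in>T. dist x y \<le> D"
  shows "kclose bp \<kappa> D S T"
  using assms(3) by (intro kclose_of_infdist[OF assms(1,2)]) (auto intro: infdist_le2)

text \<open>The rays of \<open>exit_ray\<close> have the same constants for all radii and are each
  at bounded distance from \<open>\<zeta>\<close>. One Morse bound therefore holds for all their
  initial geodesics, as the limit requires.\<close>

lemma kmorse_geodesic_ray:
  fixes \<zeta> :: "real \<Rightarrow> 'a::metric_space"
  assumes P: "proper_space (UNIV :: 'a set)" and X: "geodesic_space (UNIV :: 'a set)"
    and \<kappa>: "kappa_fun \<kappa>" and \<zeta>: "qg_ray bp q Q \<zeta>" and M: "kmorse bp \<kappa> (ray_img \<zeta>)"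
  obtains b where "geodesic_ray bp b" "fellow_travel bp \<kappa> b \<zeta>"
proof -
  obtain M0 where M0: "\<And>\<eta>. qg_ray bp (3 * q) Q \<eta> \<Longrightarrow> \<exists>C. kclose bp \<kappa> C (ray_img \<eta>) (ray_img \<zeta>) \<Longrightarrow>
      kclose bp \<kappa> M0 (ray_img \<eta>) (ray_img \<zeta>)" using M unfolding kmorse_def by blast
  have "\<exists>y g. geodesic_segment g bp y \<and> real n \<le> dist bp y \<and>
        (\<forall>t\<in>{0..dist bp y}. infdist (g t) (ray_img \<zeta>) \<le> M0 * \<kappa> t)" for n
  proof -
    have n: "0 \<le> real n" by simp
    obtain y g \<eta> where g: "geodesic_segment g bp y" "dist bp y = real n" "qg_ray bp (3 * q) Q \<eta>"
      "\<forall>t\<in>{0..real n}. g t \<in> ray_img \<eta>" "\<forall>x\<in>ray_img \<eta>. infdist x (ray_img \<zeta>) \<le> real n"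
      by (rule exit_ray[OF X \<zeta> n])
    have "kclose bp \<kappa> M0 (ray_img \<eta>) (ray_img \<zeta>)"
      using M0[OF g(3)] kclose_of_infdist[OF \<kappa> n g(5)] by blast
    then have "infdist (g t) (ray_img \<zeta>) \<le> M0 * \<kappa> t" if "t \<in> {0..dist bp y}" for t
      using g(4) that geodesic_segment_dist_left[OF g(1), of t] g(2) unfolding kclose_def by force
    then show ?thesis using g(1,2) by (intro exI[of _ y] exI[of _ g]) auto
  qed
  from geodesic_limit_fellow[OF P \<kappa> \<zeta> this] show ?thesis using that by blast
qed

text \<open>Only the existence of an a priori bound is moved from \<open>Z'\<close> to
  \<open>Z\<close>; the uniform bound is then moved back.\<close>

lemma kmorse_cong:
  assumes \<kappa>: "kappa_fun \<kappa>" and M: "kmorse bp \<kappa> Z"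
    and 1: "kclose bp \<kappa> n Z Z'" and 2: "kclose bp \<kappa> n' Z' Z" and ne: "Z \<noteq> {}" "Z' \<noteq> {}"
  shows "kmorse bp \<kappa> Z'"
  unfolding kmorse_def
proof (intro allI)
  fix q Q
  obtain M0 where M0: "\<And>\<eta>. qg_ray bp q Q \<eta> \<Longrightarrow> \<exists>C. kclose bp \<kappa> C (ray_img \<eta>) Z \<Longrightarrow>
      kclose bp \<kappa> M0 (ray_img \<eta>) Z" using M unfolding kmorse_def by blast
  obtain l where l: "\<And>S T U. kclose bp \<kappa> M0 S T \<Longrightarrow> kclose bp \<kappa> n T U \<Longrightarrow> T \<noteq> {} \<Longrightarrow> kclose bp \<kappa> l S U"
    using kclose_trans[OF \<kappa>] by metis
  show "\<exists>M. \<forall>\<eta>. qg_ray bp q Q \<eta> \<and> (\<exists>C. kclose bp \<kappa> C (ray_img \<eta>) Z') \<longrightarrow> kclose bp \<kappa> M (ray_img \<eta>) Z'"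
  proof (intro exI[of _ l] allI impI)
    fix \<eta> assume \<eta>: "qg_ray bp q Q \<eta> \<and> (\<exists>C. kclose bp \<kappa> C (ray_img \<eta>) Z')"
    then obtain C where "kclose bp \<kappa> C (ray_img \<eta>) Z'" by blast
    then have "\<exists>C. kclose bp \<kappa> C (ray_img \<eta>) Z" using kclose_trans[OF \<kappa>] 2 ne by metis
    then show "kclose bp \<kappa> l (ray_img \<eta>) Z'" using l M0 \<eta> 1 ne by blast
  qed
qed

lemma kmorse_fellow_travel:
  assumes "kappa_fun \<kappa>" "kmorse bp \<kappa> (ray_img \<alpha>)" "fellow_travel bp \<kappa> \<alpha> \<beta>"
  shows "kmorse bp \<kappa> (ray_img \<beta>)"
proof -
  obtain n n' where "kclose bp \<kappa> n (ray_img \<alpha>) (ray_img \<beta>)" "kclose bp \<kappa> n' (ray_img \<beta>) (ray_img \<alpha>)"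
    using assms(3) unfolding fellow_travel_kclose by blast
  then show ?thesis by (rule kmorse_cong[OF assms(1,2)]) simp_all
qed

section \<open>From the strong Morse property to the Morse property\<close>

lemma first_time_props:
  assumes \<eta>: "qg_ray bp q Q \<eta>" and R: "0 \<le> R"
  shows "0 \<le> first_time bp \<eta> R" "dist bp (\<eta> (first_time bp \<eta> R)) = R"
    "\<And>T. 0 \<le> T \<Longrightarrow> \<forall>t\<in>{0..T}. dist bp (\<eta> t) < R \<Longrightarrow> T \<le> first_time bp \<eta> R"
proof -
  have z: "continuous_on {0..} \<eta>" using \<eta> by (auto simp: qg_ray_def)
  define S where "S = {t. 0 \<le> t \<and> dist bp (\<eta> t) = R}"
  obtain T where "0 \<le> T" "dist bp (\<eta> T) = R" "\<forall>t\<ge>T. R \<le> dist bp (\<eta> t)" by (rule last_exit[OF \<eta> R])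
  then have ne: "S \<noteq> {}" by (auto simp: S_def)
  have bdd: "bdd_below S" by (auto simp: S_def bdd_below_def)
  have "S = {0..} \<inter> (\<lambda>t. dist bp (\<eta> t)) -` {R}" by (auto simp: S_def)
  moreover have "closed ({0..} \<inter> (\<lambda>t. dist bp (\<eta> t)) -` {R})"
    by (intro continuous_closed_preimage continuous_intros z)
  ultimately have "closed S" by simp
  then have "Inf S \<in> S" using closed_contains_Inf[OF ne bdd] by blast
  then show 1: "0 \<le> first_time bp \<eta> R" "dist bp (\<eta> (first_time bp \<eta> R)) = R" by (auto simp: S_def first_time_def)
  fix T assume "0 \<le> T" "\<forall>t\<in>{0..T}. dist bp (\<eta> t) < R"
  then show "T \<le> first_time bp \<eta> R" using 1 by (metis atLeastAtMost_iff less_irrefl linear)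
qed

text \<open>Sublinearity of \<open>\<kappa>\<close> makes \<open>r / (2 * \<kappa> r)\<close>
  unbounded, so any quasi-geodesic constants are admissible at some large radius.\<close>

lemma large_radius:
  assumes \<kappa>: "kappa_fun \<kappa>"
  obtains r where "N < r" "0 < r" "m \<le> r / (2 * \<kappa> r)"
proof -
  define e where "e = 1 / (4 * (\<bar>m\<bar> + 1))"
  obtain B where B: "B \<ge> 0" "\<And>t. 0 \<le> t \<Longrightarrow> \<kappa> t \<le> e * t + B"
    by (rule kappa_sublinear[OF \<kappa>, of e], simp add: e_def, rule that)
  define r where "r = \<bar>N\<bar> + 1 + 4 * \<bar>m\<bar> * B"
  have r: "0 < r" "N < r"
  proof -
    have "0 \<le> 4 * \<bar>m\<bar> * B" using B(1) by simp
    then show "0 < r" "N < r" unfolding r_def by linarith+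
  qed
  have k: "\<kappa> r \<ge> 1" using kappa_ge_1[OF \<kappa>] r by simp
  have "m * (2 * \<kappa> r) \<le> \<bar>m\<bar> * (2 * \<kappa> r)" using k by (intro mult_right_mono) auto
  also have "\<dots> \<le> \<bar>m\<bar> * (2 * (e * r + B))" using B(2)[of r] r by (intro mult_left_mono) auto
  also have "\<dots> = 2 * (\<bar>m\<bar> * e) * r + 2 * \<bar>m\<bar> * B" by (simp add: algebra_simps)
  also have "\<dots> \<le> 2 * (1/4) * r + r / 2"
  proof (rule add_mono)
    have "\<bar>m\<bar> * e \<le> 1/4" by (simp add: e_def field_simps)
    then show "2 * (\<bar>m\<bar> * e) * r \<le> 2 * (1/4) * r" using r by (intro mult_right_mono) auto
    show "2 * \<bar>m\<bar> * B \<le> r / 2" by (simp add: r_def)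
  qed
  finally have "m * (2 * \<kappa> r) \<le> r" by simp
  then have "m \<le> r / (2 * \<kappa> r)" using k by (simp add: pos_le_divide_eq)
  then show ?thesis using that r by blast
qed

text \<open>A negative radius R in the strong Morse property makes first_time the infimum of the empty
  set, an unspecified constant. Replacing the gauge by a large constant on negative
  arguments turns this case into the radius 0.\<close>
lemma strongly_morse_nonneg_radius:
  fixes b :: "real \<Rightarrow> 'a::metric_space"
  assumes \<kappa>: "kappa_fun \<kappa>" and sm: "strongly_morse bp \<kappa> b m" and m: "\<forall>q Q. max q Q \<le> m q Q"
    and b: "geodesic_ray bp b" and r: "0 < r" and n: "0 < n"
  obtains R where "0 \<le> R" "\<And>q Q \<eta>. qg_ray bp q Q \<eta> \<Longrightarrow> m q Q \<le> r / (2 * \<kappa> r) \<Longrightarrow>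
      infdist (\<eta> (first_time bp \<eta> R)) (ray_img b) \<le> n * \<kappa> R \<Longrightarrow>
      ray_upto bp \<eta> r \<subseteq> knbhd bp \<kappa> (ray_img b) (m q Q)"
proof -
  define x0 :: real where "x0 = Inf {}"
  define q0 where "q0 = r / (2 * \<kappa> r)"
  \<comment> \<open>\<open>kappa_fun\<close> leaves negative arguments free. Since \<open>q\<close>
    and \<open>Q\<close> are at most \<open>q0\<close> for admissible rays, this constant times
    \<open>n\<close> bounds the distance of \<open>\<eta>' x0\<close> from \<open>bp\<close>, so the
    condition at a negative \<open>R\<close> is automatic.\<close>
  define \<kappa>' where "\<kappa>' t = (if 0 \<le> t then \<kappa> t else (q0 * \<bar>x0\<bar> + q0) / n)" for t
  have "kappa_fun \<kappa>'"
  proof -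
    have "((\<lambda>t. \<kappa>' t / t) \<longlongrightarrow> 0) at_top \<longleftrightarrow> ((\<lambda>t. \<kappa> t / t) \<longlongrightarrow> 0) at_top"
    proof (rule tendsto_cong)
      show "\<forall>\<^sub>F t in at_top. \<kappa>' t / t = \<kappa> t / t"
        using eventually_ge_at_top[of "0::real"] by eventually_elim (simp add: \<kappa>'_def)
    qed
    moreover have "mono_on {0..} \<kappa>' \<longleftrightarrow> mono_on {0..} \<kappa>" by (auto simp: mono_on_def \<kappa>'_def)
    moreover have "concave_on {0..} \<kappa>' \<longleftrightarrow> concave_on {0..} \<kappa>" by (auto simp: concave_on_iff \<kappa>'_def)
    ultimately show ?thesis using \<kappa> by (simp add: kappa_fun_def \<kappa>'_def)
  qed
  then obtain R where R: "\<And>q Q \<eta>. qg_ray bp q Q \<eta> \<Longrightarrow> m q Q \<le> r / (2 * \<kappa> r) \<Longrightarrow>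
      infdist (\<eta> (first_time bp \<eta> R)) (ray_img b) \<le> n * \<kappa>' R \<Longrightarrow>
      ray_upto bp \<eta> r \<subseteq> knbhd bp \<kappa> (ray_img b) (m q Q)"
    using sm r n unfolding strongly_morse_def by meson
  show ?thesis
  proof (cases "0 \<le> R")
    case True
    then show ?thesis using that[of R] R by (auto simp: \<kappa>'_def)
  next
    case False
    have "ray_upto bp \<eta> r \<subseteq> knbhd bp \<kappa> (ray_img b) (m q Q)"
      if \<eta>: "qg_ray bp q Q \<eta>" and mq: "m q Q \<le> r / (2 * \<kappa> r)" for q Q \<eta>
    proof -
      \<comment> \<open>\<open>x0\<close> may be negative, where nothing is known about
        \<open>\<eta>\<close>. Redefining it there changes neither first times nor initial
        parts.\<close>
      define \<eta>' where "\<eta>' t = (if t < 0 then bp else \<eta> t)" for t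
      have q: "q \<le> q0" "Q \<le> q0" "q \<ge> 1" "Q \<ge> 0" using m mq \<eta> by (auto simp: q0_def qg_ray_def intro: order_trans)
      have "continuous_on {0..} \<eta>' \<longleftrightarrow> continuous_on {0..} \<eta>" by (rule continuous_on_cong) (auto simp: \<eta>'_def)
      then have \<eta>': "qg_ray bp q Q \<eta>'" using \<eta> by (auto simp: qg_ray_def \<eta>'_def)
      have ft: "first_time bp \<eta>' \<rho> = first_time bp \<eta> \<rho>" for \<rho>
        unfolding first_time_def by (rule arg_cong[of _ _ Inf]) (auto simp: \<eta>'_def)
      have "{t. 0 \<le> t \<and> dist bp (\<eta>' t) = R} = {}" using False by (auto simp: not_le)
      then have "first_time bp \<eta>' R = x0" unfolding first_time_def x0_def by (rule arg_cong)
      moreover have "infdist (\<eta>' x0) (ray_img b) \<le> n * \<kappa>' R"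
      proof -
        have "dist (\<eta>' x0) bp \<le> q * \<bar>x0\<bar> + Q"
        proof (cases "x0 < 0")
          case True
          moreover have "0 \<le> q * \<bar>x0\<bar> + Q" using q by (intro add_nonneg_nonneg mult_nonneg_nonneg) auto
          ultimately show ?thesis by (simp only: \<eta>'_def if_True dist_self)
        next
          case False
          then show ?thesis using coarse_ray_upper[of q Q \<eta> x0 0] \<eta> by (simp add: \<eta>'_def qg_ray_coarse)
        qed
        also have "\<dots> \<le> q0 * \<bar>x0\<bar> + q0" using q by (intro add_mono mult_right_mono) auto
        finally have "dist (\<eta>' x0) bp \<le> n * \<kappa>' R" using n False by (simp add: \<kappa>'_def)
        moreover have "bp \<in> ray_img b" using b ray_imgI[of 0 b] by (simp add: geodesic_ray_def)
        ultimately show ?thesis by (rule infdist_le2[rotated])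
      qed
      ultimately have "ray_upto bp \<eta>' r \<subseteq> knbhd bp \<kappa> (ray_img b) (m q Q)" using R[OF \<eta>' mq] by simp
      moreover have "ray_upto bp \<eta>' r = ray_upto bp \<eta> r"
        unfolding ray_upto_def ft by (rule image_cong) (auto simp: \<eta>'_def)
      ultimately show ?thesis by simp
    qed
    then show ?thesis using that[of 0] by blast
  qed
qed

text \<open>The a priori constant \<open>C\<close> enters only through \<open>n\<close>, hence
  through the radius \<open>R\<close>; the resulting bound \<open>m q Q\<close> is free of
  it.\<close>

lemma strongly_morse_kmorse:
  fixes b :: "real \<Rightarrow> 'a::metric_space"
  assumes \<kappa>: "kappa_fun \<kappa>" and sm: "strongly_morse bp \<kappa> b m" and m: "\<forall>q Q. max q Q \<le> m q Q"
    and b: "geodesic_ray bp b"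
  shows "kmorse bp \<kappa> (ray_img b)"
  unfolding kmorse_def
proof (intro allI exI impI)
  fix q Q \<eta> assume "qg_ray bp q Q \<eta> \<and> (\<exists>C. kclose bp \<kappa> C (ray_img \<eta>) (ray_img b))"
  then obtain C where \<eta>: "qg_ray bp q Q \<eta>" and C: "kclose bp \<kappa> C (ray_img \<eta>) (ray_img b)" by blast
  define n where "n = max C 1"
  have C': "kclose bp \<kappa> n (ray_img \<eta>) (ray_img b)" by (rule kclose_mono[OF \<kappa> C]) (simp add: n_def)
  show "kclose bp \<kappa> (m q Q) (ray_img \<eta>) (ray_img b)"
    unfolding kclose_def
  proof
    fix x assume "x \<in> ray_img \<eta>"
    then obtain t where t: "0 \<le> t" "x = \<eta> t" by (auto simp: ray_img_def)
    \<comment> \<open>The radius is so large that \<open>q\<close> and \<open>Q\<close> are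
      admissible and that the ray stays inside it up to time \<open>t\<close>; then \<open>x\<close>
      lies in the controlled initial part.\<close>
    obtain r where r: "q * t + Q < r" "0 < r" "m q Q \<le> r / (2 * \<kappa> r)" by (rule large_radius[OF \<kappa>])
    have n0: "0 < n" by (simp add: n_def)
    obtain R where R: "0 \<le> R" "\<And>q Q \<eta>. qg_ray bp q Q \<eta> \<Longrightarrow> m q Q \<le> r / (2 * \<kappa> r) \<Longrightarrow>
      infdist (\<eta> (first_time bp \<eta> R)) (ray_img b) \<le> n * \<kappa> R \<Longrightarrow>
      ray_upto bp \<eta> r \<subseteq> knbhd bp \<kappa> (ray_img b) (m q Q)"
      by (rule strongly_morse_nonneg_radius[OF \<kappa> sm m b r(2) n0], rule that)
    note ft = first_time_props[OF \<eta> R(1)]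
    have "infdist (\<eta> (first_time bp \<eta> R)) (ray_img b) \<le> n * \<kappa> R"
      using C' ft(1,2) ray_imgI[OF ft(1), of \<eta>] unfolding kclose_def by force
    then have sub: "ray_upto bp \<eta> r \<subseteq> knbhd bp \<kappa> (ray_img b) (m q Q)" by (rule R(2)[OF \<eta> r(3)])
    have small: "\<forall>s\<in>{0..t}. dist bp (\<eta> s) < r"
    proof
      fix s assume s: "s \<in> {0..t}"
      have "dist bp (\<eta> s) \<le> q * s + Q" using coarse_ray_upper[of q Q \<eta> 0 s] \<eta> s by (auto simp: qg_ray_coarse)
      also have "\<dots> \<le> q * t + Q" using s \<eta> by (auto simp: qg_ray_def intro!: mult_left_mono)
      finally show "dist bp (\<eta> s) < r" using r(1) by simp
    qed
    have "t \<le> first_time bp \<eta> r" using first_time_props(3)[OF \<eta> less_imp_le[OF r(2)] t(1) small] .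
    then have "x \<in> ray_upto bp \<eta> r" using t by (auto simp: ray_upto_def)
    then show "infdist x (ray_img b) \<le> m q Q * \<kappa> (dist bp x)" using sub by (auto simp: knbhd_def)
  qed
qed

text \<open>By \<open>fork\<close> the distance at time \<open>t\<close> is at most
  \<open>t / T\<close> times the distance at time \<open>T\<close>, and the latter is sublinear in
  \<open>T\<close> because both rays leave \<open>bp\<close> at unit speed. In \<open>Unbhd\<close>
  this reduces the clause over all geodesic rays of a class to one of them.\<close>

lemma geodesic_ray_unique:
  fixes b b' :: "real \<Rightarrow> 'a::metric_space"
  assumes X: "CAT0 (UNIV :: 'a set)" and \<kappa>: "kappa_fun \<kappa>"
    and b: "geodesic_ray bp b" and b': "geodesic_ray bp b'"
    and n: "kclose bp \<kappa> n (ray_img b) (ray_img b')" and t: "0 \<le> t"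
  shows "b t = b' t"
proof -
  define n' where "n' = max n 0"
  have sub: "dist (b T) (b' T) \<le> 2 * (n' * \<kappa> T + 1)" if T: "0 \<le> T" for T
  proof -
    have "infdist (b T) (ray_img b') \<le> n * \<kappa> (dist bp (b T))" using n T by (auto simp: kclose_def ray_imgI)
    also have "\<dots> \<le> n' * \<kappa> T" unfolding geodesic_ray_dist_base[OF b T]
      using kappa_ge_1[OF \<kappa> T] by (intro mult_right_mono) (auto simp: n'_def)
    finally obtain y where "y \<in> ray_img b'" "dist (b T) y \<le> n' * \<kappa> T + 1"
      using infdist_le_of_near[OF ray_img_nonempty] by blast
    then obtain u where u: "0 \<le> u" "dist (b T) (b' u) \<le> n' * \<kappa> T + 1" by (auto simp: ray_img_def)
    have "\<bar>T - u\<bar> \<le> dist (b T) (b' u)"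
      using dist_triangle[of bp "b T" "b' u"] dist_triangle[of bp "b' u" "b T"]
        geodesic_ray_dist_base[OF b T] geodesic_ray_dist_base[OF b' u(1)] by (simp add: dist_commute)
    then show ?thesis using u dist_triangle[of "b T" "b' T" "b' u"] geodesic_ray_dist[OF b' u(1) T] by simp
  qed
  have ray: "dist bp (b t) + dist (b t) (b T) = dist bp (b T)" "dist bp (b' t) + dist (b' t) (b' T) = dist bp (b' T)"
    if "t \<le> T" for T
    using that t geodesic_ray_dist_base[OF b] geodesic_ray_dist_base[OF b'] geodesic_ray_dist[OF b] geodesic_ray_dist[OF b'] by auto
  have "dist (b t) (b' t) \<le> 0 + e" if e: "0 < e" for e
  proof -
    \<comment> \<open>\<open>h\<close> limits the linear part of the error to half of
      \<open>e * T\<close>; the choice of \<open>T\<close> below does the same for the constant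
      part.\<close>
    define h where "h = e / (4 * (n' + 1) * (t + 1))"
    have n0: "0 \<le> n'" by (simp add: n'_def)
    have h: "0 < h" using e n0 t by (simp add: h_def)
    obtain B where B: "B \<ge> 0" "\<And>s. 0 \<le> s \<Longrightarrow> \<kappa> s \<le> h * s + B" by (rule kappa_sublinear[OF \<kappa> h], rule that)
    define T where "T = t + 1 + 4 * t * (n' * B + 1) / e"
    have "0 \<le> 4 * t * (n' * B + 1) / e" using t e n0 B by simp
    then have T: "0 < T" "t \<le> T" using t unfolding T_def by linarith+
    define d where "d = dist (b T) (b' T)"
    have "T * T * (dist (b t) (b' t))\<^sup>2 \<le> T * T * (t\<^sup>2 + t\<^sup>2) - t * t * (T\<^sup>2 + T\<^sup>2 - d\<^sup>2)"
      using fork[OF X ray(1)[OF T(2)] ray(2)[OF T(2)]] T t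
      by (simp add: geodesic_ray_dist_base[OF b] geodesic_ray_dist_base[OF b'] d_def)
    then have "(T * dist (b t) (b' t))\<^sup>2 \<le> (t * d)\<^sup>2" by (simp add: power2_eq_square algebra_simps)
    moreover have "0 \<le> t * d" using t by (simp add: d_def)
    ultimately have "T * dist (b t) (b' t) \<le> t * d" by (rule power2_le_imp_le)
    also have "\<dots> \<le> t * (2 * (n' * (h * T + B) + 1))"
    proof -
      have "n' * \<kappa> T \<le> n' * (h * T + B)" using B(2)[of T] T n0 by (intro mult_left_mono) auto
      then show ?thesis using sub[of T] T t by (intro mult_left_mono) (auto simp: d_def)
    qed
    also have "\<dots> = 2 * (t * n' * h) * T + 2 * t * (n' * B + 1)" by (simp add: algebra_simps)
    also have "\<dots> \<le> (e / 2) * T + (e / 2) * T"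
    proof (rule add_mono)
      have "t * n' \<le> (t + 1) * (n' + 1)" using t n0 by (simp add: algebra_simps)
      then have "t * n' * h \<le> (t + 1) * (n' + 1) * h" using h by (intro mult_right_mono) auto
      also have "\<dots> = e / 4"
      proof -
        have "a * c * (e / (4 * c * a)) = e / 4" if "a \<noteq> 0" "c \<noteq> 0" for a c :: real using that by simp
        from this[of "t + 1" "n' + 1"] show ?thesis using t n0 by (simp add: h_def)
      qed
      finally show "2 * (t * n' * h) * T \<le> (e / 2) * T" using T by (intro mult_right_mono) auto
      have "e * T = e * (t + 1) + 4 * t * (n' * B + 1)" using e by (simp add: T_def field_simps)
      then show "2 * t * (n' * B + 1) \<le> (e / 2) * T" using e t by simp
    qed
    finally have "T * dist (b t) (b' t) \<le> T * e" by (simp add: algebra_simps)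
    then show ?thesis using T(1) by simp
  qed
  then have "dist (b t) (b' t) \<le> 0" by (rule field_le_epsilon)
  then show ?thesis by simp
qed

section \<open>Quasi-isometries with a quasi-inverse\<close>

text \<open>Symmetric in the two maps, so each lemma serves both directions. Exact base points make
  tamed images start at the right point, and the lower bounds follow from the coarse
  inverse.\<close>

definition qi_pair :: "real \<Rightarrow> real \<Rightarrow> 'a::metric_space \<Rightarrow> 'b::metric_space \<Rightarrow> ('a \<Rightarrow> 'b) \<Rightarrow> ('b \<Rightarrow> 'a) \<Rightarrow> bool" where
  "qi_pair k K a b F G \<longleftrightarrow> 1 \<le> k \<and> 0 \<le> K \<and> F a = b \<and> G b = a \<and>
     (\<forall>x y. dist (F x) (F y) \<le> k * dist x y + K) \<and> (\<forall>x y. dist (G x) (G y) \<le> k * dist x y + K) \<and>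
     (\<forall>x. dist (G (F x)) x \<le> K) \<and> (\<forall>y. dist (F (G y)) y \<le> K)"

lemma qi_pair_sym: "qi_pair k K a b F G \<Longrightarrow> qi_pair k K b a G F"
  unfolding qi_pair_def by blast

lemma quasi_isometry_qi_pair:
  assumes "quasi_isometry k K \<Phi>"
  obtains \<Psi> where "qi_pair k (3 * k * K) a (\<Phi> a) \<Phi> \<Psi>"
proof -
  have q: "1 \<le> k" "0 \<le> K" "\<And>x y. dist x y / k - K \<le> dist (\<Phi> x) (\<Phi> y)" "\<And>x y. dist (\<Phi> x) (\<Phi> y) \<le> k * dist x y + K"
    "\<And>y. \<exists>x. dist (\<Phi> x) y \<le> K" using assms by (auto simp: quasi_isometry_def)
  \<comment> \<open>A nearby preimage, forced to be \<open>a\<close> at the base point. The lower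
    bound of \<open>\<Phi>\<close> turns an error of \<open>K\<close> at each of two points into
    \<open>k * (2 * K + K)\<close>, the origin of \<open>3 * k * K\<close>.\<close>
  define \<Psi> where "\<Psi> y = (if y = \<Phi> a then a else SOME x. dist (\<Phi> x) y \<le> K)" for y
  have near: "dist (\<Phi> (\<Psi> y)) y \<le> K" for y
    using someI_ex[OF q(5)[of y]] q(2) by (auto simp: \<Psi>_def)
  have low: "dist x y \<le> k * (dist (\<Phi> x) (\<Phi> y) + K)" for x y using q(3)[of x y] q(1) by (simp add: field_simps)
  have K3: "K \<le> 3 * k * K" "0 \<le> k * K" using q(1,2) mult_right_mono[of 1 "3 * k" K] by auto
  have "dist (\<Psi> (\<Phi> x)) x \<le> 3 * k * K" for x
  proof -
    have "dist (\<Psi> (\<Phi> x)) x \<le> k * (dist (\<Phi> (\<Psi> (\<Phi> x))) (\<Phi> x) + K)" by (rule low)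
    also have "\<dots> \<le> k * (K + K)" using near q(1) by (intro mult_left_mono add_right_mono) auto
    finally show ?thesis using K3 by (simp add: algebra_simps)
  qed
  moreover have "dist (\<Psi> x) (\<Psi> y) \<le> k * dist x y + 3 * k * K" for x y
  proof -
    have "dist (\<Phi> (\<Psi> x)) (\<Phi> (\<Psi> y)) \<le> dist x y + 2 * K"
      using near[of x] near[of y] dist_triangle[of "\<Phi> (\<Psi> x)" "\<Phi> (\<Psi> y)" x] dist_triangle[of x "\<Phi> (\<Psi> y)" y]
      by (simp add: dist_commute)
    then have "k * (dist (\<Phi> (\<Psi> x)) (\<Phi> (\<Psi> y)) + K) \<le> k * (dist x y + 2 * K + K)"
      using q(1) by (intro mult_left_mono) auto
    then show ?thesis using low[of "\<Psi> x" "\<Psi> y"] by (simp add: algebra_simps)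
  qed
  moreover have "dist (\<Phi> (\<Psi> y)) y \<le> 3 * k * K" for y using near[of y] K3 by linarith
  moreover have "dist (\<Phi> x) (\<Phi> y) \<le> k * dist x y + 3 * k * K" for x y using q(4)[of x y] K3 by linarith
  ultimately show ?thesis using that[of \<Psi>] q K3 by (simp add: qi_pair_def \<Psi>_def)
qed

lemma qi_pair_lower:
  assumes "qi_pair k K a b F G"
  shows "dist x y \<le> k * dist (F x) (F y) + 3 * K"
proof -
  have "dist (G (F x)) (G (F y)) \<le> k * dist (F x) (F y) + K" "dist (G (F x)) x \<le> K" "dist (G (F y)) y \<le> K"
    using assms by (auto simp: qi_pair_def)
  then show ?thesis
    using dist_triangle[of x y "G (F x)"] dist_triangle[of "G (F x)" y "G (F y)"] by (simp add: dist_commute)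
qed

lemma coarse_ray_image:
  assumes F: "qi_pair k K a b F G" and \<eta>: "coarse_ray q Q \<eta>"
  shows "coarse_ray (k * q) (k * Q + 3 * K) (F \<circ> \<eta>)"
proof (rule coarse_rayI)
  have k: "1 \<le> k" "0 \<le> K" "\<And>x y. dist (F x) (F y) \<le> k * dist x y + K" using F by (auto simp: qi_pair_def)
  have q: "1 \<le> q" "0 \<le> Q" using \<eta> by (auto simp: coarse_ray_def)
  show "1 \<le> k * q" using mult_mono[of 1 k 1 q] k q by simp
  show "0 \<le> k * Q + 3 * K" using k q by simp
  have kQ: "Q \<le> k * Q" using mult_right_mono[of 1 k Q] k q by simp
  fix s t :: real assume st: "0 \<le> s" "s \<le> t"
  let ?d = "dist (F (\<eta> s)) (F (\<eta> t))"
  have "dist (\<eta> s) (\<eta> t) \<le> k * ?d + 3 * K" by (rule qi_pair_lower[OF F])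
  also have "k * ?d + 3 * K \<le> k * (?d + 3 * K)" using mult_right_mono[of 1 k "3 * K"] k by (simp add: distrib_left)
  finally have 1: "dist (\<eta> s) (\<eta> t) \<le> k * ?d + k * (3 * K)" by (simp add: distrib_left)
  have "k * Q \<le> k * (k * Q)" using kQ k by (intro mult_left_mono) auto
  then have "dist (\<eta> s) (\<eta> t) + Q \<le> k * ?d + k * (k * Q) + k * (3 * K)" using 1 kQ by linarith
  then have "dist (\<eta> s) (\<eta> t) + Q \<le> k * (?d + (k * Q + 3 * K))" by (simp add: algebra_simps)
  then have "q * (dist (\<eta> s) (\<eta> t) + Q) \<le> q * (k * (?d + (k * Q + 3 * K)))" using q by (intro mult_left_mono) auto
  then show "t - s \<le> k * q * (dist ((F \<circ> \<eta>) s) ((F \<circ> \<eta>) t) + (k * Q + 3 * K))"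
    using coarse_ray_lower[OF \<eta>, of s t] st by (simp add: mult_ac)
  have "k * dist (\<eta> s) (\<eta> t) \<le> k * (q * (t - s) + Q)"
    using coarse_ray_upper[OF \<eta>, of s t] st k by (intro mult_left_mono) auto
  then show "dist ((F \<circ> \<eta>) s) ((F \<circ> \<eta>) t) \<le> k * q * (t - s) + (k * Q + 3 * K)"
    using k(2) k(3)[of "\<eta> s" "\<eta> t"] by (simp add: distrib_left)
qed

text \<open>The constants depend on \<open>q\<close> and \<open>Q\<close> but not on the ray, as
  needed for Morse bounds and neighbourhoods.\<close>

lemma qi_tame:
  fixes F :: "'a::metric_space \<Rightarrow> 'b::metric_space"
  assumes X: "geodesic_space (UNIV :: 'b set)" and F: "qi_pair k K a b F G"
  obtains q' Q' D where "0 \<le> D" "\<And>\<eta>. qg_ray a q Q \<eta> \<Longrightarrow>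
    \<exists>\<theta>. qg_ray b q' Q' \<theta> \<and> (\<forall>t\<ge>0. dist (\<theta> t) (F (\<eta> t)) \<le> D)"
proof -
  define Q1 where "Q1 = k * Q + 3 * K"
  have "\<exists>\<theta>. qg_ray b (k * q) (5 * (k * q + Q1)) \<theta> \<and> (\<forall>t\<ge>0. dist (\<theta> t) (F (\<eta> t)) \<le> \<bar>2 * (k * q + Q1)\<bar>)"
    if \<eta>: "qg_ray a q Q \<eta>" for \<eta>
  proof -
    have "coarse_ray (k * q) Q1 (F \<circ> \<eta>)" using coarse_ray_image[OF F] \<eta> by (auto simp: qg_ray_coarse Q1_def)
    then obtain \<theta> where "qg_ray ((F \<circ> \<eta>) 0) (k * q) (5 * (k * q + Q1)) \<theta>"
      "\<forall>t\<ge>0. dist (\<theta> t) ((F \<circ> \<eta>) t) \<le> 2 * (k * q + Q1)" by (rule tame[OF X])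
    moreover have "(F \<circ> \<eta>) 0 = b" using \<eta> F by (simp add: qg_ray_def qi_pair_def)
    ultimately show ?thesis by (intro exI[of _ \<theta>]) force
  qed
  then show ?thesis using that by (metis abs_ge_zero)
qed

text \<open>Norms before and after \<open>F\<close> are comparable because base points correspond,
  so \<open>\<kappa>\<close> at \<open>x\<close> is at most a multiple of \<open>\<kappa>\<close> at
  \<open>F x\<close>.\<close>

lemma kclose_image:
  assumes \<kappa>: "kappa_fun \<kappa>" and F: "qi_pair k K a b F G"
  obtains n' where "\<And>S T. kclose a \<kappa> n S T \<Longrightarrow> T \<noteq> {} \<Longrightarrow> kclose b \<kappa> n' (F ` S) (F ` T)"
proof -
  have k: "1 \<le> k" "0 \<le> K" "\<And>x y. dist (F x) (F y) \<le> k * dist x y + K" "F a = b" using F by (auto simp: qi_pair_def)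
  obtain C where C: "C \<ge> 1" "\<And>s t. 0 \<le> s \<Longrightarrow> 0 \<le> t \<Longrightarrow> t \<le> (k + 3 * K) * (s + \<kappa> t + \<kappa> s + 1) \<Longrightarrow> \<kappa> t \<le> C * \<kappa> s"
    by (rule kappa_control[OF \<kappa>, of "k + 3 * K"], rule that)
  define n0 where "n0 = max n 0"
  define n' where "n' = (k * (n0 + 1) + K) * C"
  have "kclose b \<kappa> n' (F ` S) (F ` T)" if n: "kclose a \<kappa> n S T" and T: "T \<noteq> {}" for S T
    unfolding kclose_def
  proof clarify
    fix x assume x: "x \<in> S"
    define t s where "t = dist a x" and "s = dist b (F x)"
    have ts: "0 \<le> t" "0 \<le> s" "1 \<le> \<kappa> t" "1 \<le> \<kappa> s" using kappa_ge_1[OF \<kappa>] by (auto simp: t_def s_def)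
    have "infdist x T \<le> n * \<kappa> t" using n x by (auto simp: kclose_def t_def)
    also have "\<dots> \<le> n0 * \<kappa> t" using ts by (intro mult_right_mono) (auto simp: n0_def)
    finally obtain y where y: "y \<in> T" "dist x y \<le> n0 * \<kappa> t + 1" by (rule infdist_le_of_near[OF T])
    have "dist (F x) (F y) \<le> k * (n0 * \<kappa> t + 1) + K"
      using k(3)[of x y] mult_left_mono[OF y(2), of k] k(1) by linarith
    also have "\<dots> \<le> k * ((n0 + 1) * \<kappa> t) + K * \<kappa> t"
      using ts k by (intro add_mono mult_left_mono) (auto simp: distrib_right mult_le_cancel_left1)
    also have "\<dots> = (k * (n0 + 1) + K) * \<kappa> t" by (simp add: algebra_simps)
    also have "\<dots> \<le> (k * (n0 + 1) + K) * (C * \<kappa> s)"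
    proof (intro mult_left_mono C(2) ts)
      have "t \<le> k * s + 3 * K" using qi_pair_lower[OF F, of a x] k(4) by (simp add: t_def s_def)
      also have "\<dots> \<le> (k + 3 * K) * s + (k + 3 * K) * (\<kappa> t + \<kappa> s + 1)"
      proof (rule add_mono)
        show "k * s \<le> (k + 3 * K) * s" using k ts by (intro mult_right_mono) auto
        have "3 * K * 1 \<le> (k + 3 * K) * (\<kappa> t + \<kappa> s + 1)" using k ts by (intro mult_mono) auto
        then show "3 * K \<le> (k + 3 * K) * (\<kappa> t + \<kappa> s + 1)" by simp
      qed
      finally show "t \<le> (k + 3 * K) * (s + \<kappa> t + \<kappa> s + 1)" by (simp add: algebra_simps)
      show "0 \<le> k * (n0 + 1) + K" using k by (auto simp: n0_def)
    qed
    finally show "infdist (F x) (F ` T) \<le> n' * \<kappa> (dist b (F x))"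
      using y(1) by (intro infdist_le2[of "F y"]) (auto simp: n'_def s_def)
  qed
  then show ?thesis using that by blast
qed

lemma ray_img_comp: "ray_img (F \<circ> \<alpha>) = F ` ray_img \<alpha>"
  by (auto simp: ray_img_def)

lemma fellow_travel_image:
  assumes \<kappa>: "kappa_fun \<kappa>" and F: "qi_pair k K a b F G" and "fellow_travel a \<kappa> \<alpha> \<beta>"
  shows "fellow_travel b \<kappa> (F \<circ> \<alpha>) (F \<circ> \<beta>)"
proof -
  have "\<exists>m. kclose b \<kappa> m (F ` S) (F ` T)" if "kclose a \<kappa> n S T" "T \<noteq> {}" for n S T
    using that by (rule_tac kclose_image[OF \<kappa> F, of n]) blast
  then show ?thesis
    using assms(3) unfolding fellow_travel_kclose ray_img_comp by (meson ray_img_nonempty)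
qed

lemma fellow_travel_GF:
  assumes \<kappa>: "kappa_fun \<kappa>" and F: "qi_pair k K a b F G"
  shows "fellow_travel a \<kappa> (G \<circ> (F \<circ> \<alpha>)) \<alpha>"
  by (rule fellow_travel_bounded[OF \<kappa>, of "G \<circ> (F \<circ> \<alpha>)" \<alpha> K]) (use F in \<open>simp add: qi_pair_def\<close>)

text \<open>All constants up to \<open>M3\<close> are fixed before \<open>\<eta>\<close>. The a
  priori constant \<open>C\<close> only ensures that the pulled-back ray has some a priori bound,
  and does not enter \<open>M3\<close>.\<close>

lemma kmorse_image:
  fixes F :: "'a::metric_space \<Rightarrow> 'b::metric_space"
  assumes X: "geodesic_space (UNIV :: 'a set)" and \<kappa>: "kappa_fun \<kappa>" and F: "qi_pair k K a b F G"
    and M: "kmorse a \<kappa> Z" and Z: "Z \<noteq> {}"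
  shows "kmorse b \<kappa> (F ` Z)"
  unfolding kmorse_def
proof (intro allI)
  fix q Q
  have k: "1 \<le> k" "0 \<le> K" "\<And>x y. dist (F x) (F y) \<le> k * dist x y + K" "\<And>x. dist (G (F x)) x \<le> K" "\<And>y. dist (F (G y)) y \<le> K"
    using F by (auto simp: qi_pair_def)
  obtain q1 Q1 D where D: "0 \<le> D" "\<And>\<eta>. qg_ray b q Q \<eta> \<Longrightarrow> \<exists>\<theta>. qg_ray a q1 Q1 \<theta> \<and> (\<forall>t\<ge>0. dist (\<theta> t) (G (\<eta> t)) \<le> D)"
    by (rule qi_tame[OF X qi_pair_sym[OF F]], rule that)
  obtain M1 where M1: "\<And>\<eta>. qg_ray a q1 Q1 \<eta> \<Longrightarrow> \<exists>C. kclose a \<kappa> C (ray_img \<eta>) Z \<Longrightarrow>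
      kclose a \<kappa> M1 (ray_img \<eta>) Z" using M unfolding kmorse_def by blast
  obtain M2 where M2: "\<And>S T. kclose a \<kappa> M1 S T \<Longrightarrow> T \<noteq> {} \<Longrightarrow> kclose b \<kappa> M2 (F ` S) (F ` T)"
    by (rule kclose_image[OF \<kappa> F], rule that)
  \<comment> \<open>A point of \<open>\<eta>\<close> is within \<open>K\<close> of its image under
    going back and forth, which is within \<open>k * D + K\<close> of the image of the tamed
    pull-back.\<close>
  define E where "E = k * D + 2 * K"
  have E: "0 \<le> E" using k D by (simp add: E_def)
  obtain M3 where M3: "\<And>S T U. kclose b \<kappa> E S T \<Longrightarrow> kclose b \<kappa> M2 T U \<Longrightarrow> T \<noteq> {} \<Longrightarrow> kclose b \<kappa> M3 S U"
    by (rule kclose_trans[OF \<kappa>], rule that)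
  have "kclose b \<kappa> M3 (ray_img \<eta>) (F ` Z)"
    if \<eta>: "qg_ray b q Q \<eta>" and C: "kclose b \<kappa> C (ray_img \<eta>) (F ` Z)" for \<eta> C
  proof -
    obtain \<theta> where \<theta>: "qg_ray a q1 Q1 \<theta>" "\<forall>t\<ge>0. dist (\<theta> t) (G (\<eta> t)) \<le> D" using D(2)[OF \<eta>] by blast
    have 1: "kclose a \<kappa> D (ray_img \<theta>) (G ` ray_img \<eta>)"
      by (rule kclose_bounded_set[OF \<kappa> D(1)]) (use \<theta> in \<open>auto simp: ray_img_def\<close>)
    obtain C' where 2: "kclose a \<kappa> C' (G ` ray_img \<eta>) (G ` (F ` Z))"
      using kclose_image[OF \<kappa> qi_pair_sym[OF F]] C Z by (metis image_is_empty)
    have 3: "kclose a \<kappa> K (G ` (F ` Z)) Z"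
      by (rule kclose_bounded_set[OF \<kappa> k(2)]) (use k(4) in auto)
    have "\<exists>C. kclose a \<kappa> C (G ` ray_img \<eta>) Z"
      using kclose_trans[OF \<kappa>, of a C' K] 2 3 Z by (metis image_is_empty)
    then obtain C'' where 4: "kclose a \<kappa> C'' (G ` ray_img \<eta>) Z" by blast
    have "\<exists>C. kclose a \<kappa> C (ray_img \<theta>) Z"
      using kclose_trans[OF \<kappa>, of a D C''] 1 4 by (metis image_is_empty ray_img_nonempty)
    then have "kclose a \<kappa> M1 (ray_img \<theta>) Z" using M1[OF \<theta>(1)] by blast
    then have 5: "kclose b \<kappa> M2 (F ` ray_img \<theta>) (F ` Z)" using M2 Z by blast
    have "kclose b \<kappa> E (ray_img \<eta>) (F ` ray_img \<theta>)"
    proof (rule kclose_bounded_set[OF \<kappa> E], rule ballI)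
      fix x assume "x \<in> ray_img \<eta>"
      then obtain t where t: "0 \<le> t" "x = \<eta> t" by (auto simp: ray_img_def)
      have "k * dist (\<theta> t) (G (\<eta> t)) \<le> k * D" using \<theta>(2) t k(1) by (intro mult_left_mono) auto
      then have "dist (F (\<theta> t)) (F (G (\<eta> t))) \<le> k * D + K" using k(3)[of "\<theta> t" "G (\<eta> t)"] by linarith
      then have "dist x (F (\<theta> t)) \<le> E" using k(5)[of "\<eta> t"] dist_triangle[of "\<eta> t" "F (\<theta> t)" "F (G (\<eta> t))"] t
        by (simp add: E_def dist_commute)
      then show "\<exists>y\<in>F ` ray_img \<theta>. dist x y \<le> E" using t by (auto simp: ray_imgI)
    qed
    then show ?thesis using M3 5 by simp
  qed
  then show "\<exists>M. \<forall>\<eta>. qg_ray b q Q \<eta> \<and> (\<exists>C. kclose b \<kappa> C (ray_img \<eta>) (F ` Z)) \<longrightarrow> kclose b \<kappa> M (ray_img \<eta>) (F ` Z)"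
    by blast
qed

section \<open>The induced map on boundaries\<close>

lemma ray_class_eq:
  assumes "kappa_fun \<kappa>" "fellow_travel bp \<kappa> \<alpha> \<beta>"
  shows "ray_class bp \<kappa> \<alpha> = ray_class bp \<kappa> \<beta>"
proof -
  have "fellow_travel bp \<kappa> \<gamma> \<alpha> \<longleftrightarrow> fellow_travel bp \<kappa> \<gamma> \<beta>" for \<gamma>
    using fellow_travel_trans[OF assms(1) _ assms(2)] fellow_travel_trans[OF assms(1) _ fellow_travel_sym[OF assms(2)]]
    by blast
  then show ?thesis by (simp add: ray_class_def)
qed

lemma kbdry_class:
  assumes "kappa_fun \<kappa>" "B \<in> kbdry bp \<kappa>" "\<beta> \<in> B"
  shows "quasi_geodesic_ray bp \<beta>" "B = ray_class bp \<kappa> \<beta>"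
proof -
  obtain \<beta>0 where "B = ray_class bp \<kappa> \<beta>0" using assms by (auto simp: kbdry_def)
  then show "quasi_geodesic_ray bp \<beta>" "B = ray_class bp \<kappa> \<beta>"
    using assms(3) ray_class_eq[OF assms(1), of bp \<beta> \<beta>0] by (auto simp: ray_class_def)
qed


lemma kbdry_geodesic_ray:
  fixes B :: "(real \<Rightarrow> 'a::metric_space) set"
  assumes P: "proper_space (UNIV :: 'a set)" and X: "CAT0 (UNIV :: 'a set)"
    and \<kappa>: "kappa_fun \<kappa>" and B: "B \<in> kbdry bp \<kappa>"
  obtains b where "b \<in> B" "geodesic_ray bp b"
proof -
  obtain \<beta> q Q where \<beta>: "B = ray_class bp \<kappa> \<beta>" "qg_ray bp q Q \<beta>" "kcontracting bp \<kappa> (ray_img \<beta>)"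
    using B by (auto simp: kbdry_def quasi_geodesic_ray_def)
  have "geodesic_space (UNIV :: 'a set)" using X by (simp add: CAT0_def)
  from contracting_geodesic_ray[OF P this \<kappa> \<beta>(2,3)] obtain b where "geodesic_ray bp b" "fellow_travel bp \<kappa> b \<beta>" .
  then show ?thesis using that \<beta>(1) geodesic_ray_qg by (fastforce simp: ray_class_def quasi_geodesic_ray_def)
qed

text \<open>Collecting the rays that fellow-travel the image of some member avoids choosing a
  representative or its taming; by \<open>star_eq\<close> the result is the class of any such
  ray.\<close>

definition star :: "(real \<Rightarrow> real) \<Rightarrow> 'b \<Rightarrow> ('a \<Rightarrow> 'b) \<Rightarrow> (real \<Rightarrow> 'a) set \<Rightarrow> (real \<Rightarrow> 'b::metric_space) set" where
  "star \<kappa> b F B = {\<alpha>. quasi_geodesic_ray b \<alpha> \<and> (\<exists>\<beta>\<in>B. fellow_travel b \<kappa> \<alpha> (F \<circ> \<beta>))}"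

lemma star_eq:
  assumes \<kappa>: "kappa_fun \<kappa>" and F: "qi_pair k K a b F G" and B: "B \<in> kbdry a \<kappa>" "\<beta> \<in> B"
    and \<gamma>: "fellow_travel b \<kappa> \<gamma> (F \<circ> \<beta>)"
  shows "star \<kappa> b F B = ray_class b \<kappa> \<gamma>"
proof -
  have 1: "fellow_travel b \<kappa> (F \<circ> \<beta>') (F \<circ> \<beta>)" if "\<beta>' \<in> B" for \<beta>'
    using that kbdry_class(2)[OF \<kappa> B] fellow_travel_image[OF \<kappa> F] unfolding ray_class_def by blast
  have "(\<exists>\<beta>\<in>B. fellow_travel b \<kappa> \<alpha> (F \<circ> \<beta>)) \<longleftrightarrow> fellow_travel b \<kappa> \<alpha> (F \<circ> \<beta>)" for \<alpha>
    using B(2) fellow_travel_trans[OF \<kappa> _ 1] by blast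
  then have "star \<kappa> b F B = ray_class b \<kappa> (F \<circ> \<beta>)" by (simp add: star_def ray_class_def)
  then show ?thesis using ray_class_eq[OF \<kappa> \<gamma>] by simp
qed

lemma tame_image:
  fixes F :: "'a::metric_space \<Rightarrow> 'b::metric_space"
  assumes X: "geodesic_space (UNIV :: 'b set)" and F: "qi_pair k K a b F G" and \<beta>: "quasi_geodesic_ray a \<beta>"
  obtains \<gamma> D where "quasi_geodesic_ray b \<gamma>" "\<forall>t\<ge>0. dist (\<gamma> t) (F (\<beta> t)) \<le> D"
proof -
  obtain q Q where q: "qg_ray a q Q \<beta>" using \<beta> by (auto simp: quasi_geodesic_ray_def)
  obtain q' Q' D where "0 \<le> D" "\<And>\<eta>. qg_ray a q Q \<eta> \<Longrightarrow> \<exists>\<theta>. qg_ray b q' Q' \<theta> \<and> (\<forall>t\<ge>0. dist (\<theta> t) (F (\<eta> t)) \<le> D)"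
    by (rule qi_tame[OF X F], rule that)
  then show ?thesis using q that unfolding quasi_geodesic_ray_def by blast
qed

lemma star_in_kbdry:
  fixes F :: "'a::metric_space \<Rightarrow> 'b::metric_space"
  assumes PX: "proper_space (UNIV :: 'a set)" and X: "CAT0 (UNIV :: 'a set)"
    and PY: "proper_space (UNIV :: 'b set)" and Y: "CAT0 (UNIV :: 'b set)"
    and \<kappa>: "kappa_fun \<kappa>" and F: "qi_pair k K a b F G" and m: "morse_gauge a \<kappa> m" and B: "B \<in> kbdry a \<kappa>"
  shows "star \<kappa> b F B \<in> kbdry b \<kappa>"
proof -
  have gX: "geodesic_space (UNIV :: 'a set)" and gY: "geodesic_space (UNIV :: 'b set)" using X Y by (auto simp: CAT0_def)
  obtain \<beta> where \<beta>: "\<beta> \<in> B" "geodesic_ray a \<beta>" by (rule kbdry_geodesic_ray[OF PX X \<kappa> B])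
  have "strongly_morse a \<kappa> \<beta> (m B)" "\<forall>q Q. max q Q \<le> m B q Q" using m B \<beta> by (auto simp: morse_gauge_def)
  then have "kmorse a \<kappa> (ray_img \<beta>)" by (rule strongly_morse_kmorse[OF \<kappa> _ _ \<beta>(2)])
  then have 1: "kmorse b \<kappa> (ray_img (F \<circ> \<beta>))" unfolding ray_img_comp by (rule kmorse_image[OF gX \<kappa> F]) simp
  obtain \<gamma> D where \<gamma>: "quasi_geodesic_ray b \<gamma>" "\<forall>t\<ge>0. dist (\<gamma> t) (F (\<beta> t)) \<le> D"
    by (rule tame_image[OF gY F kbdry_class(1)[OF \<kappa> B \<beta>(1)]])
  have ft: "fellow_travel b \<kappa> \<gamma> (F \<circ> \<beta>)" using fellow_travel_bounded[OF \<kappa>, of \<gamma> "F \<circ> \<beta>" D b] \<gamma>(2) by simp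
  have 2: "kmorse b \<kappa> (ray_img \<gamma>)" using kmorse_fellow_travel[OF \<kappa> 1 fellow_travel_sym[OF ft]] .
  obtain q Q where "qg_ray b q Q \<gamma>" using \<gamma> by (auto simp: quasi_geodesic_ray_def)
  from kmorse_geodesic_ray[OF PY gY \<kappa> this 2] obtain b' where b': "geodesic_ray b b'" "fellow_travel b \<kappa> b' \<gamma>" .
  have "kmorse b \<kappa> (ray_img b')" using kmorse_fellow_travel[OF \<kappa> 2 fellow_travel_sym[OF b'(2)]] .
  then have "kcontracting b \<kappa> (ray_img b')" by (rule kmorse_contracting[OF PY Y \<kappa> b'(1)])
  moreover have "star \<kappa> b F B = ray_class b \<kappa> b'"
    by (rule star_eq[OF \<kappa> F B \<beta>(1)]) (rule fellow_travel_trans[OF \<kappa> b'(2) ft])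
  moreover have "quasi_geodesic_ray b b'" using geodesic_ray_qg[OF b'(1)] by (auto simp: quasi_geodesic_ray_def)
  ultimately show ?thesis by (auto simp: kbdry_def)
qed

text \<open>A tamed image of \<open>\<beta>0\<close> lies in the image class, and mapping it back
  gives a ray fellow-travelling \<open>\<beta>0\<close>, since going forth and back moves points by
  at most \<open>K\<close>.\<close>

lemma star_inverse:
  fixes F :: "'a::metric_space \<Rightarrow> 'b::metric_space"
  assumes Y: "geodesic_space (UNIV :: 'b set)" and \<kappa>: "kappa_fun \<kappa>" and F: "qi_pair k K a b F G"
    and B: "B \<in> kbdry a \<kappa>" and sB: "star \<kappa> b F B \<in> kbdry b \<kappa>"
  shows "star \<kappa> a G (star \<kappa> b F B) = B"
proof -
  obtain \<beta>0 where b0: "B = ray_class a \<kappa> \<beta>0" "quasi_geodesic_ray a \<beta>0" using B by (auto simp: kbdry_def)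
  then have \<beta>0: "\<beta>0 \<in> B" using fellow_travel_refl[OF \<kappa>] by (auto simp: ray_class_def)
  obtain \<gamma> D where \<gamma>: "quasi_geodesic_ray b \<gamma>" "\<forall>t\<ge>0. dist (\<gamma> t) (F (\<beta>0 t)) \<le> D" by (rule tame_image[OF Y F b0(2)])
  have ft: "fellow_travel b \<kappa> \<gamma> (F \<circ> \<beta>0)" using fellow_travel_bounded[OF \<kappa>, of \<gamma> "F \<circ> \<beta>0" D b] \<gamma>(2) by simp
  then have "\<gamma> \<in> star \<kappa> b F B" using \<gamma> \<beta>0 by (auto simp: star_def)
  moreover have "fellow_travel a \<kappa> \<beta>0 (G \<circ> \<gamma>)"
    using fellow_travel_image[OF \<kappa> qi_pair_sym[OF F] ft] fellow_travel_GF[OF \<kappa> F, of \<beta>0] fellow_travel_trans[OF \<kappa>] fellow_travel_sym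
    by blast
  ultimately have "star \<kappa> a G (star \<kappa> b F B) = ray_class a \<kappa> \<beta>0" by (rule star_eq[OF \<kappa> qi_pair_sym[OF F] sB])
  then show ?thesis using b0 by simp
qed

section \<open>Continuity of the induced map\<close>

lemma star_continuous:
  fixes F :: "'a::metric_space \<Rightarrow> 'b::metric_space"
  assumes PX: "proper_space (UNIV :: 'a set)" and X: "CAT0 (UNIV :: 'a set)"
    and PY: "proper_space (UNIV :: 'b set)" and Y: "CAT0 (UNIV :: 'b set)"
    and \<kappa>: "kappa_fun \<kappa>" and F: "qi_pair k K a b F G"
    and mX: "morse_gauge a \<kappa> mX" and mY: "morse_gauge b \<kappa> mY" and W: "bopen b \<kappa> mY W"
  shows "bopen a \<kappa> mX (star \<kappa> b F -` W \<inter> kbdry a \<kappa>)"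
  unfolding bopen_def
proof (intro conjI ballI)
  fix B assume "B \<in> star \<kappa> b F -` W \<inter> kbdry a \<kappa>"
  then have B: "B \<in> kbdry a \<kappa>" "star \<kappa> b F B \<in> W" by auto
  define B' where "B' = star \<kappa> b F B"
  have B': "B' \<in> kbdry b \<kappa>" using W B by (auto simp: bopen_def B'_def)
  have gX: "geodesic_space (UNIV :: 'a set)" using X by (simp add: CAT0_def)
  have k: "1 \<le> k" "0 \<le> K" "\<And>x y. dist (F x) (F y) \<le> k * dist x y + K" "\<And>y. dist (F (G y)) y \<le> K"
    using F by (auto simp: qi_pair_def)
  obtain r' where r': "0 < r'" "Unbhd b \<kappa> mY B' r' \<subseteq> W" using W B unfolding bopen_def B'_def by blast
  obtain \<beta> where \<beta>: "\<beta> \<in> B" "geodesic_ray a \<beta>" by (rule kbdry_geodesic_ray[OF PX X \<kappa> B(1)])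
  obtain b' where b': "b' \<in> B'" "geodesic_ray b b'" by (rule kbdry_geodesic_ray[OF PY Y \<kappa> B'])
  have sm: "strongly_morse b \<kappa> b' (mY B')" and mY_ge: "\<forall>q Q. max q Q \<le> mY B' q Q"
    using mY B' b' by (auto simp: morse_gauge_def)
  \<comment> \<open>The neighbourhood of radius \<open>r'\<close> tests only rays with
    \<open>mY B' q Q \<le> r' / (2 * \<kappa> r')\<close>. The gauge dominates \<open>q\<close> and
    \<open>Q\<close>, so these rays all have constants \<open>q0\<close>, \<open>q0\<close>, and
    their pull-backs share \<open>q1\<close>, \<open>Q1\<close> and \<open>D\<close>.\<close>
  define q0 where "q0 = max 1 (r' / (2 * \<kappa> r'))"
  obtain q1 Q1 D where D: "0 \<le> D" "\<And>\<eta>. qg_ray b q0 q0 \<eta> \<Longrightarrow> \<exists>\<theta>. qg_ray a q1 Q1 \<theta> \<and> (\<forall>t\<ge>0. dist (\<theta> t) (G (\<eta> t)) \<le> D)"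
    by (rule qi_tame[OF gX qi_pair_sym[OF F]], rule that)
  define M where "M = mX B q1 Q1"
  text \<open>The constant n is chosen so that a point within M of the ray in the first space is carried to
    a point within n of the geodesic ray of the image class.\<close>
  have "star \<kappa> b F B = ray_class b \<kappa> (F \<circ> \<beta>)" by (rule star_eq[OF \<kappa> F B(1) \<beta>(1) fellow_travel_refl[OF \<kappa>]])
  then have "fellow_travel b \<kappa> b' (F \<circ> \<beta>)" using b'(1) by (simp add: B'_def ray_class_def)
  then obtain n1 where n1: "kclose b \<kappa> n1 (F ` ray_img \<beta>) (ray_img b')"
    by (auto simp: fellow_travel_kclose ray_img_comp)
  obtain n2 where n2: "\<And>S T. kclose a \<kappa> M S T \<Longrightarrow> T \<noteq> {} \<Longrightarrow> kclose b \<kappa> n2 (F ` S) (F ` T)"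
    by (rule kclose_image[OF \<kappa> F], rule that)
  obtain n3 where n3: "\<And>S T U. kclose b \<kappa> n2 S T \<Longrightarrow> kclose b \<kappa> n1 T U \<Longrightarrow> T \<noteq> {} \<Longrightarrow> kclose b \<kappa> n3 S U"
    by (rule kclose_trans[OF \<kappa>], rule that)
  define E where "E = k * D + 2 * K"
  have E: "0 \<le> E" using k D by (simp add: E_def)
  obtain n4 where n4: "\<And>S T U. kclose b \<kappa> E S T \<Longrightarrow> kclose b \<kappa> n3 T U \<Longrightarrow> T \<noteq> {} \<Longrightarrow> kclose b \<kappa> n4 S U"
    by (rule kclose_trans[OF \<kappa>], rule that)
  define n where "n = max n4 1"
  have n: "0 < n" by (simp add: n_def)
  obtain R where R: "0 \<le> R" "\<And>q Q \<eta>. qg_ray b q Q \<eta> \<Longrightarrow> mY B' q Q \<le> r' / (2 * \<kappa> r') \<Longrightarrow>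
      infdist (\<eta> (first_time b \<eta> R)) (ray_img b') \<le> n * \<kappa> R \<Longrightarrow>
      ray_upto b \<eta> r' \<subseteq> knbhd b \<kappa> (ray_img b') (mY B' q Q)"
    by (rule strongly_morse_nonneg_radius[OF \<kappa> sm mY_ge b'(2) r'(1) n], rule that)
  \<comment> \<open>A tested ray first reaches radius \<open>R\<close> at a time at most
    \<open>q0 * (R + q0)\<close>; until then its pull-back stays inside radius \<open>r\<close>. The
    last condition makes the pull-back one of the rays tested at radius \<open>r\<close>.\<close>
  obtain r where r: "q1 * (q0 * (R + q0)) + Q1 < r" "0 < r" "M \<le> r / (2 * \<kappa> r)" by (rule large_radius[OF \<kappa>])
  have "A \<in> star \<kappa> b F -` W \<inter> kbdry a \<kappa>" if A: "A \<in> Unbhd a \<kappa> mX B r" for A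
  proof -
    have Ak: "A \<in> kbdry a \<kappa>" using A by (simp add: Unbhd_def)
    have sA: "star \<kappa> b F A \<in> kbdry b \<kappa>" by (rule star_in_kbdry[OF PX X PY Y \<kappa> F mX Ak])
    have "star \<kappa> b F A \<in> Unbhd b \<kappa> mY B' r'"
      unfolding Unbhd_def
    proof (intro CollectI conjI sA ballI impI allI)
      fix b'' q Q \<alpha>' assume b'': "b'' \<in> B'" "geodesic_ray b b''"
        and "\<alpha>' \<in> star \<kappa> b F A \<and> qg_ray b q Q \<alpha>' \<and> mY B' q Q \<le> r' / (2 * \<kappa> r')"
      then have \<alpha>': "\<alpha>' \<in> star \<kappa> b F A" "qg_ray b q Q \<alpha>'" "mY B' q Q \<le> r' / (2 * \<kappa> r')" by auto
      have "fellow_travel b \<kappa> b'' b'" using kbdry_class(2)[OF \<kappa> B' b'(1)] b''(1) by (auto simp: ray_class_def)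
      then have "b'' t = b' t" if "0 \<le> t" for t
        using geodesic_ray_unique[OF Y \<kappa> b''(2) b'(2) _ that] by (auto simp: fellow_travel_kclose)
      then have img: "ray_img b'' = ray_img b'" unfolding ray_img_def by (intro image_cong) auto
      have "q \<le> q0" "Q \<le> q0" using mY_ge[rule_format, of q Q] \<alpha>'(3) by (auto simp: q0_def)
      then have \<alpha>0: "qg_ray b q0 q0 \<alpha>'" using qg_ray_mono[OF \<alpha>'(2)] by blast
      then obtain \<alpha> where \<alpha>: "qg_ray a q1 Q1 \<alpha>" "\<forall>t\<ge>0. dist (\<alpha> t) (G (\<alpha>' t)) \<le> D" using D(2) by blast
      \<comment> \<open>The neighbourhood condition concerns only members of \<open>A\<close>. The
        pull-back fellow-travels a member \<open>\<alpha>1\<close> mapped forth and back, hence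
        \<open>\<alpha>1\<close> itself.\<close>
      have "\<alpha> \<in> A"
      proof -
        obtain \<alpha>1 where \<alpha>1: "\<alpha>1 \<in> A" "fellow_travel b \<kappa> \<alpha>' (F \<circ> \<alpha>1)" using \<alpha>'(1) by (auto simp: star_def)
        have "fellow_travel a \<kappa> \<alpha> (G \<circ> \<alpha>')" using fellow_travel_bounded[OF \<kappa>, of \<alpha> "G \<circ> \<alpha>'" D a] \<alpha>(2) by simp
        moreover have "fellow_travel a \<kappa> (G \<circ> \<alpha>') (G \<circ> (F \<circ> \<alpha>1))" by (rule fellow_travel_image[OF \<kappa> qi_pair_sym[OF F] \<alpha>1(2)])
        ultimately have "fellow_travel a \<kappa> \<alpha> \<alpha>1"
          using fellow_travel_trans[OF \<kappa>] fellow_travel_GF[OF \<kappa> F, of \<alpha>1] by blast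
        then show ?thesis using kbdry_class(2)[OF \<kappa> Ak \<alpha>1(1)] \<alpha>(1) by (auto simp: ray_class_def quasi_geodesic_ray_def)
      qed
      then have sub: "ray_upto a \<alpha> r \<subseteq> knbhd a \<kappa> (ray_img \<beta>) M"
        using A \<beta> \<alpha>(1) r(3) unfolding Unbhd_def M_def by blast
      define T where "T = first_time b \<alpha>' R"
      have T: "0 \<le> T" "dist b (\<alpha>' T) = R" using first_time_props[OF \<alpha>0 R(1)] by (auto simp: T_def)
      have c0: "coarse_ray q0 q0 \<alpha>'" "\<alpha>' 0 = b" "coarse_ray q1 Q1 \<alpha>" "\<alpha> 0 = a" using \<alpha>0 \<alpha> by (auto simp: qg_ray_coarse)
      have Tq: "T \<le> q0 * (R + q0)" using coarse_ray_lower[OF c0(1), of 0 T] T c0(2) by simp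
      have "\<forall>t\<in>{0..T}. dist a (\<alpha> t) < r"
      proof
        fix t assume t: "t \<in> {0..T}"
        have "dist a (\<alpha> t) \<le> q1 * t + Q1" using coarse_ray_upper[OF c0(3), of 0 t] t c0(4) by simp
        also have "\<dots> \<le> q1 * (q0 * (R + q0)) + Q1" using t Tq c0(3) by (intro add_right_mono mult_left_mono) (auto simp: coarse_ray_def)
        finally show "dist a (\<alpha> t) < r" using r(1) by simp
      qed
      then have "T \<le> first_time a \<alpha> r" by (rule first_time_props(3)[OF \<alpha>(1) less_imp_le[OF r(2)] T(1)])
      then have "\<alpha> T \<in> ray_upto a \<alpha> r" using T by (auto simp: ray_upto_def)
      then have "kclose a \<kappa> M {\<alpha> T} (ray_img \<beta>)" using sub by (auto simp: kclose_def knbhd_def)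
      then have "kclose b \<kappa> n2 {F (\<alpha> T)} (F ` ray_img \<beta>)" using n2[of "{\<alpha> T}" "ray_img \<beta>"] by simp
      then have 3: "kclose b \<kappa> n3 {F (\<alpha> T)} (ray_img b')" using n3 n1 by simp
      have "k * dist (\<alpha> T) (G (\<alpha>' T)) \<le> k * D" using \<alpha>(2) T(1) k(1) by (intro mult_left_mono) auto
      then have "dist (F (\<alpha> T)) (F (G (\<alpha>' T))) \<le> k * D + K" using k(3)[of "\<alpha> T" "G (\<alpha>' T)"] by linarith
      then have "dist (\<alpha>' T) (F (\<alpha> T)) \<le> E" using k(4)[of "\<alpha>' T"] dist_triangle[of "\<alpha>' T" "F (\<alpha> T)" "F (G (\<alpha>' T))"]
        by (simp add: E_def dist_commute)
      then have "kclose b \<kappa> E {\<alpha>' T} {F (\<alpha> T)}" by (intro kclose_bounded_set[OF \<kappa> E]) auto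
      then have "kclose b \<kappa> n4 {\<alpha>' T} (ray_img b')" using n4 3 by simp
      then have "infdist (\<alpha>' T) (ray_img b') \<le> n4 * \<kappa> R" using T by (simp add: kclose_def)
      also have "\<dots> \<le> n * \<kappa> R" using kappa_ge_1[OF \<kappa> R(1)] by (intro mult_right_mono) (auto simp: n_def)
      finally show "ray_upto b \<alpha>' r' \<subseteq> knbhd b \<kappa> (ray_img b'') (mY B' q Q)"
        unfolding img T_def by (rule R(2)[OF \<alpha>'(2,3)])
    qed
    then show ?thesis using r'(2) Ak by auto
  qed
  then show "\<exists>r>0. Unbhd a \<kappa> mX B r \<subseteq> star \<kappa> b F -` W \<inter> kbdry a \<kappa>" using r(2) by blast
qed auto

theorem theorem5p1:
  fixes \<Phi> :: "'a::metric_space \<Rightarrow> 'b::metric_space"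
    and oX :: 'a and k K :: real and \<kappa> :: "real \<Rightarrow> real"
    and mX :: "(real \<Rightarrow> 'a) set \<Rightarrow> real \<Rightarrow> real \<Rightarrow> real"
    and mY :: "(real \<Rightarrow> 'b) set \<Rightarrow> real \<Rightarrow> real \<Rightarrow> real"
  assumes "proper_space (UNIV :: 'a set)" and "CAT0 (UNIV :: 'a set)"
    and "proper_space (UNIV :: 'b set)" and "CAT0 (UNIV :: 'b set)"
    and "quasi_isometry k K \<Phi>"
    and "kappa_fun \<kappa>"
    and "morse_gauge oX \<kappa> mX"
    and "morse_gauge (\<Phi> oX) \<kappa> mY"
  shows "\<exists>f. bij_betw f (kbdry oX \<kappa>) (kbdry (\<Phi> oX) \<kappa>) \<and>
      (\<forall>W. bopen (\<Phi> oX) \<kappa> mY W \<longrightarrow> bopen oX \<kappa> mX (f -` W \<inter> kbdry oX \<kappa>)) \<and>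
      (\<forall>V. bopen oX \<kappa> mX V \<longrightarrow> bopen (\<Phi> oX) \<kappa> mY (f ` V)) \<and>
      (\<forall>B\<in>kbdry oX \<kappa>. \<forall>\<beta>\<in>B.
         (\<exists>\<gamma>. quasi_geodesic_ray (\<Phi> oX) \<gamma> \<and> (\<exists>D. \<forall>t\<ge>0. dist (\<gamma> t) (\<Phi> (\<beta> t)) \<le> D)) \<and>
         (\<forall>\<gamma>. quasi_geodesic_ray (\<Phi> oX) \<gamma> \<and> (\<exists>D. \<forall>t\<ge>0. dist (\<gamma> t) (\<Phi> (\<beta> t)) \<le> D)
               \<longrightarrow> f B = ray_class (\<Phi> oX) \<kappa> \<gamma>))"
proof -
  obtain \<Psi> where F: "qi_pair k (3 * k * K) oX (\<Phi> oX) \<Phi> \<Psi>"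
    by (rule quasi_isometry_qi_pair[OF assms(5)])
  note G = qi_pair_sym[OF F]
  define f where "f = star \<kappa> (\<Phi> oX) \<Phi>"
  define g where "g = star \<kappa> oX \<Psi>"
  have gX: "geodesic_space (UNIV :: 'a set)" and gY: "geodesic_space (UNIV :: 'b set)"
    using assms(2,4) by (auto simp: CAT0_def)
  have fin: "f B \<in> kbdry (\<Phi> oX) \<kappa>" if "B \<in> kbdry oX \<kappa>" for B
    unfolding f_def by (rule star_in_kbdry[OF assms(1-4) assms(6) F assms(7) that])
  have gin: "g B \<in> kbdry oX \<kappa>" if "B \<in> kbdry (\<Phi> oX) \<kappa>" for B
    unfolding g_def by (rule star_in_kbdry[OF assms(3,4,1,2,6) G assms(8) that])
  have gf: "g (f B) = B" if "B \<in> kbdry oX \<kappa>" for B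
    using star_inverse[OF gY assms(6) F that fin[OF that, unfolded f_def]] by (simp add: f_def g_def)
  have fg: "f (g B) = B" if "B \<in> kbdry (\<Phi> oX) \<kappa>" for B
    using star_inverse[OF gX assms(6) G that gin[OF that, unfolded g_def]] by (simp add: f_def g_def)
  have "bij_betw f (kbdry oX \<kappa>) (kbdry (\<Phi> oX) \<kappa>)"
    by (rule bij_betw_byWitness[where f' = g]) (use fin gin gf fg in auto)
  moreover have "bopen oX \<kappa> mX (f -` W \<inter> kbdry oX \<kappa>)" if "bopen (\<Phi> oX) \<kappa> mY W" for W
    unfolding f_def by (rule star_continuous[OF assms(1-4,6) F assms(7,8) that])
  moreover have "bopen (\<Phi> oX) \<kappa> mY (f ` V)" if V: "bopen oX \<kappa> mX V" for V
  proof -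
    have "bopen (\<Phi> oX) \<kappa> mY (g -` V \<inter> kbdry (\<Phi> oX) \<kappa>)"
      unfolding g_def by (rule star_continuous[OF assms(3,4,1,2,6) G assms(8,7) V])
    \<comment> \<open>Images under \<open>f\<close> are preimages under \<open>g\<close>, so
      openness of \<open>f\<close> is continuity of its inverse.\<close>
    moreover have "f ` V = g -` V \<inter> kbdry (\<Phi> oX) \<kappa>"
    proof
      have VB: "V \<subseteq> kbdry oX \<kappa>" using V by (simp add: bopen_def)
      then show "f ` V \<subseteq> g -` V \<inter> kbdry (\<Phi> oX) \<kappa>" using fin gf by auto
      show "g -` V \<inter> kbdry (\<Phi> oX) \<kappa> \<subseteq> f ` V" using fg by (auto intro: rev_image_eqI)
    qed
    ultimately show ?thesis by simp
  qed
  moreover have "\<exists>\<gamma>. quasi_geodesic_ray (\<Phi> oX) \<gamma> \<and> (\<exists>D. \<forall>t\<ge>0. dist (\<gamma> t) (\<Phi> (\<beta> t)) \<le> D)"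
    if "B \<in> kbdry oX \<kappa>" "\<beta> \<in> B" for B \<beta>
    by (rule tame_image[OF gY F kbdry_class(1)[OF assms(6) that]]) blast
  moreover have "f B = ray_class (\<Phi> oX) \<kappa> \<gamma>"
    if "B \<in> kbdry oX \<kappa>" "\<beta> \<in> B" "\<forall>t\<ge>0. dist (\<gamma> t) (\<Phi> (\<beta> t)) \<le> D" for B \<beta> \<gamma> D
    unfolding f_def
    by (rule star_eq[OF assms(6) F that(1,2)]) (use fellow_travel_bounded[OF assms(6), of \<gamma> "\<Phi> \<circ> \<beta>"] that(3) in simp)
  ultimately show ?thesis by (intro exI[of _ f]) blast
qed

end
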